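(* Let $X\subset V\cong\mathbb{C}^{N+1}$ be an irreducible affine variety. Let $Z\subset X$ be an irreducible affine subvariety of codimension $\delta$ in $X$. If $X$ is ED regular given $Z$, then $\mathrm{DL}_{X|Z}$ is irreducible of codimension $\delta$ in $V$.
   Context: $V=\mathbb{C}^{N+1}$ carries the bilinear form $\langle x,y\rangle=\sum_i x_iy_i$, and $q(x)=\langle x,x\rangle$. For a smooth point $x$ of $X$, $T_xX\subset V$ is the linear tangent space and $N_xX=\{y\in V\mid\langle y,v\rangle=0\ \forall v\in T_xX\}$. For $u\in V$, a smooth point $x\in X$ is critical for $d_{X,u}(x)=q(u-x)$ if $u-x\in N_xX$. The ED correspondence of $X$ is $\mathcal{E}_X=\overline{\{(x,u)\in V\times V\mid x\in X_{\rm sm},\ u-x\in N_xX\}}$, and the conditional ED correspondence of $X$ given $Z$ is $\mathcal{E}_{X|Z}=\overline{\{(x,u)\in V\times V\mid x\in X_{\rm sm}\cap Z,\ u-x\in N_xX\}}$. The ED data locus of $X$ given $Z$ is $\mathrm{DL}_{X|Z}=\overline{\mathrm{pr}_2(\mathcal{E}_{X|Z})}\subset V$, where $\mathrm{pr}_2$ is the projection to the second factor. It is assumed that $T_xX\cap N_xX=\{0\}$ at some $x\in X_{\rm sm}$, so that $\mathrm{pr}_2\colon\mathcal{E}_X\to V$ is dominant and there is a dense open subset $\mathcal{U}\subset V$ such that for $u\in\mathcal{U}$ the critical locus $\mathrm{pr}_1(\mathrm{pr}_2^{-1}(u))\subset X$ is zero-dimensional, consists of simple points, and has constant cardinality, denoted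 $\mathrm{EDD}(X)$. $X$ is ED regular given $Z$ if $Z\not\subset X_{\rm sing}$ and $\mathrm{DL}_{X|Z}\not\subset V\setminus\mathcal{U}$. *)

theory Defs
  imports "HOL-Analysis.Analysis" "HOL-Library.Extended_Nat"
begin

section \<open>Affine varieties in complex affine space\<close>

inductive poly_fun :: "(complex ^ 'n \<Rightarrow> complex) \<Rightarrow> bool" where
  const: "poly_fun (\<lambda>x. c)"
| coord: "poly_fun (\<lambda>x. x $ i)"
| add: "poly_fun f \<Longrightarrow> poly_fun g \<Longrightarrow> poly_fun (\<lambda>x. f x + g x)"
| mult: "poly_fun f \<Longrightarrow> poly_fun g \<Longrightarrow> poly_fun (\<lambda>x. f x * g x)"

definition zero_locus :: "(complex ^ 'n \<Rightarrow> complex) set \<Rightarrow> (complex ^ 'n) set" where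
  "zero_locus F = {x. \<forall>f\<in>F. f x = 0}"

definition vanishing_ideal :: "(complex ^ 'n) set \<Rightarrow> (complex ^ 'n \<Rightarrow> complex) set" where
  "vanishing_ideal S = {f. poly_fun f \<and> (\<forall>x\<in>S. f x = 0)}"

definition algebraic_set :: "(complex ^ 'n) set \<Rightarrow> bool" where
  "algebraic_set S \<longleftrightarrow> (\<exists>F. F \<subseteq> Collect poly_fun \<and> S = zero_locus F)"

definition zariski :: "(complex ^ 'n) topology" where
  "zariski = topology (\<lambda>S. algebraic_set (- S))"

lemma algebraic_set_Un:
  assumes "algebraic_set A" "algebraic_set B"
  shows "algebraic_set (A \<union> B)"
proof -
  obtain F G where F: "F \<subseteq> Collect poly_fun" "A = zero_locus F"
    and G: "G \<subseteq> Collect poly_fun" "B = zero_locus G"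
    using assms unfolding algebraic_set_def by blast
  let ?H = "{(\<lambda>x. f x * g x) | f g. f \<in> F \<and> g \<in> G}"
  have "?H \<subseteq> Collect poly_fun"
    using F(1) G(1) by (auto intro: poly_fun.mult)
  moreover have "A \<union> B = zero_locus ?H"
    unfolding F(2) G(2) zero_locus_def by fastforce
  ultimately show ?thesis
    unfolding algebraic_set_def by blast
qed

lemma algebraic_set_Inter:
  assumes "\<And>A. A \<in> \<A> \<Longrightarrow> algebraic_set A"
  shows "algebraic_set (\<Inter>\<A>)"
proof -
  obtain F where F: "\<And>A. A \<in> \<A> \<Longrightarrow> F A \<subseteq> Collect poly_fun \<and> A = zero_locus (F A)"
    using assms unfolding algebraic_set_def by metis
  have "(\<Union>A\<in>\<A>. F A) \<subseteq> Collect poly_fun"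
    using F by blast
  moreover have "\<Inter>\<A> = zero_locus (\<Union>A\<in>\<A>. F A)"
    using F unfolding zero_locus_def by blast
  ultimately show ?thesis
    unfolding algebraic_set_def by blast
qed

lemma openin_zariski:
  fixes S :: "(complex ^ 'n) set"
  shows "openin zariski S \<longleftrightarrow> algebraic_set (- S)"
proof -
  have "istopology (\<lambda>S :: (complex ^ 'n) set. algebraic_set (- S))"
    unfolding istopology_def
  proof (intro conjI allI impI)
    fix S T :: "(complex ^ 'n) set"
    assume "algebraic_set (- S)" "algebraic_set (- T)"
    then show "algebraic_set (- (S \<inter> T))"
      by (simp add: algebraic_set_Un)
  next
    fix \<K> :: "(complex ^ 'n) set set"
    assume "\<forall>K\<in>\<K>. algebraic_set (- K)"
    then have "algebraic_set (\<Inter> (uminus ` \<K>))"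
      by (intro algebraic_set_Inter) auto
    then show "algebraic_set (- \<Union>\<K>)"
      by (simp add: uminus_Sup)
  qed
  then show ?thesis
    by (simp add: zariski_def topology_inverse')
qed

lemma topspace_zariski: "topspace (zariski :: (complex ^ 'n) topology) = UNIV"
proof -
  have "algebraic_set (- (UNIV :: (complex ^ 'n) set))"
    unfolding algebraic_set_def zero_locus_def
    by (rule exI[of _ "{\<lambda>x. 1}"]) (auto intro: poly_fun.const)
  then show ?thesis
    by (metis openin_zariski openin_subset top.extremum_unique)
qed

lemma closedin_zariski: "closedin zariski S \<longleftrightarrow> algebraic_set S"
  by (simp add: closedin_def topspace_zariski openin_zariski Compl_eq_Diff_UNIV[symmetric])

definition irreducible_variety :: "(complex ^ 'n) set \<Rightarrow> bool" where
  "irreducible_variety S \<longleftrightarrow> closedin zariski S \<and> S \<noteq> {} \<and>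
     (\<forall>A B. closedin zariski A \<and> closedin zariski B \<and> S = A \<union> B \<longrightarrow> S = A \<or> S = B)"

text \<open>Krull dimension of a Zariski closed set. Note that the empty set gets dimension 0 here.\<close>

definition variety_dim :: "(complex ^ 'n) set \<Rightarrow> enat" where
  "variety_dim S = Sup {enat k | k. \<exists>C. (\<forall>i\<le>k. irreducible_variety (C i) \<and> C i \<subseteq> S) \<and>
                                        (\<forall>i<k. C i \<subset> C (Suc i))}"

definition has_codim :: "(complex ^ 'n) set \<Rightarrow> (complex ^ 'n) set \<Rightarrow> nat \<Rightarrow> bool" where
  "has_codim Z X \<delta> \<longleftrightarrow> variety_dim X = variety_dim Z + enat \<delta>"

text \<open>The linear (Zariski) tangent space: the common kernel of the differentials at \<open>x\<close> of all
  polynomials vanishing on \<open>X\<close>; the differential is evaluated on \<open>v\<close> as a directional derivative.\<close>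

definition tangent_space :: "(complex ^ 'n) set \<Rightarrow> complex ^ 'n \<Rightarrow> (complex ^ 'n) set" where
  "tangent_space X x = {v. \<forall>f\<in>vanishing_ideal X. deriv (\<lambda>t. f (x + t *s v)) 0 = 0}"

text \<open>Smooth points of an irreducible variety; \<open>vec.dim\<close> is the dimension over the complex
  numbers.\<close>

definition smooth_locus :: "(complex ^ 'n) set \<Rightarrow> (complex ^ 'n) set" where
  "smooth_locus X = {x \<in> X. enat (vec.dim (tangent_space X x)) = variety_dim X}"

definition singular_locus :: "(complex ^ 'n) set \<Rightarrow> (complex ^ 'n) set" where
  "singular_locus X = X - smooth_locus X"


section \<open>Euclidean distance correspondences\<close>

text \<open>The form is bilinear, not Hermitian, so the library's \<open>inner\<close> is not applicable.\<close>

definition bform :: "complex ^ 'n \<Rightarrow> complex ^ 'n \<Rightarrow> complex" where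
  "bform x y = (\<Sum>i\<in>UNIV. x $ i * y $ i)"

definition normal_vectors :: "(complex ^ 'n) set \<Rightarrow> complex ^ 'n \<Rightarrow> (complex ^ 'n) set" where
  "normal_vectors X x = {y. \<forall>v\<in>tangent_space X x. bform y v = 0}"

text \<open>The product \<open>V \<times> V\<close> is the affine space \<open>complex ^ ('n + 'n)\<close>, so that the Zariski notions
  above apply to it; its points are \<open>vpair x u\<close>.\<close>

definition vpair :: "complex ^ 'n \<Rightarrow> complex ^ 'n \<Rightarrow> complex ^ ('n + 'n)" where
  "vpair x u = (\<chi> k. case k of Inl i \<Rightarrow> x $ i | Inr i \<Rightarrow> u $ i)"

definition pr1 :: "complex ^ ('n + 'n) \<Rightarrow> complex ^ 'n" where
  "pr1 p = (\<chi> i. p $ Inl i)"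

definition pr2 :: "complex ^ ('n + 'n) \<Rightarrow> complex ^ 'n" where
  "pr2 p = (\<chi> i. p $ Inr i)"

definition ED_corr :: "(complex ^ 'n) set \<Rightarrow> (complex ^ ('n + 'n)) set" where
  "ED_corr X = zariski closure_of
     {vpair x u | x u. x \<in> smooth_locus X \<and> u - x \<in> normal_vectors X x}"

definition cond_ED_corr ::
    "(complex ^ 'n) set \<Rightarrow> (complex ^ 'n) set \<Rightarrow> (complex ^ ('n + 'n)) set" where
  "cond_ED_corr X Z = zariski closure_of
     {vpair x u | x u. x \<in> smooth_locus X \<inter> Z \<and> u - x \<in> normal_vectors X x}"

definition data_locus :: "(complex ^ 'n) set \<Rightarrow> (complex ^ 'n) set \<Rightarrow> (complex ^ 'n) set" where
  "data_locus X Z = zariski closure_of (pr2 ` cond_ED_corr X Z)"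

definition critical_locus :: "(complex ^ 'n) set \<Rightarrow> complex ^ 'n \<Rightarrow> (complex ^ 'n) set" where
  "critical_locus X u = pr1 ` {p \<in> ED_corr X. pr2 p = u}"

text \<open>Simple means reduced: the Zariski tangent space at \<open>x\<close> of the scheme-theoretic fibre of
  \<open>pr2 : ED_corr X \<rightarrow> V\<close> over \<open>u\<close>, that is, the kernel of the differential of \<open>pr2\<close>, is zero.\<close>

definition simple_critical_point ::
    "(complex ^ 'n) set \<Rightarrow> complex ^ 'n \<Rightarrow> complex ^ 'n \<Rightarrow> bool" where
  "simple_critical_point X u x \<longleftrightarrow> x \<in> critical_locus X u \<and>
     {w \<in> tangent_space (ED_corr X) (vpair x u). pr2 w = 0} = {0}"

text \<open>The properties of the dense open set of generic data; the number \<open>d\<close> is the ED degree.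
  The locus is required to be nonempty because \<open>variety_dim\<close> does not distinguish the empty set
  from zero-dimensional ones.\<close>

definition ED_generic_data :: "(complex ^ 'n) set \<Rightarrow> (complex ^ 'n) set \<Rightarrow> bool" where
  "ED_generic_data X U \<longleftrightarrow> openin zariski U \<and> zariski closure_of U = UNIV \<and>
     (\<forall>u\<in>U. critical_locus X u \<noteq> {} \<and> variety_dim (critical_locus X u) = 0 \<and>
            (\<forall>x\<in>critical_locus X u. simple_critical_point X u x)) \<and>
     (\<exists>d. \<forall>u\<in>U. card (critical_locus X u) = d)"

definition ED_regular ::
    "(complex ^ 'n) set \<Rightarrow> (complex ^ 'n) set \<Rightarrow> (complex ^ 'n) set \<Rightarrow> bool" where
  "ED_regular U X Z \<longleftrightarrow> \<not> Z \<subseteq> singular_locus X \<and> \<not> data_locus X Z \<subseteq> UNIV - U"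

end

theory Submission
  imports Defs "HOL-Computational_Algebra.Fundamental_Theorem_Algebra"
begin

text \<open>
  The Krull dimension of an irreducible variety equals the largest number of algebraically
  independent coordinates and also the generic dimension of its tangent spaces. The points
  \<open>(x, u)\<close> with \<open>x\<close> in \<open>Z\<close> smooth on \<open>X\<close> and \<open>u - x\<close> normal form an affine bundle of rank
  \<open>codim X\<close> over an open part of \<open>Z\<close>, so they are irreducible of dimension
  \<open>dim Z + codim X = dim V - \<delta>\<close>. ED regularity provides a point of the conditional correspondence
  that is a simple critical point. There the second projection is injective on tangent vectors, by
  semicontinuity it is so generically, and hence the image has the same dimension.
\<close>


section \<open>Polynomial functions\<close>

text \<open>The arguments use points and polynomial functions only; neither Hilbert's basis theorem
  nor the Nullstellensatz enters. This shapes the lower bound for the Krull dimension: an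
  irreducible closed subset of dimension exactly one less is needed, but a hyperplane section cannot
  be split into finitely many components. A minimal closed set replaces the component, and chains of
  closed sets are controlled by constructing actual points, one coordinate at a time. Primality
  (\<open>zprime\<close>) is stated for arbitrary sets, so it applies to the incidence set and to
  its projection before any closure is taken. Characteristic zero enters through relations of
  minimal degree: their derivative in the new coordinate does not vanish identically. The point
  given by ED regularity lies in a closure. It may be outside the incidence set and need not be
  generic on the correspondence, so nothing but the trivial kernel of the projection is used there.
  Triviality of this kernel passes to subvarieties, and it persists on an open set around the point,
  which meets the generic locus.\<close>

lemma poly_fun_uminus: "poly_fun f \<Longrightarrow> poly_fun (\<lambda>x. - f x)"
  using poly_fun.mult[OF poly_fun.const[of "-1"]] by force

lemma poly_fun_diff: "poly_fun f \<Longrightarrow> poly_fun g \<Longrightarrow> poly_fun (\<lambda>x. f x - g x)"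
  using poly_fun.add[OF _ poly_fun_uminus] by force

lemma poly_fun_power: "poly_fun f \<Longrightarrow> poly_fun (\<lambda>x. f x ^ k)"
  by (induction k) (auto intro: poly_fun.const poly_fun.mult)

lemma poly_fun_sum: "(\<And>i. i \<in> I \<Longrightarrow> poly_fun (f i)) \<Longrightarrow> poly_fun (\<lambda>x. \<Sum>i\<in>I. f i x)"
  by (induction I rule: infinite_finite_induct) (auto intro: poly_fun.const poly_fun.add)

lemma poly_fun_prod: "(\<And>i. i \<in> I \<Longrightarrow> poly_fun (f i)) \<Longrightarrow> poly_fun (\<lambda>x. \<Prod>i\<in>I. f i x)"
  by (induction I rule: infinite_finite_induct) (auto intro: poly_fun.const poly_fun.mult)

lemmas poly_fun_intros = poly_fun.intros poly_fun_uminus poly_fun_diff poly_fun_power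
  poly_fun_sum poly_fun_prod

lemma poly_fun_compose:
  assumes "poly_fun f" and "\<And>i. poly_fun (\<lambda>x. \<phi> x $ i)"
  shows "poly_fun (\<lambda>x. f (\<phi> x))"
  using assms(1) by induction (auto intro: poly_fun.intros assms(2))

lemma poly_fun_line:
  assumes "poly_fun f"
  shows "\<exists>q. \<forall>t. poly q t = f (x + t *s v)"
  using assms
proof induction
  case (const c)
  show ?case by (intro exI[of _ "[:c:]"]) auto
next
  case (coord i)
  show ?case by (intro exI[of _ "[:x $ i, v $ i:]"]) (auto simp: algebra_simps)
next
  case (add f g)
  then obtain p q where "\<forall>t. poly p t = f (x + t *s v)" "\<forall>t. poly q t = g (x + t *s v)"
    by blast
  then show ?case by (intro exI[of _ "p + q"]) auto
next
  case (mult f g)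
  then obtain p q where "\<forall>t. poly p t = f (x + t *s v)" "\<forall>t. poly q t = g (x + t *s v)"
    by blast
  then show ?case by (intro exI[of _ "p * q"]) auto
qed

text \<open>The polynomial ring in the variables from \<open>S\<close>, recognised by values:
  membership means independence of the remaining coordinates, so it can be verified without a normal
  form.\<close>

definition poly_in :: "'n set \<Rightarrow> (complex ^ 'n \<Rightarrow> complex) \<Rightarrow> bool" where
  "poly_in S f \<longleftrightarrow> poly_fun f \<and> (\<forall>x y. (\<forall>i\<in>S. x $ i = y $ i) \<longrightarrow> f x = f y)"

lemma poly_inI:
  "poly_fun f \<Longrightarrow> (\<And>x y. (\<And>i. i \<in> S \<Longrightarrow> x $ i = y $ i) \<Longrightarrow> f x = f y) \<Longrightarrow> poly_in S f"
  unfolding poly_in_def by blast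

lemma poly_in_imp_poly_fun: "poly_in S f \<Longrightarrow> poly_fun f"
  unfolding poly_in_def by blast

lemma poly_in_cong: "poly_in S f \<Longrightarrow> (\<And>i. i \<in> S \<Longrightarrow> x $ i = y $ i) \<Longrightarrow> f x = f y"
  unfolding poly_in_def by blast

lemma poly_in_UNIV: "poly_in UNIV f \<longleftrightarrow> poly_fun f"
  unfolding poly_in_def by (metis UNIV_I vec_eq_iff)

lemma poly_in_mono: "poly_in S f \<Longrightarrow> S \<subseteq> T \<Longrightarrow> poly_in T f"
  unfolding poly_in_def by blast

lemma poly_in_const: "poly_in S (\<lambda>x. c)"
  unfolding poly_in_def by (auto intro: poly_fun.intros)

lemma poly_in_coord: "i \<in> S \<Longrightarrow> poly_in S (\<lambda>x. x $ i)"
  unfolding poly_in_def by (auto intro: poly_fun.intros)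

lemma poly_in_add: "poly_in S f \<Longrightarrow> poly_in S g \<Longrightarrow> poly_in S (\<lambda>x. f x + g x)"
  unfolding poly_in_def by (metis poly_fun.add)

lemma poly_in_mult: "poly_in S f \<Longrightarrow> poly_in S g \<Longrightarrow> poly_in S (\<lambda>x. f x * g x)"
  unfolding poly_in_def by (metis poly_fun.mult)

lemma poly_in_diff: "poly_in S f \<Longrightarrow> poly_in S g \<Longrightarrow> poly_in S (\<lambda>x. f x - g x)"
  unfolding poly_in_def by (metis poly_fun_diff)

lemma poly_in_power: "poly_in S f \<Longrightarrow> poly_in S (\<lambda>x. f x ^ k)"
  unfolding poly_in_def by (metis poly_fun_power)

lemma poly_in_sum: "(\<And>i. i \<in> I \<Longrightarrow> poly_in S (f i)) \<Longrightarrow> poly_in S (\<lambda>x. \<Sum>i\<in>I. f i x)"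
  by (induction I rule: infinite_finite_induct) (auto intro: poly_in_const poly_in_add)

lemma poly_in_prod: "(\<And>i. i \<in> I \<Longrightarrow> poly_in S (f i)) \<Longrightarrow> poly_in S (\<lambda>x. \<Prod>i\<in>I. f i x)"
  by (induction I rule: infinite_finite_induct) (auto intro: poly_in_const poly_in_mult)

lemmas poly_in_intros = poly_in_const poly_in_coord poly_in_add poly_in_mult poly_in_diff
  poly_in_power poly_in_sum poly_in_prod

text \<open>A polynomial in the coordinate \<open>i\<close> with coefficient functions
  \<open>a k\<close>. The index \<open>d\<close> counts terms: a polynomial of degree
  \<open>d\<close> with leading coefficient \<open>a d\<close> is written
  \<open>psum a (Suc d) i\<close>, and a remainder of degree below \<open>d\<close> is
  \<open>psum r d i\<close>.\<close>

definition psum :: "(nat \<Rightarrow> complex ^ 'n \<Rightarrow> complex) \<Rightarrow> nat \<Rightarrow> 'n \<Rightarrow> complex ^ 'n \<Rightarrow> complex" where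
  "psum a d i x = (\<Sum>k<d. a k x * x $ i ^ k)"

lemma psum_0 [simp]: "psum a 0 i = (\<lambda>x. 0)"
  by (auto simp: psum_def)

lemma psum_Suc: "psum a (Suc d) i x = psum a d i x + a d x * x $ i ^ d"
  by (simp add: psum_def)

lemma psum_pad: "e \<le> d \<Longrightarrow> psum (\<lambda>k. if k < e then a k else (\<lambda>x. 0)) d i = psum a e i"
proof
  fix x assume "e \<le> d"
  then have "{..<d} = {..<e} \<union> {e..<d}" by auto
  then have "psum (\<lambda>k. if k < e then a k else (\<lambda>x. 0)) d i x =
      (\<Sum>k<e. (if k < e then a k else (\<lambda>x. 0)) x * x $ i ^ k) +
      (\<Sum>k\<in>{e..<d}. (if k < e then a k else (\<lambda>x. 0)) x * x $ i ^ k)"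
    unfolding psum_def by (simp add: sum.union_disjoint ivl_disj_int)
  then show "psum (\<lambda>k. if k < e then a k else (\<lambda>x. 0)) d i x = psum a e i x"
    by (simp add: psum_def)
qed

lemma poly_in_psum: "(\<And>k. poly_in S (a k)) \<Longrightarrow> poly_in (insert i S) (psum a d i)"
  unfolding psum_def [abs_def]
  by (intro poly_in_intros) (auto intro: poly_in_mono)

lemma poly_fun_decomp:
  fixes f :: "complex ^ 'n \<Rightarrow> complex"
  assumes "poly_fun f"
  shows "\<exists>a d. (\<forall>k. poly_in (- {i}) (a k)) \<and> f = psum a d i"
  using assms
proof induction
  case (const c)
  show ?case
    by (intro exI[of _ "\<lambda>k x. c"] exI[of _ 1]) (auto simp: psum_def poly_in_const)
next
  case (coord j)
  show ?case
  proof (cases "j = i")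
    case True
    then show ?thesis
      by (intro exI[of _ "\<lambda>k x. if k = 1 then 1 else 0"] exI[of _ 2])
        (auto simp: psum_def poly_in_const numeral_2_eq_2)
  next
    case False
    then show ?thesis
      by (intro exI[of _ "\<lambda>k x. x $ j"] exI[of _ 1]) (auto simp: psum_def poly_in_coord)
  qed
next
  case (add f g)
  then obtain a d b e where a: "\<forall>k. poly_in (- {i}) (a k)" "f = psum a d i"
    and b: "\<forall>k. poly_in (- {i}) (b k)" "g = psum b e i" by metis
  define a' b' where "a' = (\<lambda>k. if k < d then a k else (\<lambda>x. 0))"
    and "b' = (\<lambda>k. if k < e then b k else (\<lambda>x. 0))"
  have "f = psum a' (max d e) i" "g = psum b' (max d e) i"
    unfolding a'_def b'_def a(2) b(2) by (simp_all add: psum_pad)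
  moreover have "\<forall>k. poly_in (- {i}) (a' k)" "\<forall>k. poly_in (- {i}) (b' k)"
    using a b by (auto simp: a'_def b'_def poly_in_const)
  ultimately show ?case
    by (intro exI[of _ "\<lambda>k x. a' k x + b' k x"] exI[of _ "max d e"])
      (auto simp: psum_def sum.distrib algebra_simps intro: poly_in_add)
next
  case (mult f g)
  then obtain a d b e where a: "\<forall>k. poly_in (- {i}) (a k)" "f = psum a d i"
    and b: "\<forall>k. poly_in (- {i}) (b k)" "g = psum b e i" by metis
  define c where "c = (\<lambda>m x. \<Sum>(k, l) \<in> {p \<in> {..<d} \<times> {..<e}. fst p + snd p = m}. a k x * b l x)"
  have "poly_in (- {i}) (c m)" for m
    unfolding c_def using a b by (intro poly_in_sum) (auto split: prod.split intro: poly_in_mult)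
  moreover have "f x * g x = psum c (d + e) i x" for x
  proof -
    have "f x * g x = (\<Sum>(k, l) \<in> {..<d} \<times> {..<e}. (a k x * b l x) * x $ i ^ (k + l))"
      unfolding a(2) b(2) psum_def sum_product sum.cartesian_product
      by (intro sum.cong) (auto simp: power_add)
    also have "\<dots> = (\<Sum>m<d+e. \<Sum>p \<in> {p \<in> {..<d} \<times> {..<e}. fst p + snd p = m}.
        case p of (k, l) \<Rightarrow> (a k x * b l x) * x $ i ^ (k + l))"
      by (intro sum.group [symmetric]) auto
    also have "\<dots> = psum c (d + e) i x"
      unfolding psum_def c_def
      by (intro sum.cong refl) (auto simp: sum_distrib_right intro!: sum.cong)
    finally show ?thesis .
  qed
  ultimately show ?case by blast
qed

lemma poly_in_decomp:
  fixes f :: "complex ^ 'n \<Rightarrow> complex"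
  assumes "poly_in (insert i S) f" "i \<notin> S"
  obtains a d where "\<And>k. poly_in S (a k)" "f = psum a d i"
proof -
  obtain a d where a: "\<forall>k. poly_in (- {i}) (a k)" "f = psum a d i"
    using poly_fun_decomp assms(1) poly_in_imp_poly_fun by metis
  \<comment> \<open>Setting the coordinates outside \<open>insert i S\<close> to zero does not
    change \<open>f\<close>, but makes the coefficients depend on \<open>S\<close> alone.\<close>
  define \<pi> :: "complex ^ 'n \<Rightarrow> complex ^ 'n"
    where "\<pi> = (\<lambda>x. \<chi> j. if j \<in> insert i S then x $ j else 0)"
  define a' where "a' = (\<lambda>k x. a k (\<pi> x))"
  have "poly_in S (a' k)" for k
  proof (rule poly_inI)
    have "poly_fun (\<lambda>x. \<pi> x $ j)" for j
      unfolding \<pi>_def by (cases "j = i \<or> j \<in> S") (auto intro: poly_fun.intros)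
    then show "poly_fun (a' k)"
      unfolding a'_def using a poly_in_imp_poly_fun by (metis poly_fun_compose)
    show "a' k x = a' k y" if "\<And>j. j \<in> S \<Longrightarrow> x $ j = y $ j" for x y
      unfolding a'_def
      by (rule poly_in_cong[of "- {i}"]) (use a that in \<open>auto simp: \<pi>_def\<close>)
  qed
  moreover have "f = psum a' d i"
  proof
    fix x
    have "f x = f (\<pi> x)"
      using assms(1) by (rule poly_in_cong) (auto simp: \<pi>_def)
    also have "\<dots> = psum a' d i x"
      unfolding a(2) psum_def a'_def by (simp add: \<pi>_def)
    finally show "f x = psum a' d i x" .
  qed
  ultimately show ?thesis using that by blast
qed

text \<open>One elimination step of long division. The number of terms stays \<open>d + m\<close>,
  so a cancelled top term appears as a zero coefficient, to be dropped where the identity is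
  applied.\<close>

lemma psum_shift:
  "psum (\<lambda>k x. c x * b k x - (if k < m then 0 else g x * a (k - m) x)) (d + m) i x =
    c x * psum b (d + m) i x - g x * x $ i ^ m * psum a d i x"
proof -
  have "(\<Sum>k<d + m. (if k < m then 0 else a (k - m) x) * x $ i ^ k) =
      (\<Sum>k\<in>{m..<d + m}. a (k - m) x * x $ i ^ k)"
    by (intro sum.mono_neutral_cong_right) auto
  also have "\<dots> = (\<Sum>k\<in>{0..<d}. a k x * x $ i ^ (k + m))"
    using sum.shift_bounds_nat_ivl[of "\<lambda>k. a (k - m) x * x $ i ^ k" 0 m d] by simp
  also have "\<dots> = x $ i ^ m * psum a d i x"
    unfolding psum_def sum_distrib_left by (rule sum.cong) (auto simp: power_add)
  finally have *: "(\<Sum>k<d + m. (if k < m then 0 else a (k - m) x) * x $ i ^ k) =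
    x $ i ^ m * psum a d i x" .
  have "psum (\<lambda>k x. c x * b k x - (if k < m then 0 else g x * a (k - m) x)) (d + m) i x =
      c x * psum b (d + m) i x - g x * (\<Sum>k<d + m. (if k < m then 0 else a (k - m) x) * x $ i ^ k)"
    unfolding psum_def sum_distrib_left sum_subtractf[symmetric]
    by (rule sum.cong) (auto simp: algebra_simps)
  then show ?thesis unfolding * by (simp add: algebra_simps)
qed

text \<open>Long division without inverting the leading coefficient \<open>a d\<close>: each step
  multiplies the dividend by it. The last clause records the top coefficient of the quotient because
  \<open>eliminate_coordinate\<close> has to recognise it as a product of powers of the two leading
  coefficients.\<close>

lemma pseudo_division:
  fixes a b :: "nat \<Rightarrow> complex ^ 'n \<Rightarrow> complex"
  assumes a: "\<And>k. poly_in S (a k)" and b: "\<And>k. poly_in S (b k)"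
  shows "\<exists>q r. (\<forall>k. poly_in S (q k)) \<and> (\<forall>k. poly_in S (r k)) \<and>
    (\<forall>x. a d x ^ Suc m * psum b (Suc (d + m)) i x =
      psum q (Suc m) i x * psum a (Suc d) i x + psum r d i x) \<and>
    q m = (\<lambda>x. a d x ^ m * b (d + m) x)"
  using b
proof (induction m arbitrary: b)
  case 0
  show ?case
    by (rule exI[of _ "\<lambda>k. b d"], rule exI[of _ "\<lambda>k x. a d x * b k x - b d x * a k x"])
      (use 0 a in \<open>auto simp: psum_def sum_subtractf sum_distrib_left algebra_simps
        intro!: poly_in_intros\<close>)
next
  case (Suc m)
  \<comment> \<open>The coefficient of \<open>b'\<close> at \<open>d + Suc m\<close> is zero, so
    \<open>b'\<close> has one term less and the induction hypothesis applies to it.\<close>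
  define b' where "b' = (\<lambda>k x. a d x * b k x -
    (if k < Suc m then 0 else b (d + Suc m) x * a (k - Suc m) x))"
  have "poly_in S (b' k)" for k
    unfolding b'_def using Suc.prems a
    by (cases "k < Suc m") (auto intro!: poly_in_intros)
  from Suc.IH[of b', OF this] obtain q r where
    q: "\<forall>k. poly_in S (q k)" "\<forall>k. poly_in S (r k)"
    "\<forall>x. a d x ^ Suc m * psum b' (Suc (d + m)) i x =
      psum q (Suc m) i x * psum a (Suc d) i x + psum r d i x" by metis
  define q' where "q' = (\<lambda>k. if k < Suc m then q k else (\<lambda>x. a d x ^ Suc m * b (d + Suc m) x))"
  have b': "psum b' (Suc (d + m)) i x = a d x * psum b (Suc (d + Suc m)) i x -
      b (d + Suc m) x * x $ i ^ Suc m * psum a (Suc d) i x" for x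
  proof -
    have "psum b' (Suc (d + m)) i x = psum b' (Suc d + Suc m) i x"
      by (simp add: psum_def b'_def)
    then show ?thesis
      using psum_shift[of "a d" b "Suc m" "b (d + Suc m)" a "Suc d" i x]
      by (simp add: b'_def)
  qed
  have q': "psum q' (Suc (Suc m)) i x = psum q (Suc m) i x +
      a d x ^ Suc m * b (d + Suc m) x * x $ i ^ Suc m" for x
    by (subst psum_Suc) (simp add: psum_def q'_def)
  show ?case
  proof (rule exI[of _ q'], rule exI[of _ r], intro conjI allI)
    fix x
    have "a d x ^ Suc (Suc m) * psum b (Suc (d + Suc m)) i x =
      a d x ^ Suc m * psum b' (Suc (d + m)) i x +
      a d x ^ Suc m * b (d + Suc m) x * x $ i ^ Suc m * psum a (Suc d) i x"
      unfolding b' by (simp add: algebra_simps)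
    then show "a d x ^ Suc (Suc m) * psum b (Suc (d + Suc m)) i x =
      psum q' (Suc (Suc m)) i x * psum a (Suc d) i x + psum r d i x"
      unfolding q' using q(3) by (simp add: algebra_simps)
  qed (use q a Suc.prems in \<open>auto simp: q'_def intro!: poly_in_intros\<close>)
qed


section \<open>Vanishing ideals and irreducibility\<close>

lemma vanishing_idealI: "poly_fun f \<Longrightarrow> (\<And>x. x \<in> W \<Longrightarrow> f x = 0) \<Longrightarrow> f \<in> vanishing_ideal W"
  unfolding vanishing_ideal_def by blast

lemma vanishing_idealD:
  "f \<in> vanishing_ideal W \<Longrightarrow> x \<in> W \<Longrightarrow> f x = 0"
  "f \<in> vanishing_ideal W \<Longrightarrow> poly_fun f"
  unfolding vanishing_ideal_def by blast+

lemma vanishing_ideal_add: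
  "f \<in> vanishing_ideal W \<Longrightarrow> g \<in> vanishing_ideal W \<Longrightarrow> (\<lambda>x. f x + g x) \<in> vanishing_ideal W"
  unfolding vanishing_ideal_def by (auto intro: poly_fun.intros)

lemma vanishing_ideal_diff:
  "f \<in> vanishing_ideal W \<Longrightarrow> g \<in> vanishing_ideal W \<Longrightarrow> (\<lambda>x. f x - g x) \<in> vanishing_ideal W"
  unfolding vanishing_ideal_def by (auto intro: poly_fun_diff)

lemma vanishing_ideal_mult:
  "f \<in> vanishing_ideal W \<Longrightarrow> poly_fun g \<Longrightarrow> (\<lambda>x. g x * f x) \<in> vanishing_ideal W"
  unfolding vanishing_ideal_def by (auto intro: poly_fun.intros)

lemma vanishing_ideal_antimono: "A \<subseteq> B \<Longrightarrow> vanishing_ideal B \<subseteq> vanishing_ideal A"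
  unfolding vanishing_ideal_def by blast

lemma closedin_zariski_zero_locus:
  "F \<subseteq> Collect poly_fun \<Longrightarrow> closedin zariski (zero_locus F)"
  unfolding closedin_zariski algebraic_set_def by blast

lemma closedin_zariski_iff:
  "closedin zariski W \<longleftrightarrow> zero_locus (vanishing_ideal W) = W"
proof
  assume "closedin zariski W"
  then obtain F where "F \<subseteq> Collect poly_fun" "W = zero_locus F"
    unfolding closedin_zariski algebraic_set_def by blast
  then show "zero_locus (vanishing_ideal W) = W"
    unfolding vanishing_ideal_def zero_locus_def by blast
next
  assume "zero_locus (vanishing_ideal W) = W"
  then show "closedin zariski W"
    using closedin_zariski_zero_locus[of "vanishing_ideal W"]
    by (auto simp: vanishing_ideal_def)
qed

lemma closedin_zariski_hypersurface: "poly_fun f \<Longrightarrow> closedin zariski {x. f x = 0}"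
  using closedin_zariski_zero_locus[of "{f}"] by (simp add: zero_locus_def)

lemma zariski_closure_of:
  fixes A :: "(complex ^ 'n) set"
  shows "zariski closure_of A = zero_locus (vanishing_ideal A)"
proof (rule antisym)
  show "zariski closure_of A \<subseteq> zero_locus (vanishing_ideal A)"
    by (intro closure_of_minimal closedin_zariski_zero_locus)
      (auto simp: zero_locus_def vanishing_ideal_def)
  have "A \<subseteq> zariski closure_of A"
    by (simp add: closure_of_subset topspace_zariski)
  then have "zero_locus (vanishing_ideal A) \<subseteq> zero_locus (vanishing_ideal (zariski closure_of A))"
    using vanishing_ideal_antimono unfolding zero_locus_def by blast
  then show "zero_locus (vanishing_ideal A) \<subseteq> zariski closure_of A"
    using closedin_zariski_iff closedin_closure_of by metis
qed

lemma vanishing_ideal_closure_of: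
  fixes A :: "(complex ^ 'n) set"
  shows "vanishing_ideal (zariski closure_of A) = vanishing_ideal A"
  unfolding zariski_closure_of by (auto simp: vanishing_ideal_def zero_locus_def)

lemma subset_zariski_closure_of:
  fixes A :: "(complex ^ 'n) set"
  shows "A \<subseteq> zariski closure_of A"
  by (simp add: closure_of_subset topspace_zariski)

text \<open>Equivalently, the vanishing ideal of \<open>W\<close> is prime.\<close>

definition zprime :: "(complex ^ 'n) set \<Rightarrow> bool" where
  "zprime W \<longleftrightarrow> W \<noteq> {} \<and> (\<forall>f g. poly_fun f \<longrightarrow> poly_fun g \<longrightarrow>
     f \<notin> vanishing_ideal W \<longrightarrow> g \<notin> vanishing_ideal W \<longrightarrow> (\<exists>x\<in>W. f x \<noteq> 0 \<and> g x \<noteq> 0))"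

lemma zprimeE:
  assumes "zprime W" "poly_fun f" "poly_fun g"
    "f \<notin> vanishing_ideal W" "g \<notin> vanishing_ideal W"
  obtains x where "x \<in> W" "f x \<noteq> 0" "g x \<noteq> 0"
  using assms unfolding zprime_def by blast

lemma zprime_mult:
  assumes "zprime W" "poly_fun f" "poly_fun g" "(\<lambda>x. f x * g x) \<in> vanishing_ideal W"
    "f \<notin> vanishing_ideal W"
  shows "g \<in> vanishing_ideal W"
  using zprimeE[OF assms(1-3,5)] vanishing_idealD(1)[OF assms(4)] by (metis mult_eq_0_iff)

lemma zprime_power:
  assumes "zprime W" "poly_fun f" "f \<notin> vanishing_ideal W"
  shows "(\<lambda>x. f x ^ k) \<notin> vanishing_ideal W"
  using assms unfolding vanishing_ideal_def by (auto simp: poly_fun_power)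

text \<open>Primality depends on the vanishing ideal alone, since even nonemptiness says that the
  constant 1 is not in it. This carries primality from a set to its closure.\<close>

lemma zprime_cong: "zprime W \<Longrightarrow> vanishing_ideal W = vanishing_ideal W' \<Longrightarrow> zprime W'"
proof -
  assume W: "zprime W" "vanishing_ideal W = vanishing_ideal W'"
  have "(\<lambda>x. 1) \<notin> vanishing_ideal W"
    using W(1) unfolding zprime_def vanishing_ideal_def by auto
  then have "W' \<noteq> {}"
    unfolding W(2) by (auto simp: vanishing_ideal_def intro: poly_fun.intros)
  moreover have "\<exists>x\<in>W'. f x \<noteq> 0 \<and> g x \<noteq> 0"
    if "poly_fun f" "poly_fun g" "f \<notin> vanishing_ideal W'" "g \<notin> vanishing_ideal W'" for f g
  proof (rule ccontr)
    assume "\<not> ?thesis"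
    then have "(\<lambda>x. f x * g x) \<in> vanishing_ideal W"
      unfolding W(2) using that by (auto intro!: vanishing_idealI poly_fun.intros)
    from zprime_mult[OF W(1) that(1,2) this] that(3,4) W(2) show False by blast
  qed
  ultimately show ?thesis unfolding zprime_def by blast
qed

text \<open>A cover by two closed sets corresponds to a product of two polynomials: each factor
  separates a point of \<open>W\<close> from one of the two pieces.\<close>

lemma irreducible_variety_iff:
  fixes W :: "(complex ^ 'n) set"
  shows "irreducible_variety W \<longleftrightarrow> closedin zariski W \<and> zprime W"
proof
  assume W: "irreducible_variety W"
  have "\<exists>x\<in>W. f x \<noteq> 0 \<and> g x \<noteq> 0"
    if fg: "poly_fun f" "poly_fun g" "f \<notin> vanishing_ideal W" "g \<notin> vanishing_ideal W" for f g
  proof (rule ccontr)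
    assume "\<not> ?thesis"
    then have "W = (W \<inter> {x. f x = 0}) \<union> (W \<inter> {x. g x = 0})" by blast
    moreover have "closedin zariski (W \<inter> {x. f x = 0})" "closedin zariski (W \<inter> {x. g x = 0})"
      using W fg closedin_zariski_hypersurface unfolding irreducible_variety_def by blast+
    ultimately have "W = W \<inter> {x. f x = 0} \<or> W = W \<inter> {x. g x = 0}"
      using W unfolding irreducible_variety_def by blast
    then have "W \<subseteq> {x. f x = 0} \<or> W \<subseteq> {x. g x = 0}" by blast
    then show False using fg unfolding vanishing_ideal_def by blast
  qed
  then show "closedin zariski W \<and> zprime W"
    using W unfolding irreducible_variety_def zprime_def by blast
next
  assume W: "closedin zariski W \<and> zprime W"
  have "W = A \<or> W = B"
    if AB: "closedin zariski A" "closedin zariski B" "W = A \<union> B" for A B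
  proof (rule ccontr)
    assume "\<not> ?thesis"
    then obtain x y where "x \<in> W" "x \<notin> A" "y \<in> W" "y \<notin> B" using AB(3) by blast
    moreover have "zero_locus (vanishing_ideal A) = A" "zero_locus (vanishing_ideal B) = B"
      using AB(1,2) by (simp_all add: closedin_zariski_iff)
    ultimately obtain f g where fg: "f \<in> vanishing_ideal A" "f x \<noteq> 0"
      "g \<in> vanishing_ideal B" "g y \<noteq> 0"
      unfolding zero_locus_def by blast
    then have "f \<notin> vanishing_ideal W" "g \<notin> vanishing_ideal W"
      using \<open>x \<in> W\<close> \<open>y \<in> W\<close> vanishing_idealD(1) by blast+
    then obtain z where "z \<in> W" "f z \<noteq> 0" "g z \<noteq> 0"
      using W vanishing_idealD(2)[OF fg(1)] vanishing_idealD(2)[OF fg(3)] unfolding zprime_def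
      by blast
    then show False using AB(3) fg vanishing_idealD(1) by blast
  qed
  moreover have "W \<noteq> {}" using W unfolding zprime_def by simp
  ultimately show "irreducible_variety W"
    using W unfolding irreducible_variety_def by blast
qed

lemma irreducible_closure_of:
  assumes "zprime A"
  shows "irreducible_variety (zariski closure_of A)"
  unfolding irreducible_variety_iff
  using zprime_cong[OF assms vanishing_ideal_closure_of[symmetric]] closedin_closure_of
  by (intro conjI)

text \<open>On the line through a point with \<open>f\<close> nonzero and a point with
  \<open>g\<close> nonzero, both become nonzero polynomials in one variable, and their product has
  finitely many roots.\<close>

lemma zprime_affine:
  fixes A :: "(complex ^ 'n) set"
  assumes "A \<noteq> {}" and line: "\<And>x y t. x \<in> A \<Longrightarrow> y \<in> A \<Longrightarrow> x + t *s (y - x) \<in> A"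
  shows "zprime A"
  unfolding zprime_def
proof (intro conjI allI impI)
  fix f g :: "complex ^ 'n \<Rightarrow> complex"
  assume fg: "poly_fun f" "poly_fun g" "f \<notin> vanishing_ideal A" "g \<notin> vanishing_ideal A"
  obtain x y where xy: "x \<in> A" "f x \<noteq> 0" "y \<in> A" "g y \<noteq> 0"
    using fg unfolding vanishing_ideal_def by blast
  obtain p q where p: "\<forall>t. poly p t = f (x + t *s (y - x))"
    and q: "\<forall>t. poly q t = g (x + t *s (y - x))"
    using poly_fun_line fg by metis
  have "poly p 0 \<noteq> 0" "poly q 1 \<noteq> 0" using p q xy by auto
  then have "p * q \<noteq> 0" by auto
  then have "finite {t. poly (p * q) t = 0}" by (rule poly_roots_finite)
  moreover have "infinite (UNIV :: complex set)" by (rule infinite_UNIV_char_0)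
  ultimately obtain t where "poly (p * q) t \<noteq> 0"
    using finite_subset[of UNIV "{t. poly (p * q) t = 0}"] by blast
  then show "\<exists>x\<in>A. f x \<noteq> 0 \<and> g x \<noteq> 0"
    using p q line xy by auto
qed (rule assms(1))

lemma zprime_UNIV: "zprime (UNIV :: (complex ^ 'n) set)"
  by (rule zprime_affine) auto

lemma vanishing_ideal_UNIV: "f \<in> vanishing_ideal UNIV \<longleftrightarrow> f = (\<lambda>x. 0)"
  unfolding vanishing_ideal_def by (auto intro: poly_fun.intros)

lemma poly_fun_mult_nonzero:
  assumes "poly_fun f" "poly_fun g" "f \<noteq> (\<lambda>x. 0)" "g \<noteq> (\<lambda>x. 0)"
  shows "\<exists>x. f x \<noteq> 0 \<and> g x \<noteq> 0"
  using zprime_UNIV assms unfolding zprime_def vanishing_ideal_UNIV by blast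

lemma zprime_prod:
  assumes "zprime W" "finite I" "\<And>i. i \<in> I \<Longrightarrow> poly_fun (f i) \<and> f i \<notin> vanishing_ideal W"
  shows "(\<lambda>x. \<Prod>i\<in>I. f i x) \<notin> vanishing_ideal W"
  using assms(2,3)
proof (induction I rule: finite_induct)
  case empty
  then show ?case using assms(1) unfolding zprime_def vanishing_ideal_def by auto
next
  case (insert i I)
  show ?case
  proof
    assume "(\<lambda>x. \<Prod>i\<in>insert i I. f i x) \<in> vanishing_ideal W"
    then have "(\<lambda>x. f i x * (\<Prod>i\<in>I. f i x)) \<in> vanishing_ideal W"
      using insert by simp
    from zprime_mult[OF assms(1) _ _ this] have "(\<lambda>x. \<Prod>i\<in>I. f i x) \<in> vanishing_ideal W"
      using insert.prems poly_fun_prod[of I f] by simp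
    then show False
      using insert by blast
  qed
qed

section \<open>Algebraic independence of coordinates\<close>

definition alg_indep :: "(complex ^ 'n) set \<Rightarrow> 'n set \<Rightarrow> bool" where
  "alg_indep W S \<longleftrightarrow> (\<forall>f. poly_in S f \<longrightarrow> (\<forall>x\<in>W. f x = 0) \<longrightarrow> f = (\<lambda>x. 0))"

text \<open>For irreducible \<open>W\<close> this is the transcendence degree of the function field,
  because the coordinates generate that field and so contain a transcendence basis. On the empty set
  no \<open>S\<close> is independent and the maximum is unspecified; hence the nonemptiness
  hypotheses below.\<close>

definition adim :: "(complex ^ 'n) set \<Rightarrow> nat" where
  "adim W = Max (card ` {S. alg_indep W S})"

lemma alg_indepD: "alg_indep W S \<Longrightarrow> poly_in S f \<Longrightarrow> f \<in> vanishing_ideal W \<Longrightarrow> f = (\<lambda>x. 0)"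
  unfolding alg_indep_def vanishing_ideal_def by blast

lemma alg_indep_mono: "alg_indep W S \<Longrightarrow> W \<subseteq> W' \<Longrightarrow> alg_indep W' S"
  unfolding alg_indep_def by blast

lemma alg_indep_empty: "W \<noteq> {} \<Longrightarrow> alg_indep W {}"
  unfolding alg_indep_def poly_in_def by (metis empty_iff ex_in_conv)

lemma card_le_adim: "alg_indep W S \<Longrightarrow> card S \<le> adim W"
  unfolding adim_def by (intro Max_ge) auto

lemma adim_mono:
  assumes "W \<noteq> {}" "W \<subseteq> W'"
  shows "adim W \<le> adim W'"
proof -
  have "{S. alg_indep W S} \<subseteq> {S. alg_indep W' S}"
    using alg_indep_mono[OF _ assms(2)] by (simp add: Collect_mono_iff)
  moreover have "{} \<in> {S. alg_indep W S}"
    using alg_indep_empty[OF assms(1)] by simp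
  ultimately show ?thesis
    unfolding adim_def by (intro Max_mono image_mono) auto
qed

lemma adim_basis:
  assumes "W \<noteq> {}"
  obtains S where "alg_indep W S" "card S = adim W"
    "\<And>i. i \<notin> S \<Longrightarrow> \<not> alg_indep W (insert i S)"
proof -
  have "adim W \<in> card ` {S. alg_indep W S}"
    unfolding adim_def using alg_indep_empty[OF assms] by (intro Max_in) auto
  then obtain S where S: "alg_indep W S" "card S = adim W" by auto
  moreover have "\<not> alg_indep W (insert i S)" if "i \<notin> S" for i
    using card_le_adim[of W "insert i S"] that S(2) by (auto simp: card_insert_disjoint)
  ultimately show ?thesis using that by blast
qed

section \<open>Minimal algebraic relations and elimination of coordinates\<close>

lemma psum_truncate:
  assumes "\<And>k. e \<le> k \<Longrightarrow> k < d \<Longrightarrow> b k \<in> vanishing_ideal W" "e \<le> d"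
    and "psum b d i \<in> vanishing_ideal W" "\<And>k. poly_in S (b k)"
  shows "psum b e i \<in> vanishing_ideal W"
proof (rule vanishing_idealI)
  show "poly_fun (psum b e i)"
    using assms(4) poly_in_psum poly_in_imp_poly_fun by metis
  fix x assume x: "x \<in> W"
  have "b k x * x $ i ^ k = 0" if "k \<in> {..<d} - {..<e}" for k
    using vanishing_idealD(1)[OF assms(1) x, of k] that by auto
  then have "psum b e i x = psum b d i x"
    unfolding psum_def using assms(2) by (intro sum.mono_neutral_left) auto
  then show "psum b e i x = 0"
    using assms(3) x vanishing_idealD(1) by metis
qed

lemma least_natE:
  fixes n :: nat
  assumes "P n"
  obtains k where "P k" "\<And>l. l < k \<Longrightarrow> \<not> P l"
  using LeastI[of P, OF assms] not_less_Least[of _ P] by blast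

lemma greatest_belowE:
  fixes n d :: nat
  assumes "P n" "n < d"
  obtains k where "k < d" "P k" "\<And>l. l < d \<Longrightarrow> P l \<Longrightarrow> l \<le> k"
proof -
  obtain k where "k < d \<and> P k" "\<forall>y. y < d \<and> P y \<longrightarrow> y \<le> k"
    using ex_has_greatest_nat[of "\<lambda>k. k < d \<and> P k" n "\<lambda>k. k" d] assms by blast
  then show ?thesis using that by blast
qed

lemma ex_relation:
  assumes "alg_indep W S" "\<not> alg_indep W (insert i S)" "i \<notin> S"
  obtains a d where "\<And>k. poly_in S (a k)" "psum a (Suc d) i \<in> vanishing_ideal W"
    "a d \<noteq> (\<lambda>x. 0)"
proof -
  obtain f where f: "poly_in (insert i S) f" "\<forall>x\<in>W. f x = 0" "f \<noteq> (\<lambda>x. 0)"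
    using assms(2) unfolding alg_indep_def by blast
  then have fW: "f \<in> vanishing_ideal W" by (auto intro: vanishing_idealI poly_in_imp_poly_fun)
  obtain a d where a: "\<And>k. poly_in S (a k)" "f = psum a d i"
    using poly_in_decomp[OF f(1) assms(3)] by blast
  have "\<exists>k. k < d \<and> a k \<noteq> (\<lambda>x. 0)"
  proof (rule ccontr)
    assume "\<not> ?thesis"
    then have "f = (\<lambda>x. 0)" unfolding a(2) psum_def by (intro ext sum.neutral) auto
    with f show False by blast
  qed
  then obtain k0 where "a k0 \<noteq> (\<lambda>x. 0)" "k0 < d" by blast
  then obtain k where k: "k < d" "a k \<noteq> (\<lambda>x. 0)"
    and max: "\<And>l. l < d \<Longrightarrow> a l \<noteq> (\<lambda>x. 0) \<Longrightarrow> l \<le> k"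
    by (rule greatest_belowE[of "\<lambda>k. a k \<noteq> (\<lambda>x. 0)"]) blast
  have "a l \<in> vanishing_ideal W" if "Suc k \<le> l" "l < d" for l
  proof -
    have "a l = (\<lambda>x. 0)" using max[OF that(2)] that(1) by auto
    then show ?thesis by (auto intro: vanishing_idealI poly_fun.intros)
  qed
  then have "psum a (Suc k) i \<in> vanishing_ideal W"
    using psum_truncate[of "Suc k" d a W i S] k(1) a fW by simp
  with that a(1) k(2) show ?thesis by blast
qed

text \<open>The last clause says that \<open>d\<close> is the minimal degree of a relation for the coordinate \<open>i\<close>
  over the coordinates in \<open>T\<close>.\<close>

definition min_rel ::
    "(complex ^ 'n) set \<Rightarrow> 'n set \<Rightarrow> 'n \<Rightarrow> nat \<Rightarrow> (nat \<Rightarrow> complex ^ 'n \<Rightarrow> complex) \<Rightarrow> bool" where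
  "min_rel W T i d a \<longleftrightarrow> (\<forall>k. poly_in T (a k)) \<and> psum a (Suc d) i \<in> vanishing_ideal W \<and>
     a d \<notin> vanishing_ideal W \<and>
     (\<forall>b e. (\<forall>k. poly_in T (b k)) \<longrightarrow> e \<le> d \<longrightarrow> psum b e i \<in> vanishing_ideal W \<longrightarrow>
        (\<forall>k<e. b k \<in> vanishing_ideal W))"

text \<open>The larger set \<open>T\<close> need not be independent. A relation over the independent
  set \<open>S\<close> still has a leading coefficient that does not vanish on \<open>W\<close>, so
  it is a starting point for descent on the degree over \<open>T\<close>.\<close>

lemma ex_min_rel:
  assumes "alg_indep W S" "\<not> alg_indep W (insert i S)" "i \<notin> S" "S \<subseteq> T"
  obtains d a where "min_rel W T i d a"
proof -
  let ?P = "\<lambda>d. \<exists>a. (\<forall>k. poly_in T (a k)) \<and> psum a (Suc d) i \<in> vanishing_ideal W \<and>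
     a d \<notin> vanishing_ideal W"
  obtain a0 d0 where "\<And>k. poly_in S (a0 k)" "psum a0 (Suc d0) i \<in> vanishing_ideal W"
    "a0 d0 \<noteq> (\<lambda>x. 0)"
    using ex_relation[OF assms(1-3)] by metis
  then have "?P d0"
    using poly_in_mono[OF _ assms(4)] alg_indepD[OF assms(1)] by metis
  then obtain d where d: "?P d" "\<And>e. e < d \<Longrightarrow> \<not> ?P e"
    by (rule least_natE[of ?P]) blast
  then obtain a where a: "\<forall>k. poly_in T (a k)" "psum a (Suc d) i \<in> vanishing_ideal W"
     "a d \<notin> vanishing_ideal W" by blast
  have "b l \<in> vanishing_ideal W"
    if b: "\<forall>k. poly_in T (b k)" "e \<le> d" "psum b e i \<in> vanishing_ideal W" "l < e" for b e l
  proof (rule ccontr)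
    assume "b l \<notin> vanishing_ideal W"
    then obtain k where k: "k < e" "b k \<notin> vanishing_ideal W"
      and max: "\<And>l. l < e \<Longrightarrow> b l \<notin> vanishing_ideal W \<Longrightarrow> l \<le> k"
      using b(4) by (rule greatest_belowE[of "\<lambda>k. b k \<notin> vanishing_ideal W"]) blast
    have "psum b (Suc k) i \<in> vanishing_ideal W"
      by (rule psum_truncate[of _ e]) (use max k b in force)+
    then show False using d(2)[of k] k b by auto
  qed
  then have "min_rel W T i d a"
    unfolding min_rel_def using a by blast
  then show ?thesis using that by blast
qed

lemma min_relD:
  assumes "min_rel W T i d a"
  shows "poly_in T (a k)" "psum a (Suc d) i \<in> vanishing_ideal W" "a d \<notin> vanishing_ideal W"
    "(\<And>k. poly_in T (b k)) \<Longrightarrow> e \<le> d \<Longrightarrow> psum b e i \<in> vanishing_ideal W \<Longrightarrow> k < e \<Longrightarrow>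
       b k \<in> vanishing_ideal W"
  using assms unfolding min_rel_def by blast+

lemma psum_pad_ex:
  assumes "\<And>k. poly_in S (b k)"
  shows "\<exists>m b'. (\<forall>k. poly_in S (b' k)) \<and> psum b e i = psum b' (Suc (d + m)) i"
proof -
  define b' where "b' = (\<lambda>k. if k < e then b k else (\<lambda>x. 0))"
  have "\<forall>k. poly_in S (b' k)" using assms by (auto simp: b'_def poly_in_const)
  moreover have "psum b e i = psum b' (Suc (d + e)) i"
    unfolding b'_def by (rule psum_pad [symmetric]) auto
  ultimately show ?thesis by blast
qed

text \<open>A polynomial of minimal degree in \<open>i\<close> that vanishes on
  \<open>W'\<close> but not on \<open>W\<close> cannot have positive degree, since it would divide the minimal relation of
  \<open>i\<close> up to a factor not vanishing on \<open>W\<close>.\<close>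

lemma eliminate_coordinate:
  assumes W: "zprime W" "W' \<subseteq> W" and rel: "min_rel W T i d a" and "i \<notin> T"
    and f: "poly_in (insert i T) f" "f \<in> vanishing_ideal W'" "f \<notin> vanishing_ideal W"
  shows "\<exists>g. poly_in T g \<and> g \<in> vanishing_ideal W' \<and> g \<notin> vanishing_ideal W"
proof -
  note I_sub = vanishing_ideal_antimono[OF W(2)]
  note aT = min_relD(1)[OF rel]
  let ?P = "\<lambda>e. \<exists>b. (\<forall>k. poly_in T (b k)) \<and> psum b (Suc e) i \<in> vanishing_ideal W' \<and>
     psum b (Suc e) i \<notin> vanishing_ideal W"
  have psum_poly: "poly_fun (psum b e i)" if "\<And>k. poly_in T (b k)" for b e
    using poly_in_psum poly_in_imp_poly_fun that by metis
  obtain b0 e0 where b0: "\<And>k. poly_in T (b0 k)" "f = psum b0 e0 i"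
    using poly_in_decomp[OF f(1) \<open>i \<notin> T\<close>] by blast
  obtain m0 b0' where "\<forall>k. poly_in T (b0' k)" "psum b0 e0 i = psum b0' (Suc (0 + m0)) i"
    using psum_pad_ex[of T b0 e0 i 0] b0(1) by blast
  then have "?P m0"
    using f(2,3) unfolding b0(2) by auto
  then obtain e where e: "?P e" and min: "\<And>e'. e' < e \<Longrightarrow> \<not> ?P e'"
    by (rule least_natE[of ?P]) blast
  then obtain b where b: "\<And>k. poly_in T (b k)" "psum b (Suc e) i \<in> vanishing_ideal W'"
    "psum b (Suc e) i \<notin> vanishing_ideal W" by blast
  have min': "psum c e' i \<in> vanishing_ideal W"
    if "\<And>k. poly_in T (c k)" "psum c e' i \<in> vanishing_ideal W'" "e' \<le> e" for c e'
  proof (cases e')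
    case 0
    then show ?thesis by (auto intro: vanishing_idealI poly_fun.intros)
  next
    case (Suc e'')
    then show ?thesis using min[of e''] that by auto
  qed
  show ?thesis
  proof (cases "e = 0")
    case True
    then have "psum b (Suc e) i = b 0" by (auto simp: psum_def)
    then show ?thesis using b by auto
  next
    case False
    \<comment> \<open>Otherwise \<open>b\<close> can be divided by the minimal relation
      \<open>a\<close>. The remainder vanishes on \<open>W'\<close> and has degree below
      \<open>e\<close>, so it vanishes on \<open>W\<close>, and by primality so does
      \<open>b\<close>.\<close>
    have "e < d"
    proof (rule ccontr)
      assume "\<not> e < d"
      then obtain m where m: "e = d + m" using le_Suc_ex by (metis not_less)
      obtain q r where qr: "\<forall>k. poly_in T (q k)" "\<forall>k. poly_in T (r k)"
        "\<forall>x. a d x ^ Suc m * psum b (Suc (d + m)) i x =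
          psum q (Suc m) i x * psum a (Suc d) i x + psum r d i x"
        using pseudo_division[of T a b d m i, OF aT b(1)] by blast
      have r: "psum r d i = (\<lambda>x. a d x ^ Suc m * psum b (Suc e) i x -
          psum q (Suc m) i x * psum a (Suc d) i x)"
        using qr(3) m by auto
      have pa: "(\<lambda>x. psum q (Suc m) i x * psum a (Suc d) i x) \<in> vanishing_ideal W"
        using min_relD(2)[OF rel] qr(1) psum_poly by (intro vanishing_ideal_mult) auto
      have "psum r d i \<in> vanishing_ideal W'"
        unfolding r
        by (rule vanishing_ideal_diff[OF vanishing_ideal_mult[OF b(2)] subsetD[OF I_sub pa]])
          (intro poly_fun_power poly_in_imp_poly_fun[OF aT])
      then have "psum r d i \<in> vanishing_ideal W"
        using min' qr(2) m by auto
      from vanishing_ideal_add[OF this pa]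
      have ab: "(\<lambda>x. a d x ^ Suc m * psum b (Suc e) i x) \<in> vanishing_ideal W"
        unfolding r by simp
      have "psum b (Suc e) i \<in> vanishing_ideal W"
        by (rule zprime_mult[OF W(1) _ _ ab zprime_power[OF W(1) _ min_relD(3)[OF rel]]])
          (intro poly_fun_power poly_in_imp_poly_fun[OF aT] psum_poly b(1))+
      then show False using b(3) by blast
    qed
    define m where "m = d - e"
    have m: "d = e + m" "m < d" using \<open>e < d\<close> False by (auto simp: m_def)
    have be: "b e \<notin> vanishing_ideal W"
    proof
      assume be: "b e \<in> vanishing_ideal W"
      have *: "psum b (Suc e) i = (\<lambda>x. psum b e i x + x $ i ^ e * b e x)"
        by (auto simp: psum_Suc algebra_simps)
      have x: "(\<lambda>x. x $ i ^ e * b e x) \<in> vanishing_ideal W"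
        using be by (intro vanishing_ideal_mult poly_fun_power poly_fun.coord)
      have "(\<lambda>x. psum b (Suc e) i x - x $ i ^ e * b e x) \<in> vanishing_ideal W'"
        using b(2) x I_sub by (intro vanishing_ideal_diff) auto
      then have "psum b e i \<in> vanishing_ideal W'" unfolding * by simp
      then have "psum b e i \<in> vanishing_ideal W" using min' b(1) by blast
      from vanishing_ideal_add[OF this x] b(3) show False unfolding * by simp
    qed
    \<comment> \<open>Division in the other direction: the remainder again vanishes on
      \<open>W\<close>, hence so does the product of \<open>b\<close> with the quotient, and by
      primality the quotient itself. Its degree \<open>m\<close> is below \<open>d\<close>, so
      minimality kills its top coefficient \<open>b e x ^ m * a d x\<close>, although neither factor
      vanishes on \<open>W\<close>.\<close>
    obtain q r where qr: "\<forall>k. poly_in T (q k)" "\<forall>k. poly_in T (r k)"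
      "\<forall>x. b e x ^ Suc m * psum a (Suc (e + m)) i x =
        psum q (Suc m) i x * psum b (Suc e) i x + psum r e i x"
      "q m = (\<lambda>x. b e x ^ m * a (e + m) x)"
      using pseudo_division[of T b a e m i, OF b(1) aT] by blast
    have pa: "(\<lambda>x. b e x ^ Suc m * psum a (Suc d) i x) \<in> vanishing_ideal W"
      using min_relD(2)[OF rel] b(1) poly_in_imp_poly_fun
      by (intro vanishing_ideal_mult poly_fun_power) auto
    have r: "psum r e i = (\<lambda>x. b e x ^ Suc m * psum a (Suc d) i x -
        psum q (Suc m) i x * psum b (Suc e) i x)"
      using qr(3) m by auto
    have "psum r e i \<in> vanishing_ideal W'"
      unfolding r
      by (rule vanishing_ideal_diff[OF subsetD[OF I_sub pa] vanishing_ideal_mult[OF b(2)]])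
        (use qr(1) psum_poly in blast)
    then have "psum r e i \<in> vanishing_ideal W" using min' qr(2) by blast
    from vanishing_ideal_diff[OF pa this]
    have "(\<lambda>x. psum b (Suc e) i x * psum q (Suc m) i x) \<in> vanishing_ideal W"
      unfolding r by (simp add: mult.commute)
    then have "psum q (Suc m) i \<in> vanishing_ideal W"
      using b(1,3) qr(1) psum_poly zprime_mult[OF W(1), of "psum b (Suc e) i"] by blast
    then have "q m \<in> vanishing_ideal W"
      using min_relD(4)[OF rel, of q "Suc m" m] qr(1) m(2) by auto
    then have ba: "(\<lambda>x. b e x ^ m * a d x) \<in> vanishing_ideal W" unfolding qr(4) m(1) .
    have "a d \<in> vanishing_ideal W"
      by (rule zprime_mult[OF W(1) _ _ ba zprime_power[OF W(1) _ be]])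
        (intro poly_fun_power poly_in_imp_poly_fun[OF aT] poly_in_imp_poly_fun[OF b(1)])+
    then show ?thesis using min_relD(3)[OF rel] by blast
  qed
qed

lemma superset_induct [consumes 1, case_names base step]:
  fixes S T :: "'a::finite set"
  assumes "S \<subseteq> T" "P S"
    and "\<And>T i. S \<subseteq> T \<Longrightarrow> i \<notin> T \<Longrightarrow> P T \<Longrightarrow> P (insert i T)"
  shows "P T"
proof -
  have "P (S \<union> R)" for R
    using finite[of R]
  proof induction
    case empty
    then show ?case using assms(2) by simp
  next
    case (insert i R)
    then show ?case using assms(3)[of "S \<union> R" i] by (cases "i \<in> S") (auto simp: insert_absorb)
  qed
  from this[of T] show ?thesis using assms(1) by (simp add: Un_absorb1)
qed

text \<open>If the dimensions agreed, a basis \<open>S\<close> for \<open>W'\<close> would also be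
  one for \<open>W\<close>. A polynomial that separates \<open>W'\<close> from \<open>W\<close>
  could then be freed of all coordinates outside \<open>S\<close>, contradicting independence of
  \<open>S\<close> on \<open>W'\<close>.\<close>

lemma adim_strict_mono:
  assumes W: "irreducible_variety W" "irreducible_variety W'" "W' \<subset> W"
  shows "adim W' < adim W"
proof (rule ccontr)
  assume "\<not> ?thesis"
  moreover have ne: "W' \<noteq> {}" using W(2) irreducible_variety_def by blast
  ultimately have eq: "adim W' = adim W" using adim_mono[OF ne, of W] W(3) by (simp add: psubset_eq)
  obtain S where S: "alg_indep W' S" "card S = adim W'" using adim_basis[OF ne] by metis
  have SW: "alg_indep W S" using alg_indep_mono S(1) W(3) by blast
  have max: "\<not> alg_indep W (insert i S)" if "i \<notin> S" for i
    using card_le_adim[of W "insert i S"] that S(2) eq by (auto simp: card_insert_disjoint)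
  let ?P = "\<lambda>T. (\<exists>g. poly_in T g \<and> g \<in> vanishing_ideal W' \<and> g \<notin> vanishing_ideal W) \<longrightarrow>
    (\<exists>g. poly_in S g \<and> g \<in> vanishing_ideal W' \<and> g \<notin> vanishing_ideal W)"
  have "?P UNIV"
  proof (rule superset_induct[of S UNIV ?P, OF subset_UNIV])
    fix T i assume T: "S \<subseteq> T" "i \<notin> T" "?P T"
    then have "i \<notin> S" by blast
    obtain d a where rel: "min_rel W T i d a"
      by (rule ex_min_rel[OF SW max[OF \<open>i \<notin> S\<close>] \<open>i \<notin> S\<close> T(1)])
    have "zprime W" "W' \<subseteq> W" using W irreducible_variety_iff by blast+
    from eliminate_coordinate[OF this rel T(2)] T(3) show "?P (insert i T)" by blast
  qed auto
  moreover have "zero_locus (vanishing_ideal W') = W'" "zero_locus (vanishing_ideal W) = W"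
    using W closedin_zariski_iff[of W] closedin_zariski_iff[of W']
    by (auto simp: irreducible_variety_def)
  then have "\<exists>g. g \<in> vanishing_ideal W' \<and> g \<notin> vanishing_ideal W"
    using W(3) unfolding zero_locus_def by blast
  ultimately obtain g where "poly_in S g" "g \<in> vanishing_ideal W'" "g \<notin> vanishing_ideal W"
    using poly_in_UNIV vanishing_idealD(2) by metis
  moreover have "(\<lambda>x. 0) \<in> vanishing_ideal W"
    by (auto intro: vanishing_idealI poly_fun.intros)
  ultimately show False
    using alg_indepD[OF S(1)] by metis
qed


section \<open>Extension of points along coordinates\<close>

text \<open>The ideals \<open>J\<close> occurring below are unions of chains of vanishing ideals. They are radical,
  but without the Nullstellensatz they are not known to be vanishing ideals themselves.\<close>

definition vanishing_directed :: "(complex ^ 'n \<Rightarrow> complex) set \<Rightarrow> bool" where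
  "vanishing_directed J \<longleftrightarrow> J \<noteq> {} \<and>
     (\<forall>f\<in>J. \<forall>g\<in>J. \<exists>A. f \<in> vanishing_ideal A \<and> g \<in> vanishing_ideal A \<and> vanishing_ideal A \<subseteq> J)"

lemma vanishing_directedE:
  assumes "vanishing_directed J" "f \<in> J" "g \<in> J"
  obtains A where "f \<in> vanishing_ideal A" "g \<in> vanishing_ideal A" "vanishing_ideal A \<subseteq> J"
  using assms unfolding vanishing_directed_def by meson

lemma vanishing_directed_vanishing_ideal: "vanishing_directed (vanishing_ideal A)"
proof -
  have "(\<lambda>x. 0) \<in> vanishing_ideal A" by (intro vanishing_idealI poly_fun.const refl)
  then show ?thesis unfolding vanishing_directed_def by blast
qed

definition upd :: "complex ^ 'n \<Rightarrow> 'n \<Rightarrow> complex \<Rightarrow> complex ^ 'n" where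
  "upd p i t = (\<chi> j. if j = i then t else p $ j)"

lemma upd_nth [simp]: "upd p i t $ j = (if j = i then t else p $ j)"
  by (simp add: upd_def)

lemma poly_in_upd: "poly_in S f \<Longrightarrow> i \<notin> S \<Longrightarrow> f (upd p i t) = f p"
  by (rule poly_in_cong) auto

text \<open>The point \<open>p\<close> lies over the closure of the projection of the zero set of \<open>J\<close> to the
  coordinates in \<open>S\<close>.\<close>

definition lies_over :: "(complex ^ 'n \<Rightarrow> complex) set \<Rightarrow> 'n set \<Rightarrow> complex ^ 'n \<Rightarrow> bool" where
  "lies_over J S p \<longleftrightarrow> (\<forall>f\<in>J. poly_in S f \<longrightarrow> f p = 0)"

text \<open>If \<open>x $ i\<close> is integral over the local ring of \<open>p\<close>, the maximal ideal of \<open>p\<close> does not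
  generate the unit ideal. As in Chevalley's argument, two relations contradicting this are
  reduced against each other until one of them has degree zero.\<close>

lemma no_unit_relation:
  fixes a b :: "nat \<Rightarrow> complex ^ 'n \<Rightarrow> complex"
  assumes over: "lies_over J S p" and A: "vanishing_ideal A \<subseteq> J"
    and "\<And>k. poly_in S (a k)" "\<And>k. poly_in S (b k)"
    and "psum a (Suc d) i \<in> vanishing_ideal A" "psum b (Suc e) i \<in> vanishing_ideal A"
    and "a d p \<noteq> 0" "b 0 p \<noteq> 0" "\<And>k. 1 \<le> k \<Longrightarrow> k \<le> e \<Longrightarrow> b k p = 0"
  shows False
  using assms(3-)
proof (induction "d + e" arbitrary: a b d e rule: less_induct)
  case less
  note a = less.prems(1) and b = less.prems(2)
  have psum_poly: "poly_fun (psum c m i)" if "\<And>k. poly_in S (c k)" for c m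
    using poly_in_imp_poly_fun[OF poly_in_psum[OF that]] .
  consider "d = 0" | "0 < d" "d \<le> e" | "0 < d" "e < d" by linarith
  then show False
  proof cases
    case 1
    then have "psum a (Suc d) i = a 0" by (auto simp: psum_def)
    then have "a 0 \<in> J" using less.prems(3) A by auto
    then show False using over a less.prems(5) 1 unfolding lies_over_def by blast
  next
    case 2
    define m where "m = e - d"
    have e: "e = d + m" using 2 by (simp add: m_def)
    \<comment> \<open>Since \<open>b e p = 0\<close>, the new coefficients at \<open>p\<close> are
      \<open>a d p\<close> times the old ones, so \<open>b'\<close> is again a unit
      relation.\<close>
    define b' where "b' = (\<lambda>k x. a d x * b k x - (if k < m then 0 else b e x * a (k - m) x))"
    have b'S: "poly_in S (b' k)" for k
      unfolding b'_def using a b by (cases "k < m") (auto intro!: poly_in_intros)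
    have "psum b' (Suc (e - 1)) i x = psum b' (Suc d + m) i x" for x
      using 2 by (simp add: e psum_Suc b'_def)
    then have b'e: "psum b' (Suc (e - 1)) i x =
        a d x * psum b (Suc e) i x - b e x * x $ i ^ m * psum a (Suc d) i x" for x
      using psum_shift[of "a d" b m "b e" a "Suc d" i x] by (simp add: b'_def e)
    have "psum b' (Suc (e - 1)) i \<in> vanishing_ideal A"
    proof (rule vanishing_idealI)
      show "psum b' (Suc (e - 1)) i x = 0" if "x \<in> A" for x
        unfolding b'e using vanishing_idealD(1)[OF less.prems(3) that]
          vanishing_idealD(1)[OF less.prems(4) that] by simp
    qed (intro psum_poly b'S)
    moreover have "d + (e - 1) < d + e" using 2 by simp
    moreover have "b e p = 0" using less.prems(7)[of e] 2 by simp
    then have "b' 0 p \<noteq> 0" "\<And>k. 1 \<le> k \<Longrightarrow> k \<le> e - 1 \<Longrightarrow> b' k p = 0"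
      using less.prems(5,6,7) by (auto simp: b'_def)
    ultimately show False
      using less.hyps[of d "e - 1" a b'] a b'S less.prems(3,5) by blast
  next
    case 3
    define b1 where "b1 = (\<lambda>k. if k < Suc e then b k else (\<lambda>x. 0))"
    have b1: "psum b1 (Suc d) i = psum b (Suc e) i"
      unfolding b1_def using 3 by (intro psum_pad) simp
    have b1S: "poly_in S (b1 k)" for k using b by (auto simp: b1_def poly_in_const)
    \<comment> \<open>The constant term of \<open>a\<close> is eliminated by means of
      \<open>b\<close>, and the result is divided by \<open>x $ i\<close>. The extra factor
      \<open>b 0 x\<close> covers the points with \<open>x $ i = 0\<close>, where the division fails
      but \<open>b\<close> forces \<open>b 0 x = 0\<close>. As \<open>e < d\<close>, the leading
      coefficient at \<open>p\<close> is \<open>b 0 p\<close> squared times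
      \<open>a d p\<close>.\<close>
    define a' where "a' = (\<lambda>k x. b 0 x * (b 0 x * a (Suc k) x - a 0 x * b1 (Suc k) x))"
    have a'S: "poly_in S (a' k)" for k
      unfolding a'_def using a b b1S by (intro poly_in_intros)
    have split0: "psum c (Suc d) i x = c 0 x + x $ i * (\<Sum>k<d. c (Suc k) x * x $ i ^ k)" for c x
      unfolding psum_def by (subst sum.lessThan_Suc_shift) (simp add: sum_distrib_left ac_simps)
    have a'd: "psum a' (Suc (d - 1)) i \<in> vanishing_ideal A"
    proof (rule vanishing_idealI)
      fix x assume x: "x \<in> A"
      define P Q where "P = (\<Sum>k<d. a (Suc k) x * x $ i ^ k)"
        and "Q = (\<Sum>k<d. b1 (Suc k) x * x $ i ^ k)"
      have P: "a 0 x + x $ i * P = 0"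
        using vanishing_idealD(1)[OF less.prems(3) x] unfolding split0 P_def .
      have Q: "b 0 x + x $ i * Q = 0"
        using vanishing_idealD(1)[OF less.prems(4) x] unfolding b1[symmetric] split0 Q_def
        by (simp add: b1_def)
      have "psum a' (Suc (d - 1)) i x = b 0 x * (b 0 x * P - a 0 x * Q)"
        using 3 unfolding psum_def P_def Q_def a'_def
        by (simp add: sum_distrib_left sum_subtractf algebra_simps)
      also have "\<dots> = 0"
      proof (cases "x $ i = 0")
        case True
        then show ?thesis using Q by simp
      next
        case False
        have "x $ i * (b 0 x * P - a 0 x * Q) = b 0 x * (x $ i * P) - a 0 x * (x $ i * Q)"
          by (simp add: algebra_simps)
        also have "\<dots> = 0" using P Q by (simp add: eq_neg_iff_add_eq_0[symmetric] algebra_simps)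
        finally show ?thesis using False by simp
      qed
      finally show "psum a' (Suc (d - 1)) i x = 0" .
    qed (intro psum_poly a'S)
    have "a' (d - 1) p \<noteq> 0"
    proof -
      obtain d' where "d = Suc d'" using 3 by (cases d) auto
      then show ?thesis using 3 less.prems(5,6) by (auto simp: a'_def b1_def)
    qed
    moreover have "d - 1 + e < d + e" using 3 by simp
    ultimately show False
      using less.hyps[of "d - 1" e a' b] a'S b a'd less.prems(4,6,7) by blast
  qed
qed

lemma poly_in_poly: "i \<in> S \<Longrightarrow> poly_in S (\<lambda>x. poly r (x $ i))"
  unfolding poly_altdef by (intro poly_in_intros)

text \<open>Substituting \<open>p\<close> for the coordinates in \<open>S\<close> turns the elements
  of \<open>J\<close> in the variables \<open>insert i S\<close> into an ideal \<open>K\<close> of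
  one-variable polynomials. The relation \<open>a\<close> makes \<open>K\<close> nonzero and
  \<open>no_unit_relation\<close> makes its generator nonconstant, so a root of the generator is the
  required coordinate.\<close>

lemma lies_over_extend:
  fixes J :: "(complex ^ 'n \<Rightarrow> complex) set"
  assumes J: "vanishing_directed J" and over: "lies_over J S p" and i: "i \<notin> S"
    and a: "\<And>k. poly_in S (a k)" "psum a (Suc d) i \<in> J" "a d p \<noteq> 0"
  shows "\<exists>t. lies_over J (insert i S) (upd p i t)"
proof -
  define K where "K = {q. \<exists>g\<in>J. poly_in (insert i S) g \<and> (\<forall>t. poly q t = g (upd p i t))}"
  have K_ex: "\<exists>q\<in>K. \<forall>t. poly q t = g (upd p i t)" if "g \<in> J" "poly_in (insert i S) g" for g
  proof -
    have "upd p i 0 + t *s axis i 1 = upd p i t" for t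
      by (simp add: vec_eq_iff axis_def)
    then have "\<exists>q. \<forall>t. poly q t = g (upd p i t)"
      using poly_fun_line[OF poly_in_imp_poly_fun[OF that(2)], of "upd p i 0" "axis i 1"] by simp
    then show ?thesis unfolding K_def using that by blast
  qed
  have K_comb: "q - r * s \<in> K" if "q \<in> K" "s \<in> K" for q r s
  proof -
    obtain f g where f: "f \<in> J" "poly_in (insert i S) f" "\<forall>t. poly q t = f (upd p i t)"
      and g: "g \<in> J" "poly_in (insert i S) g" "\<forall>t. poly s t = g (upd p i t)"
      using \<open>q \<in> K\<close> \<open>s \<in> K\<close> unfolding K_def by blast
    \<comment> \<open>Directedness is what makes \<open>J\<close> closed under this combination:
      both elements lie in a single vanishing ideal inside \<open>J\<close>.\<close>
    obtain A where A: "f \<in> vanishing_ideal A" "g \<in> vanishing_ideal A" "vanishing_ideal A \<subseteq> J"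
      using vanishing_directedE[OF J f(1) g(1)] .
    have r: "poly_in (insert i S) (\<lambda>x. poly r (x $ i))" by (intro poly_in_poly) simp
    let ?h = "\<lambda>x. f x - poly r (x $ i) * g x"
    have "?h \<in> vanishing_ideal A"
      by (rule vanishing_ideal_diff[OF A(1) vanishing_ideal_mult[OF A(2) poly_in_imp_poly_fun[OF r]]])
    then have "?h \<in> J" using A(3) by blast
    moreover have "poly_in (insert i S) ?h"
      by (rule poly_in_diff[OF f(2) poly_in_mult[OF r g(2)]])
    moreover have "\<forall>t. poly (q - r * s) t = ?h (upd p i t)"
      using f(3) g(3) by simp
    ultimately show ?thesis unfolding K_def by blast
  qed
  have eval: "psum c e i (upd p i t) = poly (\<Sum>k<e. monom (c k p) k) t"
    if "\<And>k. poly_in S (c k)" for c e t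
    unfolding psum_def using poly_in_upd[OF that i] by (simp add: poly_sum poly_monom)
  have coeff: "coeff (\<Sum>k<e. monom (c k) k) l = (if l < e then c l else 0)"
    for c :: "nat \<Rightarrow> complex" and e l
    by (simp add: coeff_sum if_distrib cong: if_cong)
  obtain q0 where q0: "q0 \<in> K" "\<forall>t. poly q0 t = psum a (Suc d) i (upd p i t)"
    using K_ex[OF a(2) poly_in_psum[OF a(1)]] by blast
  have "q0 = (\<Sum>k<Suc d. monom (a k p) k)"
    using q0(2) unfolding eval[OF a(1)] by (simp add: poly_eq_poly_eq_iff[symmetric] fun_eq_iff)
  then have "coeff q0 d \<noteq> 0" using a(3) coeff[of "\<lambda>k. a k p" "Suc d" d] by simp
  then have "q0 \<noteq> 0" by auto
  then obtain q where q: "q \<in> K" "q \<noteq> 0" and min: "\<And>r. r \<in> K \<Longrightarrow> r \<noteq> 0 \<Longrightarrow> degree q \<le> degree r"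
    using ex_has_least_nat[of "\<lambda>q. q \<in> K \<and> q \<noteq> 0" q0 degree] q0(1) by blast
  have dvd: "q dvd r" if "r \<in> K" for r
  proof (rule ccontr)
    assume "\<not> q dvd r"
    then have "r mod q \<noteq> 0" by (simp add: mod_eq_0_iff_dvd)
    moreover have "r mod q \<in> K"
      using K_comb[OF that q(1), of "r div q"] by (simp add: minus_div_mult_eq_mod)
    ultimately have "degree q \<le> degree (r mod q)" using min by blast
    then show False using degree_mod_less[OF q(2), of r] \<open>r mod q \<noteq> 0\<close> by linarith
  qed
  have "degree q \<noteq> 0"
  proof
    assume "degree q = 0"
    then obtain c where c: "q = [:c:]" by (rule degree_eq_zeroE)
    obtain g where g: "g \<in> J" "poly_in (insert i S) g" "\<forall>t. poly q t = g (upd p i t)"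
      using q(1) unfolding K_def by blast
    obtain b e where b: "\<And>k. poly_in S (b k)" "g = psum b e i"
      using poly_in_decomp[OF g(2) i] by blast
    \<comment> \<open>After substitution \<open>g\<close> is the nonzero constant \<open>c\<close>,
      so at \<open>p\<close> only its coefficient of degree zero survives. This is the excluded unit
      relation, of degree \<open>e - 1\<close> because \<open>psum b e i\<close> has
      \<open>e\<close> terms.\<close>
    have qb: "q = (\<Sum>k<e. monom (b k p) k)"
      using g(3) unfolding b(2) eval[OF b(1)]
      by (simp add: poly_eq_poly_eq_iff[symmetric] fun_eq_iff)
    have bk: "(if k < e then b k p else 0) = coeff [:c:] k" for k
      unfolding c[symmetric] qb by (rule coeff[symmetric])
    have "c \<noteq> 0" using q(2) c by auto
    then have e: "0 < e" "b 0 p \<noteq> 0" using bk[of 0] by (auto split: if_splits)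
    have b0: "b k p = 0" if "1 \<le> k" "k \<le> e - 1" for k
      using bk[of k] that by (cases k) (auto split: if_splits)
    obtain A where A: "psum a (Suc d) i \<in> vanishing_ideal A" "g \<in> vanishing_ideal A"
      "vanishing_ideal A \<subseteq> J"
      using vanishing_directedE[OF J a(2) g(1)] .
    have "psum b (Suc (e - 1)) i \<in> vanishing_ideal A"
      using A(2) b(2) e(1) by simp
    then show False
      by (rule no_unit_relation[of J S p A a b d i "e - 1",
            OF over A(3) a(1) b(1) A(1) _ a(3) e(2) b0])
  qed
  then have "\<not> constant (poly q)" by (simp add: constant_degree)
  then obtain t where t: "poly q t = 0"
    using fundamental_theorem_of_algebra by blast
  have "f (upd p i t) = 0" if f: "f \<in> J" "poly_in (insert i S) f" for f
  proof -
    obtain r where r: "r \<in> K" "\<forall>t. poly r t = f (upd p i t)"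
      using K_ex[OF f] by blast
    have "poly r t = 0" using dvd[OF r(1)] t by (auto elim!: dvdE)
    then show ?thesis using r(2) by simp
  qed
  then show ?thesis unfolding lies_over_def by blast
qed

text \<open>The missing coordinates are added one at a time. The relations over \<open>S\<close>
  keep serving for larger sets, because their leading coefficients see only the coordinates in
  \<open>S\<close>, which never change.\<close>

lemma lies_over_lift:
  fixes J :: "(complex ^ 'n \<Rightarrow> complex) set"
  assumes J: "vanishing_directed J" and over: "lies_over J S p"
    and rel: "\<And>i. i \<notin> S \<Longrightarrow>
      \<exists>a d. (\<forall>k. poly_in S (a k)) \<and> psum a (Suc d) i \<in> J \<and> a d p \<noteq> 0"
  shows "\<exists>w. (\<forall>i\<in>S. w $ i = p $ i) \<and> (\<forall>f\<in>J. f w = 0)"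
proof -
  have "\<exists>w. (\<forall>i\<in>S. w $ i = p $ i) \<and> lies_over J UNIV w"
  proof (rule superset_induct[of S UNIV "\<lambda>T. \<exists>w. (\<forall>i\<in>S. w $ i = p $ i) \<and> lies_over J T w",
      OF subset_UNIV])
    show "\<exists>w. (\<forall>i\<in>S. w $ i = p $ i) \<and> lies_over J S w" using over by blast
    fix T i assume T: "S \<subseteq> T" "i \<notin> T" "\<exists>w. (\<forall>i\<in>S. w $ i = p $ i) \<and> lies_over J T w"
    then obtain w where w: "\<forall>i\<in>S. w $ i = p $ i" "lies_over J T w" by blast
    have iS: "i \<notin> S" using T by blast
    obtain a d where a: "\<forall>k. poly_in S (a k)" "psum a (Suc d) i \<in> J" "a d p \<noteq> 0"
      using rel[OF iS] by blast
    have "a d w = a d p" using w(1) a(1) poly_in_cong[of S "a d" w p] by simp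
    then have "a d w \<noteq> 0" using a(3) by simp
    then obtain t where "lies_over J (insert i T) (upd w i t)"
      using lies_over_extend[OF J w(2) T(2) poly_in_mono[OF _ T(1)] a(2)] a(1) by blast
    moreover have "\<forall>j\<in>S. upd w i t $ j = p $ j" using w(1) iS by auto
    ultimately show "\<exists>w. (\<forall>i\<in>S. w $ i = p $ i) \<and> lies_over J (insert i T) w" by blast
  qed
  then obtain w where w: "\<forall>i\<in>S. w $ i = p $ i" "lies_over J UNIV w" by blast
  have "f w = 0" if f: "f \<in> J" for f
  proof -
    obtain A where "f \<in> vanishing_ideal A" using vanishing_directedE[OF J f f] .
    then have "poly_in UNIV f" unfolding poly_in_UNIV by (rule vanishing_idealD(2))
    then show ?thesis using w(2) f unfolding lies_over_def by blast
  qed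
  then show ?thesis using w(1) by blast
qed

section \<open>Krull dimension\<close>

text \<open>A basis coordinate \<open>i\<close> is fixed to a suitable constant \<open>c\<close>.
  The remaining basis \<open>S'\<close> stays independent on the section, since a generic choice of
  these coordinates extends to a point of it; an irreducible closed subset with the same property
  has dimension at least \<open>r\<close>, and at most \<open>r\<close> by strict
  monotonicity.\<close>

lemma ex_irreducible_section:
  fixes W :: "(complex ^ 'n) set"
  assumes W: "irreducible_variety W" and dim: "adim W = Suc r"
  shows "\<exists>W'. irreducible_variety W' \<and> W' \<subset> W \<and> adim W' = r"
proof -
  have Wne: "W \<noteq> {}" using W irreducible_variety_def by blast
  obtain S where S: "alg_indep W S" "card S = adim W"
    and max: "\<And>i. i \<notin> S \<Longrightarrow> \<not> alg_indep W (insert i S)"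
    using adim_basis[OF Wne] by blast
  obtain i where i: "i \<in> S" using S(2) dim by fastforce
  define S' where "S' = S - {i}"
  have S': "S = insert i S'" "i \<notin> S'" "card S' = r" "S' \<subseteq> S"
    using i S(2) dim by (auto simp: S'_def)
  have "\<exists>a d. (\<forall>k. poly_in S (a k)) \<and> psum a (Suc d) j \<in> vanishing_ideal W \<and> a d \<noteq> (\<lambda>x. 0)"
    if "j \<notin> S" for j
    using ex_relation[OF S(1) max[OF that] that] by metis
  then obtain a d where a: "\<And>j k. j \<notin> S \<Longrightarrow> poly_in S (a j k)"
    "\<And>j. j \<notin> S \<Longrightarrow> psum (a j) (Suc (d j)) j \<in> vanishing_ideal W"
    "\<And>j. j \<notin> S \<Longrightarrow> a j (d j) \<noteq> (\<lambda>x. 0)" by metis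
  \<comment> \<open>Where \<open>u\<close> is nonzero, every coordinate outside \<open>S\<close>
    satisfies a relation with nonzero leading coefficient. The constant \<open>c\<close> is taken
    from such a point, so that \<open>u\<close> is not identically zero on the hyperplane.\<close>
  define u where "u = (\<lambda>x. \<Prod>j\<in>- S. a j (d j) x)"
  have u: "poly_in S u" unfolding u_def using a(1) by (intro poly_in_prod) auto
  have "u \<notin> vanishing_ideal UNIV"
    unfolding u_def
    by (rule zprime_prod[OF zprime_UNIV])
      (use a(3) poly_in_imp_poly_fun[OF a(1)] in \<open>auto simp: vanishing_ideal_UNIV\<close>)
  then obtain p0 where p0: "u p0 \<noteq> 0" unfolding vanishing_ideal_UNIV by blast
  define c where "c = p0 $ i"
  define u' where "u' = (\<lambda>x. u (upd x i c))"
  have u': "poly_in S' u'"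
  proof (rule poly_inI)
    have "poly_fun (\<lambda>x. upd x i c $ j)" for j
      by (cases "j = i") (auto intro: poly_fun.intros)
    then show "poly_fun u'" unfolding u'_def
      by (rule poly_fun_compose[OF poly_in_imp_poly_fun[OF u]])
    show "u' x = u' y" if "\<And>j. j \<in> S' \<Longrightarrow> x $ j = y $ j" for x y
      unfolding u'_def by (rule poly_in_cong[OF u]) (use that S'(1) in auto)
  qed
  have "upd p0 i c = p0" by (simp add: vec_eq_iff c_def)
  then have "u' \<noteq> (\<lambda>x. 0)" using p0 unfolding u'_def by metis
  have c_poly: "poly_in {i} (\<lambda>x. x $ i - c)" by (intro poly_in_intros) simp
  \<comment> \<open>Stated for an arbitrary directed \<open>J\<close> containing the ideal of
    \<open>W\<close>, because it is used both for \<open>W\<close> itself and for the union of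
    ideals along a chain.\<close>
  have lift: "\<exists>w. (\<forall>j\<in>S. w $ j = upd p i c $ j) \<and> (\<forall>g\<in>J. g w = 0)"
    if J: "vanishing_directed J" "vanishing_ideal W \<subseteq> J" and "lies_over J S (upd p i c)"
      and "u' p \<noteq> 0" for J p
  proof (rule lies_over_lift[OF J(1) that(3)])
    fix j assume j: "j \<notin> S"
    have "a j (d j) (upd p i c) \<noteq> 0" using that(4) j unfolding u'_def u_def by auto
    then show "\<exists>a d. (\<forall>k. poly_in S (a k)) \<and> psum a (Suc d) j \<in> J \<and> a d (upd p i c) \<noteq> 0"
      using a(1,2)[OF j] J(2) by blast
  qed
  define A0 where "A0 = W \<inter> {x. x $ i - c = 0}"
  have A0_closed: "closedin zariski A0"
    unfolding A0_def using W closedin_zariski_hypersurface[OF poly_in_imp_poly_fun[OF c_poly]]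
    unfolding irreducible_variety_def by blast
  have W0: "zero_locus (vanishing_ideal W) = W"
    using W closedin_zariski_iff[of W] by (simp add: irreducible_variety_def)
  have A0_indep: "alg_indep A0 S'"
    unfolding alg_indep_def
  proof (intro allI impI, rule ccontr)
    fix f assume f: "poly_in S' f" "\<forall>x\<in>A0. f x = 0" "f \<noteq> (\<lambda>x. 0)"
    obtain p where p: "f p \<noteq> 0" "u' p \<noteq> 0"
      using poly_fun_mult_nonzero[OF poly_in_imp_poly_fun[OF f(1)] poly_in_imp_poly_fun[OF u'] f(3)
          \<open>u' \<noteq> (\<lambda>x. 0)\<close>] by blast
    have "lies_over (vanishing_ideal W) S (upd p i c)"
      unfolding lies_over_def using alg_indepD[OF S(1)] by fastforce
    then obtain w where w: "\<forall>j\<in>S. w $ j = upd p i c $ j" "\<forall>g\<in>vanishing_ideal W. g w = 0"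
      using lift[OF vanishing_directed_vanishing_ideal subset_refl _ p(2)] by blast
    then have "w \<in> W" using W0 by (auto simp: zero_locus_def)
    moreover have "w $ i = c" using w(1) i by simp
    ultimately have "w \<in> A0" unfolding A0_def by simp
    moreover have "f w = f p"
      by (rule poly_in_cong[OF f(1)]) (use w(1) S' in auto)
    ultimately show False using f(2) p(1) by auto
  qed
  \<comment> \<open>A minimal closed subset of \<open>A0\<close> on which \<open>S'\<close> stays independent is irreducible. It exists
    by Zorn's lemma: extending points shows that independence survives intersections of chains.\<close>
  define \<A> where "\<A> = {B. openin zariski B \<and> - B \<subseteq> A0 \<and> alg_indep (- B) S'}"
  have "- A0 \<in> \<A>"
    unfolding \<A>_def using A0_closed A0_indep
    by (simp add: openin_zariski closedin_zariski)
  moreover have "\<Union>\<C> \<in> \<A>" if \<C>: "\<C> \<noteq> {}" "subset.chain \<A> \<C>" for \<C>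
  proof -
    have \<C>\<A>: "B \<in> \<A>" if "B \<in> \<C>" for B using \<C>(2) that unfolding subset.chain_def by blast
    define J where "J = (\<Union>B\<in>\<C>. vanishing_ideal (- B))"
    have chain: "vanishing_ideal (- B) \<subseteq> vanishing_ideal (- C) \<or>
        vanishing_ideal (- C) \<subseteq> vanishing_ideal (- B)" if "B \<in> \<C>" "C \<in> \<C>" for B C
      using \<C>(2) that vanishing_ideal_antimono[of "- B" "- C"] vanishing_ideal_antimono[of "- C" "- B"]
      unfolding subset.chain_def by auto
    have J: "vanishing_directed J"
      unfolding vanishing_directed_def
    proof (intro conjI ballI)
      obtain B0 where "B0 \<in> \<C>" using \<C>(1) by blast
      moreover have "(\<lambda>x. 0) \<in> vanishing_ideal (- B0)" by (intro vanishing_idealI poly_fun.const refl)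
      ultimately show "J \<noteq> {}" unfolding J_def by blast
      fix f g assume "f \<in> J" "g \<in> J"
      then obtain B C where BC: "B \<in> \<C>" "C \<in> \<C>" "f \<in> vanishing_ideal (- B)" "g \<in> vanishing_ideal (- C)"
        unfolding J_def by blast
      then have "\<exists>D\<in>\<C>. f \<in> vanishing_ideal (- D) \<and> g \<in> vanishing_ideal (- D)"
        using chain[OF BC(1,2)] by blast
      then show "\<exists>A. f \<in> vanishing_ideal A \<and> g \<in> vanishing_ideal A \<and> vanishing_ideal A \<subseteq> J"
        unfolding J_def by blast
    qed
    have cJ: "(\<lambda>x. x $ i - c) \<in> J" and WJ: "vanishing_ideal W \<subseteq> J"
    proof -
      obtain B where B: "B \<in> \<C>" using \<C>(1) by blast
      then have "- B \<subseteq> A0" using \<C>\<A> unfolding \<A>_def by blast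
      then have "(\<lambda>x. x $ i - c) \<in> vanishing_ideal (- B)" "vanishing_ideal W \<subseteq> vanishing_ideal (- B)"
        using poly_in_imp_poly_fun[OF c_poly] unfolding A0_def vanishing_ideal_def by blast+
      then show "(\<lambda>x. x $ i - c) \<in> J" "vanishing_ideal W \<subseteq> J" using B unfolding J_def by blast+
    qed
    have J0: "f = (\<lambda>x. 0)" if "f \<in> J" "poly_in S' f" for f
    proof -
      obtain B where "B \<in> \<C>" "f \<in> vanishing_ideal (- B)" using \<open>f \<in> J\<close> unfolding J_def by blast
      then show ?thesis using \<C>\<A>[of B] alg_indepD[OF _ that(2)] unfolding \<A>_def by blast
    qed
    have "alg_indep (- \<Union>\<C>) S'"
      unfolding alg_indep_def
    proof (intro allI impI, rule ccontr)
      fix f assume f: "poly_in S' f" "\<forall>x\<in>- \<Union>\<C>. f x = 0" "f \<noteq> (\<lambda>x. 0)"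
      obtain p where p: "f p \<noteq> 0" "u' p \<noteq> 0"
        using poly_fun_mult_nonzero[OF poly_in_imp_poly_fun[OF f(1)] poly_in_imp_poly_fun[OF u'] f(3)
            \<open>u' \<noteq> (\<lambda>x. 0)\<close>] by blast
      have over': "lies_over J S' p" unfolding lies_over_def using J0 by fastforce
      \<comment> \<open>The relation \<open>x $ i - c\<close> has leading coefficient 1, so the
        point extends along \<open>i\<close> without any genericity, and the relation forces the new
        coordinate to be \<open>c\<close>.\<close>
      define l where "l = (\<lambda>k::nat. \<lambda>x::complex ^ 'n. if k = 0 then - c else 1)"
      have "psum l (Suc 1) i = (\<lambda>x. x $ i - c)" by (auto simp: psum_def l_def)
      then obtain t where t: "lies_over J S (upd p i t)"
        using lies_over_extend[OF J over' S'(2), of l 1] cJ S'(1) by (auto simp: l_def poly_in_const)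
      have "upd p i t $ i - c = 0"
        using t cJ poly_in_mono[OF c_poly, of S] i unfolding lies_over_def by blast
      then have "t = c" by simp
      then obtain w where w: "\<forall>j\<in>S. w $ j = upd p i c $ j" "\<forall>g\<in>J. g w = 0"
        using lift[OF J WJ _ p(2)] t by blast
      have "w \<in> - B" if "B \<in> \<C>" for B
      proof -
        have "closedin zariski (- B)"
          using \<C>\<A>[OF that] unfolding \<A>_def
          by (simp add: openin_zariski closedin_zariski)
        then have "zero_locus (vanishing_ideal (- B)) = - B" by (simp add: closedin_zariski_iff)
        moreover have "w \<in> zero_locus (vanishing_ideal (- B))"
          using w(2) that unfolding zero_locus_def J_def by blast
        ultimately show ?thesis by blast
      qed
      then have "f w = 0" using f(2) by blast
      moreover have "f w = f p"
        by (rule poly_in_cong[OF f(1)]) (use w(1) S' in auto)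
      ultimately show False using p(1) by simp
    qed
    moreover have "openin zariski (\<Union>\<C>)" using \<C>\<A> unfolding \<A>_def by (intro openin_Union) blast
    moreover have "- \<Union>\<C> \<subseteq> A0" using \<C>\<A> \<C>(1) unfolding \<A>_def by blast
    ultimately show ?thesis unfolding \<A>_def by blast
  qed
  ultimately obtain M where M: "M \<in> \<A>" "\<And>B. B \<in> \<A> \<Longrightarrow> M \<subseteq> B \<Longrightarrow> B = M"
    using subset_Zorn_nonempty[of \<A>] by blast
  define W' where "W' = - M"
  have W': "closedin zariski W'" "W' \<subseteq> A0" "alg_indep W' S'"
    using M(1) unfolding \<A>_def W'_def
    by (auto simp: openin_zariski closedin_zariski)
  \<comment> \<open>Cutting \<open>W'\<close> by a nontrivial equation makes some nonzero polynomial
    in \<open>S'\<close> vanish on the cut. If \<open>f * g\<close> vanished on \<open>W'\<close>,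
    so would the product of the two polynomials obtained for \<open>f\<close> and \<open>g\<close>,
    against independence of \<open>S'\<close>.\<close>
  have minimal: "\<not> alg_indep (W' \<inter> {x. f x = 0}) S'"
    if f: "poly_fun f" "f \<notin> vanishing_ideal W'" for f
  proof
    assume ind: "alg_indep (W' \<inter> {x. f x = 0}) S'"
    have "closedin zariski (W' \<inter> {x. f x = 0})"
      using W'(1) closedin_zariski_hypersurface[OF f(1)] by blast
    then have "- (W' \<inter> {x. f x = 0}) \<in> \<A>"
      unfolding \<A>_def using ind W'(2)
      by (auto simp: openin_zariski closedin_zariski)
    then have "- (W' \<inter> {x. f x = 0}) = M" using M(2) unfolding W'_def by blast
    then have "W' \<subseteq> {x. f x = 0}" unfolding W'_def by blast
    then show False using f unfolding vanishing_ideal_def by blast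
  qed
  have "zprime W'"
    unfolding zprime_def
  proof (intro conjI allI impI)
    have "poly_in S' (\<lambda>x. 1 :: complex)" by (rule poly_in_const)
    then show "W' \<noteq> {}" using W'(3) unfolding alg_indep_def by (metis empty_iff zero_neq_one)
    fix f g :: "complex ^ 'n \<Rightarrow> complex"
    assume fg: "poly_fun f" "poly_fun g" "f \<notin> vanishing_ideal W'" "g \<notin> vanishing_ideal W'"
    obtain f1 where f1: "poly_in S' f1" "\<forall>x\<in>W' \<inter> {x. f x = 0}. f1 x = 0" "f1 \<noteq> (\<lambda>x. 0)"
      using minimal[OF fg(1,3)] unfolding alg_indep_def by blast
    obtain g1 where g1: "poly_in S' g1" "\<forall>x\<in>W' \<inter> {x. g x = 0}. g1 x = 0" "g1 \<noteq> (\<lambda>x. 0)"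
      using minimal[OF fg(2,4)] unfolding alg_indep_def by blast
    show "\<exists>x\<in>W'. f x \<noteq> 0 \<and> g x \<noteq> 0"
    proof (rule ccontr)
      assume "\<not> ?thesis"
      then have "\<forall>x\<in>W'. f1 x * g1 x = 0" using f1(2) g1(2) by auto
      then have "(\<lambda>x. f1 x * g1 x) = (\<lambda>x. 0)"
        using W'(3) poly_in_mult[OF f1(1) g1(1)] unfolding alg_indep_def by blast
      moreover obtain x where "f1 x \<noteq> 0" "g1 x \<noteq> 0"
        using poly_fun_mult_nonzero[OF poly_in_imp_poly_fun[OF f1(1)] poly_in_imp_poly_fun[OF g1(1)]
            f1(3) g1(3)] by blast
      ultimately show False by (metis mult_eq_0_iff)
    qed
  qed
  then have irr: "irreducible_variety W'" using W'(1) irreducible_variety_iff by blast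
  have "W' \<noteq> W"
  proof
    assume "W' = W"
    then have "(\<lambda>x. x $ i - c) \<in> vanishing_ideal W"
      using W'(2) poly_in_imp_poly_fun[OF c_poly] unfolding A0_def by (intro vanishing_idealI) auto
    then have "(\<lambda>x. x $ i - c) = (\<lambda>x. 0)"
      using alg_indepD[OF S(1)] poly_in_mono[OF c_poly, of S] i by blast
    then have "upd p0 i (c + 1) $ i - c = 0" by metis
    then show False by simp
  qed
  then have "W' \<subset> W" using W'(2) unfolding A0_def by blast
  moreover have "adim W' = r"
    using adim_strict_mono[OF W irr \<open>W' \<subset> W\<close>] card_le_adim[OF W'(3)] S'(3) dim by simp
  ultimately show ?thesis using irr by blast
qed

text \<open>Along a strict chain \<open>adim\<close> grows by at least one at each step, which
  bounds its length; iterated sections produce a chain of the full length.\<close>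

theorem variety_dim_eq_adim:
  fixes W :: "(complex ^ 'n) set"
  assumes "irreducible_variety W"
  shows "variety_dim W = enat (adim W)"
proof (rule antisym)
  show "variety_dim W \<le> enat (adim W)"
    unfolding variety_dim_def
  proof (rule Sup_least, clarify)
    fix k :: nat and C :: "nat \<Rightarrow> (complex ^ 'n) set"
    assume C: "\<forall>i\<le>k. irreducible_variety (C i) \<and> C i \<subseteq> W" "\<forall>i<k. C i \<subset> C (Suc i)"
    have "i \<le> k \<Longrightarrow> i \<le> adim (C i)" for i
    proof (induction i)
      case (Suc i)
      then have "adim (C i) < adim (C (Suc i))" using C by (intro adim_strict_mono) auto
      then show ?case using Suc by simp
    qed simp
    then have "k \<le> adim (C k)" by simp
    also have "\<dots> \<le> adim W"
      using C(1) irreducible_variety_def by (intro adim_mono) auto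
    finally show "enat k \<le> enat (adim W)" by simp
  qed
  have "\<exists>C. (\<forall>i\<le>r. irreducible_variety (C i) \<and> C i \<subseteq> W) \<and> (\<forall>i<r. C i \<subset> C (Suc i))"
    if "irreducible_variety W" "adim W = r" for W :: "(complex ^ 'n) set" and r
    using that
  proof (induction r arbitrary: W)
    case 0
    then show ?case by (intro exI[of _ "\<lambda>i. W"]) auto
  next
    case (Suc r)
    obtain W' where W': "irreducible_variety W'" "W' \<subset> W" "adim W' = r"
      using ex_irreducible_section[OF Suc.prems] by blast
    obtain C where C: "\<forall>i\<le>r. irreducible_variety (C i) \<and> C i \<subseteq> W'" "\<forall>i<r. C i \<subset> C (Suc i)"
      using Suc.IH[OF W'(1,3)] by blast
    define D where "D = (\<lambda>i. if i \<le> r then C i else W)"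
    have "irreducible_variety (D i) \<and> D i \<subseteq> W" for i
      using C(1) W'(2) Suc.prems(1) unfolding D_def by auto
    moreover have "D i \<subset> D (Suc i)" if "i < Suc r" for i
    proof (cases "i = r")
      case True
      then show ?thesis using C(1) W'(2) unfolding D_def by auto
    next
      case False
      then show ?thesis using C(2) that unfolding D_def by auto
    qed
    ultimately show ?case by blast
  qed
  from this[OF assms refl] show "enat (adim W) \<le> variety_dim W"
    unfolding variety_dim_def by (intro Sup_upper) blast
qed


section \<open>Directional derivatives\<close>

definition dd :: "(complex ^ 'n \<Rightarrow> complex) \<Rightarrow> complex ^ 'n \<Rightarrow> complex ^ 'n \<Rightarrow> complex" where
  "dd f x v = deriv (\<lambda>t. f (x + t *s v)) 0"

lemma has_dd:
  assumes "poly_fun f"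
  shows "((\<lambda>t. f (x + t *s v)) has_field_derivative dd f x v) (at 0)"
proof -
  obtain q where "\<forall>t. poly q t = f (x + t *s v)" using poly_fun_line[OF assms] by metis
  then have "(\<lambda>t. f (x + t *s v)) = poly q" by auto
  then show ?thesis
    unfolding dd_def using poly_DERIV[of q 0] DERIV_imp_deriv[OF poly_DERIV[of q 0]] by simp
qed

lemma dd_unique: "((\<lambda>t. f (x + t *s v)) has_field_derivative D) (at 0) \<Longrightarrow> dd f x v = D"
  unfolding dd_def by (rule DERIV_imp_deriv)

lemma dd_const [simp]: "dd (\<lambda>x. c) x v = 0"
  by (rule dd_unique) simp

lemma dd_coord [simp]: "dd (\<lambda>x. x $ i) x v = v $ i"
  by (rule dd_unique) (auto intro!: derivative_eq_intros)

lemma dd_add: "poly_fun f \<Longrightarrow> poly_fun g \<Longrightarrow> dd (\<lambda>x. f x + g x) x v = dd f x v + dd g x v"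
  by (rule dd_unique) (intro DERIV_add has_dd)

lemma dd_mult:
  assumes "poly_fun f" "poly_fun g"
  shows "dd (\<lambda>x. f x * g x) x v = f x * dd g x v + g x * dd f x v"
  using DERIV_mult[OF has_dd[OF assms(1), of x v] has_dd[OF assms(2), of x v]]
  by (intro dd_unique) (simp add: ac_simps)

lemma dd_cmult: "poly_fun f \<Longrightarrow> dd (\<lambda>x. c * f x) x v = c * dd f x v"
  using dd_mult[OF poly_fun.const, of f c] by simp

lemma dd_sum:
  assumes "finite I" "\<And>i. i \<in> I \<Longrightarrow> poly_fun (f i)"
  shows "dd (\<lambda>x. \<Sum>i\<in>I. f i x) x v = (\<Sum>i\<in>I. dd (f i) x v)"
  using assms by induction (auto simp: dd_add poly_fun_sum)

lemma dd_coord_power: "dd (\<lambda>x. x $ i ^ k) x v = of_nat k * x $ i ^ (k - 1) * v $ i"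
  by (rule dd_unique) (auto intro!: derivative_eq_intros)

lemma dd_poly_in_cong:
  assumes "poly_in T f" "\<And>i. i \<in> T \<Longrightarrow> v $ i = w $ i"
  shows "dd f x v = dd f x w"
proof -
  have "f (x + t *s v) = f (x + t *s w)" for t
    by (rule poly_in_cong[OF assms(1)]) (simp add: assms(2))
  then show ?thesis unfolding dd_def by simp
qed

lemma dd_zero_direction [simp]: "dd f x 0 = 0"
  unfolding dd_def by simp

lemma dd_bform:
  assumes "poly_fun f"
  shows "\<exists>g. (\<forall>i. poly_fun (\<lambda>x. g x $ i)) \<and> (\<forall>x v. dd f x v = bform (g x) v)"
  using assms
proof induction
  case (const c)
  show ?case
    by (intro exI[of _ "\<lambda>x. 0"]) (auto simp: bform_def intro: poly_fun.const)
next
  case (coord i)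
  show ?case
    by (intro exI[of _ "\<lambda>x. axis i 1"])
      (auto simp: bform_def axis_def if_distrib[of "\<lambda>c. c * _"] cong: if_cong intro: poly_fun.const)
next
  case (add f g)
  then obtain f' g' where "\<forall>i. poly_fun (\<lambda>x. f' x $ i)" "\<forall>x v. dd f x v = bform (f' x) v"
    "\<forall>i. poly_fun (\<lambda>x. g' x $ i)" "\<forall>x v. dd g x v = bform (g' x) v" by blast
  then show ?case
    by (intro exI[of _ "\<lambda>x. f' x + g' x"])
      (auto simp: dd_add add.hyps bform_def distrib_right sum.distrib intro: poly_fun.intros)
next
  case (mult f g)
  then obtain f' g' where "\<forall>i. poly_fun (\<lambda>x. f' x $ i)" "\<forall>x v. dd f x v = bform (f' x) v"
    "\<forall>i. poly_fun (\<lambda>x. g' x $ i)" "\<forall>x v. dd g x v = bform (g' x) v" by blast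
  then show ?case
    by (intro exI[of _ "\<lambda>x. f x *s g' x + g x *s f' x"])
      (auto simp: dd_mult mult.hyps bform_def distrib_right sum.distrib sum_distrib_left mult.assoc
        intro!: poly_fun.intros mult.hyps)
qed

section \<open>Gradients and the bilinear form\<close>

definition grad :: "(complex ^ 'n \<Rightarrow> complex) \<Rightarrow> complex ^ 'n \<Rightarrow> complex ^ 'n" where
  "grad f x = (\<chi> i. dd f x (axis i 1))"

lemma bform_axis [simp]: "bform y (axis i c) = y $ i * c" "bform (axis i c) y = c * y $ i"
  by (simp_all add: bform_def axis_def if_distrib[of "\<lambda>c. _ * c"] if_distrib[of "\<lambda>c. c * _"]
      cong: if_cong)

lemma bform_add_left: "bform (x + y) z = bform x z + bform y z"
  by (simp add: bform_def distrib_right sum.distrib)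

lemma bform_add_right: "bform z (x + y) = bform z x + bform z y"
  by (simp add: bform_def distrib_left sum.distrib)

lemma bform_scale_left: "bform (c *s x) z = c * bform x z"
  by (simp add: bform_def sum_distrib_left mult.assoc)

lemma bform_scale_right: "bform z (c *s x) = c * bform z x"
  by (simp add: bform_def sum_distrib_left ac_simps)

lemma bform_sum_left: "bform (\<Sum>i\<in>I. f i) z = (\<Sum>i\<in>I. bform (f i) z)"
  by (simp add: bform_def sum_distrib_right sum.swap[of _ I])

lemma bform_zero [simp]: "bform 0 z = 0" "bform z 0 = 0"
  by (simp_all add: bform_def)

lemma
  assumes "poly_fun f"
  shows poly_fun_grad: "poly_fun (\<lambda>x. grad f x $ i)"
    and dd_eq_bform_grad: "dd f x v = bform (grad f x) v"
proof -
  obtain g where g: "\<forall>i. poly_fun (\<lambda>x. g x $ i)" "\<forall>x v. dd f x v = bform (g x) v"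
    using dd_bform[OF assms] by blast
  have "grad f = g" by (intro ext) (simp add: grad_def vec_eq_iff g(2))
  then show "poly_fun (\<lambda>x. grad f x $ i)" "dd f x v = bform (grad f x) v"
    using g by simp_all
qed

lemma dd_add_direction: "poly_fun f \<Longrightarrow> dd f x (v + w) = dd f x v + dd f x w"
  by (simp add: dd_eq_bform_grad bform_add_right)

lemma dd_scale_direction: "poly_fun f \<Longrightarrow> dd f x (c *s v) = c * dd f x v"
  by (simp add: dd_eq_bform_grad bform_scale_right)

lemma dd_psum:
  assumes "\<And>k. poly_in T (a k)"
  shows "dd (psum a e i) x v =
    (\<Sum>k<e. dd (a k) x v * x $ i ^ k + a k x * (of_nat k * x $ i ^ (k - 1) * v $ i))"
  unfolding psum_def[abs_def] using poly_in_imp_poly_fun[OF assms]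
  by (subst dd_sum) (auto intro!: sum.cong poly_fun_intros simp: dd_mult dd_coord_power poly_fun_intros)

lemma dd_psum_axis:
  assumes "\<And>k. poly_in T (a k)" "i \<notin> T"
  shows "dd (psum a (Suc d) i) x (axis i 1) = psum (\<lambda>k x. of_nat (Suc k) * a (Suc k) x) d i x"
proof -
  have "dd (a k) x (axis i 1) = 0" for k
  proof -
    have "dd (a k) x (axis i 1) = dd (a k) x 0"
      by (rule dd_poly_in_cong[OF assms(1)]) (use assms(2) in \<open>auto simp: axis_def\<close>)
    then show ?thesis by simp
  qed
  then show ?thesis
    unfolding dd_psum[OF assms(1)] psum_def
    by (subst sum.lessThan_Suc_shift) (simp add: algebra_simps)
qed

lemma tangent_space_eq: "tangent_space X x = {v. \<forall>f\<in>vanishing_ideal X. dd f x v = 0}"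
  unfolding tangent_space_def dd_def ..

lemma tangent_space_mono: "A \<subseteq> B \<Longrightarrow> tangent_space A x \<subseteq> tangent_space B x"
  using vanishing_ideal_antimono[of A B] by (auto simp: tangent_space_eq)

lemma subspace_tangent_space: "vec.subspace (tangent_space X x)"
  unfolding tangent_space_eq vec.subspace_def
  by (auto simp: dd_add_direction dd_scale_direction vanishing_idealD(2))

section \<open>Generic tangent spaces\<close>

text \<open>The tangent space, at the image of \<open>x\<close>, of the closure of the projection of
  \<open>W\<close> to the coordinates in \<open>T\<close>, embedded by zeros in the other
  coordinates. It allows an induction on \<open>T\<close> from a basis up to all
  coordinates.\<close>

definition partial_tangent :: "(complex ^ 'n) set \<Rightarrow> 'n set \<Rightarrow> complex ^ 'n \<Rightarrow> (complex ^ 'n) set" where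
  "partial_tangent W T x = {v. (\<forall>i. i \<notin> T \<longrightarrow> v $ i = 0) \<and>
     (\<forall>f\<in>vanishing_ideal W. poly_in T f \<longrightarrow> dd f x v = 0)}"

lemma partial_tangent_UNIV: "partial_tangent W UNIV x = tangent_space W x"
  unfolding partial_tangent_def tangent_space_eq poly_in_UNIV by (auto simp: vanishing_idealD(2))

text \<open>Separability in characteristic zero: the derivative has degree below the minimal one, so
  if it vanished on \<open>W\<close>, minimality would force its top coefficient \<open>d\<close>
  times \<open>a d\<close> to vanish there.\<close>

lemma dd_relation_axis_not_vanishing:
  assumes rel: "min_rel W T i d a" and "i \<notin> T"
  shows "(\<lambda>x. dd (psum a (Suc d) i) x (axis i 1)) \<notin> vanishing_ideal W"
proof
  assume "(\<lambda>x. dd (psum a (Suc d) i) x (axis i 1)) \<in> vanishing_ideal W"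
  then have v: "psum (\<lambda>k x. of_nat (Suc k) * a (Suc k) x) d i \<in> vanishing_ideal W"
    unfolding dd_psum_axis[of T, OF min_relD(1)[OF rel] \<open>i \<notin> T\<close>] by simp
  have "d \<noteq> 0"
  proof
    assume "d = 0"
    then have "psum a (Suc d) i = a d" by (auto simp: psum_def)
    then show False using min_relD(2,3)[OF rel] by simp
  qed
  have "(\<lambda>x. of_nat (Suc (d - 1)) * a (Suc (d - 1)) x) \<in> vanishing_ideal W"
    by (rule min_relD(4)[OF rel _ order_refl v, of "d - 1"])
      (use \<open>d \<noteq> 0\<close> min_relD(1)[OF rel] in \<open>auto intro!: poly_in_intros\<close>)
  then have "(\<lambda>x. of_nat d * a d x) \<in> vanishing_ideal W" using \<open>d \<noteq> 0\<close> by simp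
  then have "a d \<in> vanishing_ideal W"
    using \<open>d \<noteq> 0\<close> poly_in_imp_poly_fun[OF min_relD(1)[OF rel]] unfolding vanishing_ideal_def by auto
  then show False using min_relD(3)[OF rel] by blast
qed

text \<open>The differential of the minimal relation determines the new component of a tangent
  vector. All other equations follow at \<open>x\<close>: up to a power of \<open>a d\<close> they
  are multiples of the relation plus a remainder whose coefficients already vanish on
  \<open>W\<close>.\<close>

lemma partial_tangent_extend:
  assumes rel: "min_rel W T i d a" and "i \<notin> T" and x: "x \<in> W" "a d x \<noteq> 0"
    and sep: "dd (psum a (Suc d) i) x (axis i 1) \<noteq> 0"
    and v: "v \<in> partial_tangent W T x"
  shows "\<exists>t. upd v i t \<in> partial_tangent W (insert i T) x"
proof -
  define F where "F = psum a (Suc d) i"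
  note aT = min_relD(1)[OF rel]
  have FT: "poly_in (insert i T) F" unfolding F_def by (intro poly_in_psum aT)
  note F_poly = poly_in_imp_poly_fun[OF FT]
  have FW: "F \<in> vanishing_ideal W" unfolding F_def by (rule min_relD(2)[OF rel])
  \<comment> \<open>The solution of the linear equation saying that \<open>v + t *s axis i 1\<close>
    is killed by the differential of \<open>F\<close>.\<close>
  define t where "t = - dd F x v / dd F x (axis i 1)"
  define w where "w = upd v i t"
  have vi: "v $ i = 0" using v \<open>i \<notin> T\<close> unfolding partial_tangent_def by blast
  have w: "w = v + t *s axis i 1" by (auto simp: w_def vec_eq_iff axis_def vi)
  have Fw: "dd F x w = 0"
    unfolding w dd_add_direction[OF F_poly] dd_scale_direction[OF F_poly] t_def
    using sep[folded F_def] by simp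
  have "dd f x w = 0" if f: "f \<in> vanishing_ideal W" "poly_in (insert i T) f" for f
  proof -
    obtain b0 e where b0: "\<And>k. poly_in T (b0 k)" "f = psum b0 e i"
      using poly_in_decomp[OF f(2) \<open>i \<notin> T\<close>] by blast
    obtain m b where b: "\<forall>k. poly_in T (b k)" "f = psum b (Suc (d + m)) i"
      using psum_pad_ex[of T b0 e i d, OF b0(1)] b0(2) by auto
    obtain q r where qr: "\<forall>k. poly_in T (q k)" "\<forall>k. poly_in T (r k)"
      "\<forall>x. a d x ^ Suc m * f x = psum q (Suc m) i x * F x + psum r d i x"
      using pseudo_division[of T a b d m i] aT b unfolding F_def by blast
    define Q R where "Q = psum q (Suc m) i" and "R = psum r d i"
    have QR: "poly_fun Q" "poly_fun R" unfolding Q_def R_def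
      using poly_in_imp_poly_fun[OF poly_in_psum] qr(1,2) by blast+
    have eq: "(\<lambda>x. a d x ^ Suc m * f x) = (\<lambda>x. Q x * F x + R x)"
      using qr(3) unfolding Q_def R_def by auto
    have R_eq: "R = (\<lambda>x. a d x ^ Suc m * f x - Q x * F x)"
      using fun_cong[OF eq] by (auto simp del: power_Suc)
    have "R \<in> vanishing_ideal W"
      unfolding R_eq
      by (intro vanishing_ideal_diff vanishing_ideal_mult f(1) FW QR(1) poly_fun_power
          poly_in_imp_poly_fun[OF aT])
    then have rW: "r k \<in> vanishing_ideal W" if "k < d" for k
      using min_relD(4)[OF rel, of r d k] qr(2) that unfolding R_def by blast
    have "dd R x w = 0"
    proof -
      have "dd (r k) x w = 0" "r k x = 0" if "k < d" for k
      proof -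
        have "dd (r k) x w = dd (r k) x v"
          by (rule dd_poly_in_cong[of T]) (use qr(2) \<open>i \<notin> T\<close> in \<open>auto simp: w_def\<close>)
        then show "dd (r k) x w = 0"
          using v rW[OF that] qr(2) unfolding partial_tangent_def by simp
        show "r k x = 0" using vanishing_idealD(1)[OF rW[OF that] x(1)] .
      qed
      then show ?thesis unfolding R_def using dd_psum[of T r d i x w] qr(2) by simp
    qed
    then have "dd (\<lambda>x. Q x * F x + R x) x w = 0"
      using Fw vanishing_idealD(1)[OF FW x(1)]
      by (simp add: dd_add dd_mult QR F_poly poly_fun.intros)
    then have "dd (\<lambda>x. a d x ^ Suc m * f x) x w = 0" unfolding eq .
    then have "a d x ^ Suc m * dd f x w = 0"
      using vanishing_idealD[OF f(1)] x(1) poly_in_imp_poly_fun[OF aT]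
      by (subst (asm) dd_mult) (auto intro: poly_fun_power simp del: power_Suc)
    then show ?thesis using x(2) by simp
  qed
  moreover have "w $ j = 0" if "j \<notin> insert i T" for j
    using v that unfolding w_def partial_tangent_def by auto
  ultimately have "w \<in> partial_tangent W (insert i T) x" unfolding partial_tangent_def by blast
  then show ?thesis unfolding w_def by blast
qed

lemma partial_tangent_restrict:
  assumes "v \<in> partial_tangent W (insert i T) x" "i \<notin> T"
  shows "upd v i 0 \<in> partial_tangent W T x"
  unfolding partial_tangent_def
proof (intro CollectI conjI ballI allI impI)
  show "upd v i 0 $ j = 0" if "j \<notin> T" for j
    using assms(1) that unfolding partial_tangent_def by auto
  fix f assume f: "f \<in> vanishing_ideal W" "poly_in T f"
  have "dd f x (upd v i 0) = dd f x v"
    by (rule dd_poly_in_cong[OF f(2)]) (use assms(2) in auto)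
  also have "\<dots> = 0"
    using assms(1) f poly_in_mono[OF f(2), of "insert i T"] unfolding partial_tangent_def by blast
  finally show "dd f x (upd v i 0) = 0" .
qed

text \<open>Over the basis \<open>S\<close> there are no equations. Each further coordinate adds one
  tangent component, which is determined uniquely wherever the leading coefficient and the
  derivative of its minimal relation are nonzero; \<open>h\<close> collects these factors.\<close>

lemma partial_tangent_generic:
  assumes W: "zprime W" and S: "alg_indep W S" "\<And>i. i \<notin> S \<Longrightarrow> \<not> alg_indep W (insert i S)"
    and "S \<subseteq> T"
  shows "\<exists>h. poly_fun h \<and> h \<notin> vanishing_ideal W \<and> (\<forall>x\<in>W. h x \<noteq> 0 \<longrightarrow>
    (\<forall>v\<in>partial_tangent W T x. (\<forall>i\<in>S. v $ i = 0) \<longrightarrow> v = 0) \<and>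
    (\<forall>c. \<exists>v\<in>partial_tangent W T x. \<forall>i\<in>S. v $ i = c $ i))"
  using \<open>S \<subseteq> T\<close>
proof (rule superset_induct)
  have S0: "f = (\<lambda>x. 0)" if "f \<in> vanishing_ideal W" "poly_in S f" for f
    using alg_indepD[OF S(1) that(2,1)] .
  have "(\<lambda>x. 1) \<notin> vanishing_ideal W"
    using W unfolding zprime_def vanishing_ideal_def by auto
  moreover have "\<exists>v\<in>partial_tangent W S x. \<forall>i\<in>S. v $ i = c $ i" for x c
    by (rule bexI[of _ "\<chi> i. if i \<in> S then c $ i else 0"])
      (auto simp: partial_tangent_def dest!: S0)
  moreover have "v = 0" if "v \<in> partial_tangent W S x" "\<forall>i\<in>S. v $ i = 0" for v x
    using that unfolding partial_tangent_def by (auto simp: vec_eq_iff)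
  ultimately show "\<exists>h. poly_fun h \<and> h \<notin> vanishing_ideal W \<and> (\<forall>x\<in>W. h x \<noteq> 0 \<longrightarrow>
    (\<forall>v\<in>partial_tangent W S x. (\<forall>i\<in>S. v $ i = 0) \<longrightarrow> v = 0) \<and>
    (\<forall>c. \<exists>v\<in>partial_tangent W S x. \<forall>i\<in>S. v $ i = c $ i))"
    by (intro exI[of _ "\<lambda>x. 1"]) (auto intro: poly_fun.const)
next
  fix T i
  assume T: "S \<subseteq> T" "i \<notin> T" and "\<exists>h. poly_fun h \<and> h \<notin> vanishing_ideal W \<and> (\<forall>x\<in>W. h x \<noteq> 0 \<longrightarrow>
    (\<forall>v\<in>partial_tangent W T x. (\<forall>i\<in>S. v $ i = 0) \<longrightarrow> v = 0) \<and>
    (\<forall>c. \<exists>v\<in>partial_tangent W T x. \<forall>i\<in>S. v $ i = c $ i))"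
  then obtain h where h: "poly_fun h" "h \<notin> vanishing_ideal W"
    and h_inj: "\<And>x v. x \<in> W \<Longrightarrow> h x \<noteq> 0 \<Longrightarrow> v \<in> partial_tangent W T x \<Longrightarrow> \<forall>i\<in>S. v $ i = 0 \<Longrightarrow> v = 0"
    and h_surj: "\<And>x c. x \<in> W \<Longrightarrow> h x \<noteq> 0 \<Longrightarrow> \<exists>v\<in>partial_tangent W T x. \<forall>i\<in>S. v $ i = c $ i"
    by blast
  have iS: "i \<notin> S" using T by blast
  obtain d a where rel: "min_rel W T i d a"
    using ex_min_rel[OF S(1) S(2)[OF iS] iS T(1)] .
  define F where "F = psum a (Suc d) i"
  have FT: "poly_in (insert i T) F" unfolding F_def by (intro poly_in_psum min_relD(1)[OF rel])
  note F_poly = poly_in_imp_poly_fun[OF FT]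
  have FW: "F \<in> vanishing_ideal W" unfolding F_def by (rule min_relD(2)[OF rel])
  define D where "D = (\<lambda>x. dd F x (axis i 1))"
  have D: "poly_fun D" "D \<notin> vanishing_ideal W"
    using poly_fun_grad[OF F_poly, of i] dd_relation_axis_not_vanishing[OF rel T(2)]
    by (simp_all add: D_def grad_def F_def)
  have ad: "poly_fun (a d)" "a d \<notin> vanishing_ideal W"
    using poly_in_imp_poly_fun[OF min_relD(1)[OF rel]] min_relD(3)[OF rel] by blast+
  define h' where "h' = (\<lambda>x. a d x * (h x * D x))"
  have "poly_fun h'" unfolding h'_def by (intro poly_fun.intros ad h D)
  moreover have "h' \<notin> vanishing_ideal W"
    unfolding h'_def
    using zprime_mult[OF W ad(1) poly_fun.mult[OF h(1) D(1)] _ ad(2)]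
      zprime_mult[OF W h(1) D(1) _ h(2)] D(2) by blast
  moreover have "v = 0" if x: "x \<in> W" "h' x \<noteq> 0" and v: "v \<in> partial_tangent W (insert i T) x"
    "\<forall>i\<in>S. v $ i = 0" for x v
  proof -
    have "upd v i 0 = 0"
      using x v(2) iS by (intro h_inj[OF x(1) _ partial_tangent_restrict[OF v(1) T(2)]])
        (auto simp: h'_def)
    then have "v = v $ i *s axis i 1" by (auto simp: vec_eq_iff axis_def) metis+
    then have "dd F x v = v $ i * D x" using dd_scale_direction[OF F_poly] unfolding D_def by metis
    moreover have "dd F x v = 0" using v(1) FW FT unfolding partial_tangent_def by blast
    ultimately have "v $ i = 0" using x(2) unfolding h'_def by simp
    then show "v = 0" using \<open>v = v $ i *s axis i 1\<close> by simp
  qed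
  moreover have "\<exists>v\<in>partial_tangent W (insert i T) x. \<forall>i\<in>S. v $ i = c $ i"
    if x: "x \<in> W" "h' x \<noteq> 0" for x c
  proof -
    obtain v where v: "v \<in> partial_tangent W T x" "\<forall>i\<in>S. v $ i = c $ i"
      using h_surj[OF x(1)] x(2) unfolding h'_def by fastforce
    obtain t where "upd v i t \<in> partial_tangent W (insert i T) x"
      using partial_tangent_extend[OF rel T(2) x(1) _ _ v(1)] x(2) unfolding h'_def D_def F_def
      by fastforce
    moreover have "\<forall>j\<in>S. upd v i t $ j = c $ j" using v(2) iS by auto
    ultimately show ?thesis by blast
  qed
  ultimately show "\<exists>h. poly_fun h \<and> h \<notin> vanishing_ideal W \<and> (\<forall>x\<in>W. h x \<noteq> 0 \<longrightarrow>
    (\<forall>v\<in>partial_tangent W (insert i T) x. (\<forall>i\<in>S. v $ i = 0) \<longrightarrow> v = 0) \<and>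
    (\<forall>c. \<exists>v\<in>partial_tangent W (insert i T) x. \<forall>i\<in>S. v $ i = c $ i))"
    by blast
qed

section \<open>Dimension bounds by coordinate projection\<close>

definition coord_proj :: "'n set \<Rightarrow> complex ^ 'n \<Rightarrow> complex ^ 'n" where
  "coord_proj S v = (\<chi> i. if i \<in> S then v $ i else 0)"

lemma linear_coord_proj: "Vector_Spaces.linear (*s) (*s) (coord_proj S)"
  by (simp add: Vector_Spaces.linear_iff vec.vector_space_axioms coord_proj_def vec_eq_iff)

lemma inj_on_coord_proj:
  assumes "vec.subspace V" "\<And>v. v \<in> V \<Longrightarrow> (\<And>i. i \<in> S \<Longrightarrow> v $ i = 0) \<Longrightarrow> v = 0"
  shows "inj_on (coord_proj S) V"
proof (rule inj_onI)
  fix v w assume vw: "v \<in> V" "w \<in> V" "coord_proj S v = coord_proj S w"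
  have "(v - w) $ i = 0" if "i \<in> S" for i
    using arg_cong[OF vw(3), of "\<lambda>u. u $ i"] that by (simp add: coord_proj_def)
  then have "v - w = 0" using assms(2) vec.subspace_diff[OF assms(1) vw(1,2)] by blast
  then show "v = w" by simp
qed

lemma dim_le_card_coords:
  assumes "vec.subspace V" "\<And>v. v \<in> V \<Longrightarrow> (\<And>i. i \<in> S \<Longrightarrow> v $ i = 0) \<Longrightarrow> v = 0"
  shows "vec.dim (V :: (complex ^ 'n) set) \<le> card S"
proof -
  have span: "vec.span V = V" using assms(1) by (simp only: vec.span_eq_iff)
  have "inj_on (coord_proj S) (vec.span V)" unfolding span by (rule inj_on_coord_proj[OF assms])
  then have "vec.dim V = vec.dim (coord_proj S ` V)"
    by (rule vec.dim_image_eq[OF linear_coord_proj, symmetric])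
  also have "\<dots> \<le> vec.dim {x :: complex ^ 'n. \<forall>i. i \<notin> S \<longrightarrow> x $ i = 0}"
    by (rule vec.dim_subset) (auto simp: coord_proj_def)
  finally show ?thesis by (simp add: dim_substandard_cart)
qed

lemma dim_ge_card_coords:
  assumes "\<And>c. \<exists>v\<in>V. \<forall>i\<in>S. v $ i = c $ i"
  shows "card S \<le> vec.dim (V :: (complex ^ 'n) set)"
proof -
  have "{x :: complex ^ 'n. \<forall>i. i \<notin> S \<longrightarrow> x $ i = 0} \<subseteq> coord_proj S ` V"
  proof
    fix c :: "complex ^ 'n" assume c: "c \<in> {x. \<forall>i. i \<notin> S \<longrightarrow> x $ i = 0}"
    obtain v where v: "v \<in> V" "\<forall>i\<in>S. v $ i = c $ i" using assms by blast
    have "c = coord_proj S v" using v(2) c by (auto simp: vec_eq_iff coord_proj_def)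
    then show "c \<in> coord_proj S ` V" using v(1) by blast
  qed
  from vec.dim_subset[OF this] have "card S \<le> vec.dim (coord_proj S ` V)"
    unfolding dim_substandard_cart .
  also have "\<dots> \<le> vec.dim V" by (rule vec.dim_image_le[OF linear_coord_proj])
  finally show ?thesis .
qed

theorem generic_tangent_space:
  fixes W :: "(complex ^ 'n) set"
  assumes "zprime W"
  obtains S h where "alg_indep W S" "card S = adim W" "poly_fun h" "h \<notin> vanishing_ideal W"
    "\<And>x v. x \<in> W \<Longrightarrow> h x \<noteq> 0 \<Longrightarrow> v \<in> tangent_space W x \<Longrightarrow> (\<And>i. i \<in> S \<Longrightarrow> v $ i = 0) \<Longrightarrow> v = 0"
    "\<And>x. x \<in> W \<Longrightarrow> h x \<noteq> 0 \<Longrightarrow> vec.dim (tangent_space W x) = adim W"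
proof -
  have "W \<noteq> {}" using assms unfolding zprime_def by simp
  then obtain S where S: "alg_indep W S" "card S = adim W"
    "\<And>i. i \<notin> S \<Longrightarrow> \<not> alg_indep W (insert i S)"
    using adim_basis[of W] by blast
  obtain h where h: "poly_fun h" "h \<notin> vanishing_ideal W"
    and inj: "\<And>x v. x \<in> W \<Longrightarrow> h x \<noteq> 0 \<Longrightarrow> v \<in> tangent_space W x \<Longrightarrow> \<forall>i\<in>S. v $ i = 0 \<Longrightarrow> v = 0"
    and surj: "\<And>x c. x \<in> W \<Longrightarrow> h x \<noteq> 0 \<Longrightarrow> \<exists>v\<in>tangent_space W x. \<forall>i\<in>S. v $ i = c $ i"
    using partial_tangent_generic[OF assms S(1,3) subset_UNIV] unfolding partial_tangent_UNIV by blast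
  have "vec.dim (tangent_space W x) = adim W" if "x \<in> W" "h x \<noteq> 0" for x
    unfolding S(2)[symmetric]
    by (intro antisym dim_le_card_coords dim_ge_card_coords subspace_tangent_space)
      (use inj[OF that] surj[OF that] in blast)+
  then show ?thesis using that[OF S(1,2) h] inj by blast
qed


section \<open>Frames of polynomial covector fields\<close>

lemma poly_fun_det:
  assumes "\<And>i j. poly_fun (\<lambda>x. A x $ i $ j)"
  shows "poly_fun (\<lambda>x. det (A x))"
  unfolding det_def by (intro poly_fun_sum poly_fun.mult poly_fun.const poly_fun_prod assms)

text \<open>The determinant is the \<open>J\<close> by \<open>J\<close> minor of the covectors. If
  it is nonzero, the covectors are independent and the coordinates outside \<open>J\<close>
  parametrise their common kernel.\<close>

definition frame_mat :: "'n set \<Rightarrow> ('n \<Rightarrow> complex ^ 'n) \<Rightarrow> complex ^ 'n ^ 'n" where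
  "frame_mat J b = (\<chi> k. if k \<in> J then b k else axis k 1)"

lemma frame_mat_mult: "(frame_mat J b *v v) $ k = (if k \<in> J then bform (b k) v else v $ k)"
proof -
  have "(frame_mat J b *v v) $ k = bform (frame_mat J b $ k) v"
    by (simp add: matrix_vector_mult_def bform_def)
  then show ?thesis by (simp add: frame_mat_def)
qed

lemma frame_mat_ker:
  assumes "det (frame_mat J b) \<noteq> 0" "\<And>k. k \<in> J \<Longrightarrow> bform (b k) v = 0" "\<And>k. k \<notin> J \<Longrightarrow> v $ k = 0"
  shows "v = 0"
proof -
  have "\<exists>B. B ** frame_mat J b = mat 1"
    using assms(1) by (simp add: invertible_det_nz[symmetric] invertible_left_inverse)
  moreover have "frame_mat J b *v v = 0"
    using assms(2,3) by (simp add: vec_eq_iff frame_mat_mult)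
  ultimately show ?thesis using matrix_left_invertible_ker by blast
qed

lemma frame_mat_solve:
  assumes "det (frame_mat J b) \<noteq> 0"
  obtains v where "\<And>k. k \<in> J \<Longrightarrow> bform (b k) v = 0" "\<And>k. k \<notin> J \<Longrightarrow> v $ k = c $ k"
proof -
  have "\<exists>B. frame_mat J b ** B = mat 1"
    using assms by (simp add: invertible_det_nz[symmetric] invertible_right_inverse)
  then obtain v where v: "frame_mat J b *v v = (\<chi> k. if k \<in> J then 0 else c $ k)"
    unfolding matrix_right_invertible_surjective surj_def by metis
  have "(if k \<in> J then bform (b k) v else v $ k) = (if k \<in> J then 0 else c $ k)" for k
    using arg_cong[OF v, of "\<lambda>w. w $ k"] by (simp add: frame_mat_mult)
  then show ?thesis using that[of v] by presburger
qed

lemma frame_mat_rows: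
  assumes "det (frame_mat J b) \<noteq> 0"
  obtains c where "\<And>j. y $ j = (\<Sum>k\<in>J. c k *s b k) $ j + (if j \<in> J then 0 else c j)"
proof -
  have "invertible (transpose (frame_mat J b))"
    unfolding invertible_det_nz det_transpose by (rule assms)
  then have "\<exists>B. transpose (frame_mat J b) ** B = mat 1"
    unfolding invertible_right_inverse .
  then obtain c where c: "y = transpose (frame_mat J b) *v c"
    unfolding matrix_right_invertible_surjective surj_def by blast
  have "y $ j = (\<Sum>k\<in>J. c $ k *s b k) $ j + (if j \<in> J then 0 else c $ j)" for j
  proof -
    have "y $ j = (\<Sum>k\<in>UNIV. frame_mat J b $ k $ j * c $ k)"
      unfolding c by (simp add: matrix_vector_mult_def transpose_def)
    also have "\<dots> = (\<Sum>k\<in>J. frame_mat J b $ k $ j * c $ k) + (\<Sum>k\<in>- J. frame_mat J b $ k $ j * c $ k)"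
      by (subst sum.union_disjoint[symmetric]) auto
    also have "(\<Sum>k\<in>- J. frame_mat J b $ k $ j * c $ k) = (\<Sum>k\<in>- J. if k = j then c $ j else 0)"
      by (rule sum.cong) (auto simp: frame_mat_def axis_def)
    also have "\<dots> = (if j \<in> J then 0 else c $ j)" by simp
    also have "(\<Sum>k\<in>J. frame_mat J b $ k $ j * c $ k) = (\<Sum>k\<in>J. c $ k *s b k) $ j"
      by (simp add: frame_mat_def mult.commute)
    finally show ?thesis .
  qed
  then show ?thesis using that[of "\<lambda>k. c $ k"] by simp
qed

lemma frame_mat_annihilator:
  assumes det: "det (frame_mat J b) \<noteq> 0"
    and y: "\<And>v. (\<And>k. k \<in> J \<Longrightarrow> bform (b k) v = 0) \<Longrightarrow> bform y v = 0"
  obtains c where "y = (\<Sum>k\<in>J. c k *s b k)"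
proof -
  obtain c where c: "\<And>j. y $ j = (\<Sum>k\<in>J. c k *s b k) $ j + (if j \<in> J then 0 else c j)"
    using frame_mat_rows[OF det] by blast
  have "c j = 0" if j: "j \<notin> J" for j
  proof -
    \<comment> \<open>A test vector in the common kernel whose only nonzero coordinate outside
      \<open>J\<close> is the \<open>j\<close>-th; it reads off \<open>c j\<close>.\<close>
    obtain v where v: "\<And>k. k \<in> J \<Longrightarrow> bform (b k) v = 0" "\<And>k. k \<notin> J \<Longrightarrow> v $ k = axis j 1 $ k"
      using frame_mat_solve[OF det] by blast
    have "y = (\<Sum>k\<in>J. c k *s b k) + (\<chi> j. if j \<in> J then 0 else c j)"
      using c by (simp add: vec_eq_iff)
    then have "bform y v = bform (\<chi> j. if j \<in> J then 0 else c j) v"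
      using v(1) by (simp add: bform_add_left bform_sum_left bform_scale_left)
    also have "\<dots> = (\<Sum>l\<in>UNIV. if l = j then c j else 0)"
      unfolding bform_def using v(2) j by (intro sum.cong) (auto simp: axis_def)
    also have "\<dots> = c j" by simp
    finally show ?thesis using y[OF v(1)] by simp
  qed
  then have "y = (\<Sum>k\<in>J. c k *s b k)" using c by (simp add: vec_eq_iff)
  then show ?thesis using that by blast
qed

lemma frame_mat_span_zero:
  assumes det: "det (frame_mat J b) \<noteq> 0"
    and "\<And>j. j \<in> J \<Longrightarrow> (\<Sum>k\<in>J. c k *s b k) $ j = 0"
  shows "(\<Sum>k\<in>J. c k *s b k) = 0"
proof -
  define w where "w = (\<Sum>k\<in>J. c k *s b k)"
  have "w $ j = 0" if j: "j \<notin> J" for j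
  proof -
    obtain v where v: "\<And>k. k \<in> J \<Longrightarrow> bform (b k) v = 0" "\<And>k. k \<notin> J \<Longrightarrow> v $ k = axis j 1 $ k"
      using frame_mat_solve[OF det] by blast
    have "w $ l * v $ l = (if l = j then w $ j else 0)" for l
      using v(2)[of l] j assms(2)[folded w_def, of l] by (cases "l \<in> J") (auto simp: axis_def)
    then have "w $ j = bform w v" unfolding bform_def by simp
    also have "\<dots> = 0"
      unfolding w_def using v(1) by (simp add: bform_sum_left bform_scale_left)
    finally show ?thesis .
  qed
  then have "w = 0" using assms(2) unfolding w_def vec_eq_iff by (metis zero_index)
  then show ?thesis unfolding w_def .
qed

lemma subspace_frame_ker: "vec.subspace {v. \<forall>k\<in>J. bform (b k) v = 0}"
  by (auto simp: vec.subspace_def bform_add_right bform_scale_right)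

lemma dim_frame_ker:
  assumes "det (frame_mat J b) \<noteq> 0"
  shows "vec.dim {v. \<forall>k\<in>J. bform (b k) v = 0} = card (- J)"
proof (rule antisym)
  show "vec.dim {v. \<forall>k\<in>J. bform (b k) v = 0} \<le> card (- J)"
    by (rule dim_le_card_coords[OF subspace_frame_ker]) (use frame_mat_ker[OF assms] in auto)
  show "card (- J) \<le> vec.dim {v. \<forall>k\<in>J. bform (b k) v = 0}"
  proof (rule dim_ge_card_coords)
    fix c
    obtain v where "\<And>k. k \<in> J \<Longrightarrow> bform (b k) v = 0" "\<And>k. k \<notin> J \<Longrightarrow> v $ k = c $ k"
      using frame_mat_solve[OF assms, of c] by blast
    then show "\<exists>v\<in>{v. \<forall>k\<in>J. bform (b k) v = 0}. \<forall>i\<in>- J. v $ i = c $ i"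
      by (intro bexI[of _ v]) simp_all
  qed
qed

text \<open>Gaussian elimination as an extremal argument: take a largest pivot set that admits a
  reduced basis. A vector left over after reduction would supply another pivot.\<close>

lemma ex_reduced_frame:
  fixes G :: "(complex ^ 'n) set"
  assumes G: "vec.subspace G"
  shows "\<exists>J b. (\<forall>k\<in>J. b k \<in> G) \<and> (\<forall>k\<in>J. \<forall>j\<in>J. b k $ j = (if j = k then 1 else 0)) \<and>
    (\<forall>g\<in>G. g = (\<Sum>k\<in>J. g $ k *s b k))"
proof -
  define P where "P = (\<lambda>J. \<exists>b. (\<forall>k\<in>J. b k \<in> G) \<and> (\<forall>k\<in>J. \<forall>j\<in>J. b k $ j = (if j = k then 1 else 0)))"
  have "P {}" unfolding P_def by simp
  moreover have "\<forall>J. P J \<longrightarrow> card J < Suc CARD('n)" by (simp add: card_mono less_Suc_eq_le)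
  ultimately have "\<exists>J. P J \<and> (\<forall>J'. P J' \<longrightarrow> card J' \<le> card J)"
    by (rule ex_has_greatest_nat)
  then obtain J where J: "P J" and max: "\<And>J'. P J' \<Longrightarrow> card J' \<le> card J"
    by blast
  obtain b where b: "\<And>k. k \<in> J \<Longrightarrow> b k \<in> G" "\<And>k j. k \<in> J \<Longrightarrow> j \<in> J \<Longrightarrow> b k $ j = (if j = k then 1 else 0)"
    using J unfolding P_def by blast
  have "g = (\<Sum>k\<in>J. g $ k *s b k)" if g: "g \<in> G" for g
  proof (rule ccontr)
    assume neq: "g \<noteq> (\<Sum>k\<in>J. g $ k *s b k)"
    define g' where "g' = g - (\<Sum>k\<in>J. g $ k *s b k)"
    have g'G: "g' \<in> G" unfolding g'_def
      by (intro vec.subspace_diff[OF G] vec.subspace_sum[OF G] vec.subspace_scale[OF G] g b(1))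
    have g'J: "g' $ j = 0" if "j \<in> J" for j
    proof -
      have "(\<Sum>k\<in>J. g $ k *s b k) $ j = (\<Sum>k\<in>J. if k = j then g $ j else 0)"
        unfolding sum_component using b(2) that by (intro sum.cong) auto
      then show ?thesis using that by (simp add: g'_def)
    qed
    have "g' \<noteq> 0" using neq by (simp add: g'_def)
    then obtain i where i: "g' $ i \<noteq> 0" by (auto simp: vec_eq_iff)
    then have iJ: "i \<notin> J" using g'J by blast
    define e where "e = (1 / g' $ i) *s g'"
    have e: "e \<in> G" "e $ i = 1" "\<And>j. j \<in> J \<Longrightarrow> e $ j = 0"
      unfolding e_def using i g'J vec.subspace_scale[OF G g'G] by auto
    \<comment> \<open>The new vector \<open>e\<close>, normalised at the pivot \<open>i\<close>,
      clears column \<open>i\<close> of the old vectors; it vanishes in the old pivot columns, so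
      these stay reduced.\<close>
    define b' where "b' = (\<lambda>k. if k = i then e else b k - b k $ i *s e)"
    have "b' k \<in> G" if "k \<in> insert i J" for k
      unfolding b'_def using that e(1) b(1)
      by (auto intro!: vec.subspace_diff[OF G] vec.subspace_scale[OF G])
    moreover have "b' k $ j = (if j = k then 1 else 0)" if "k \<in> insert i J" "j \<in> insert i J" for k j
      unfolding b'_def using that e(2,3) b(2) iJ by auto
    ultimately have "P (insert i J)" unfolding P_def by blast
    then show False using max[of "insert i J"] iJ by simp
  qed
  then show ?thesis using b by blast
qed

text \<open>Only complex linear combinations are required, not a module structure: this suffices for
  the values at each point to form a subspace.\<close>

definition covector_fields :: "(complex ^ 'n \<Rightarrow> complex ^ 'n) set \<Rightarrow> bool" where
  "covector_fields \<G> \<longleftrightarrow> (\<lambda>x. 0) \<in> \<G> \<and> (\<forall>\<xi>\<in>\<G>. \<forall>i. poly_fun (\<lambda>x. \<xi> x $ i)) \<and>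
     (\<forall>\<xi>\<in>\<G>. \<forall>\<eta>\<in>\<G>. (\<lambda>x. \<xi> x + \<eta> x) \<in> \<G>) \<and> (\<forall>c. \<forall>\<xi>\<in>\<G>. (\<lambda>x. c *s \<xi> x) \<in> \<G>)"

definition annihilator :: "(complex ^ 'n \<Rightarrow> complex ^ 'n) set \<Rightarrow> complex ^ 'n \<Rightarrow> (complex ^ 'n) set" where
  "annihilator \<G> x = {v. \<forall>\<xi>\<in>\<G>. bform (\<xi> x) v = 0}"

lemma subspace_annihilator: "vec.subspace (annihilator \<G> x)"
  by (auto simp: annihilator_def vec.subspace_def bform_add_right bform_scale_right)

text \<open>A reduced basis of the values at \<open>x\<close> is lifted to fields in the family.
  Being reduced, it has the identity matrix as its \<open>J\<close> by \<open>J\<close>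
  block.\<close>

lemma ex_frame:
  fixes \<G> :: "(complex ^ 'n \<Rightarrow> complex ^ 'n) set"
  assumes \<G>: "covector_fields \<G>"
  obtains J \<xi> where "\<And>k. k \<in> J \<Longrightarrow> \<xi> k \<in> \<G>" "det (frame_mat J (\<lambda>k. \<xi> k x)) \<noteq> 0"
    "annihilator \<G> x = {v. \<forall>k\<in>J. bform (\<xi> k x) v = 0}"
proof -
  define G where "G = (\<lambda>\<xi>. \<xi> x) ` \<G>"
  have "vec.subspace G"
    using \<G> unfolding vec.subspace_def G_def covector_fields_def by (auto simp: image_iff)
  from ex_reduced_frame[OF this] obtain J b where b: "\<forall>k\<in>J. b k \<in> G"
    "\<forall>k\<in>J. \<forall>j\<in>J. b k $ j = (if j = k then 1 else 0)"
    "\<forall>g\<in>G. g = (\<Sum>k\<in>J. g $ k *s b k)"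
    by (elim exE conjE) (rule that)
  have "\<forall>k\<in>J. \<exists>\<xi>\<in>\<G>. b k = \<xi> x" using b(1) unfolding G_def by blast
  then obtain \<xi> where \<xi>: "\<And>k. k \<in> J \<Longrightarrow> \<xi> k \<in> \<G>" "\<And>k. k \<in> J \<Longrightarrow> b k = \<xi> k x" by metis
  have mat: "frame_mat J (\<lambda>k. \<xi> k x) = frame_mat J b"
    using \<xi>(2) by (simp add: frame_mat_def vec_eq_iff)
  have "v = 0" if v: "frame_mat J b *v v = 0" for v
  proof -
    have v': "(if k \<in> J then bform (b k) v else v $ k) = 0" for k
      using arg_cong[OF v, of "\<lambda>w. w $ k"] by (simp add: frame_mat_mult)
    then have off: "v $ k = 0" if "k \<notin> J" for k using that by presburger
    have "v $ k = 0" if k: "k \<in> J" for k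
    proof -
      have "b k $ j * v $ j = (if j = k then v $ k else 0)" for j
        using b(2) k off[of j] by (cases "j \<in> J") auto
      then have "bform (b k) v = v $ k" unfolding bform_def by simp
      then show ?thesis using v'[of k] k by simp
    qed
    then show "v = 0" using off by (auto simp: vec_eq_iff)
  qed
  then have "det (frame_mat J b) \<noteq> 0"
    by (simp add: invertible_det_nz[symmetric] invertible_left_inverse matrix_left_invertible_ker)
  moreover have "annihilator \<G> x = {v. \<forall>k\<in>J. bform (\<xi> k x) v = 0}"
  proof (intro set_eqI iffI)
    fix v assume v: "v \<in> {v. \<forall>k\<in>J. bform (\<xi> k x) v = 0}"
    have "bform (\<eta> x) v = 0" if "\<eta> \<in> \<G>" for \<eta>
    proof -
      have "\<eta> x \<in> G" using that unfolding G_def by blast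
      then have "\<eta> x = (\<Sum>k\<in>J. \<eta> x $ k *s b k)" by (rule b(3)[rule_format])
      also have "\<dots> = (\<Sum>k\<in>J. \<eta> x $ k *s \<xi> k x)"
        by (intro sum.cong) (simp_all add: \<xi>(2))
      finally have "bform (\<eta> x) v = bform (\<Sum>k\<in>J. \<eta> x $ k *s \<xi> k x) v"
        by (rule arg_cong)
      then have "bform (\<eta> x) v = (\<Sum>k\<in>J. \<eta> x $ k * bform (\<xi> k x) v)"
        unfolding bform_sum_left bform_scale_left .
      then show ?thesis using v by simp
    qed
    then show "v \<in> annihilator \<G> x" unfolding annihilator_def by blast
  qed (use \<xi>(1) in \<open>auto simp: annihilator_def\<close>)
  ultimately show ?thesis using that[OF \<xi>(1)] mat by simp
qed

lemma annihilator_eq_frame_ker: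
  assumes "\<And>k. k \<in> J \<Longrightarrow> \<xi> k \<in> \<G>" "det (frame_mat J (\<lambda>k. \<xi> k x)) \<noteq> 0"
  shows "vec.dim (annihilator \<G> x) \<le> card (- J)"
    and "card (- J) \<le> vec.dim (annihilator \<G> x) \<Longrightarrow>
      annihilator \<G> x = {v. \<forall>k\<in>J. bform (\<xi> k x) v = 0}"
proof -
  have sub: "annihilator \<G> x \<subseteq> {v. \<forall>k\<in>J. bform (\<xi> k x) v = 0}"
    using assms(1) unfolding annihilator_def by blast
  from vec.dim_subset[OF sub] show "vec.dim (annihilator \<G> x) \<le> card (- J)"
    unfolding dim_frame_ker[OF assms(2)] .
  assume "card (- J) \<le> vec.dim (annihilator \<G> x)"
  then show "annihilator \<G> x = {v. \<forall>k\<in>J. bform (\<xi> k x) v = 0}"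
    using dim_frame_ker[OF assms(2)]
    by (intro vec.subspace_dim_equal subspace_annihilator subspace_frame_ker sub) simp
qed

lemma poly_fun_det_frame:
  assumes "\<And>k i. k \<in> J \<Longrightarrow> poly_fun (\<lambda>x. \<xi> k x $ i)"
  shows "poly_fun (\<lambda>x. det (frame_mat J (\<lambda>k. \<xi> k x)))"
proof (rule poly_fun_det)
  fix i j
  show "poly_fun (\<lambda>x. frame_mat J (\<lambda>k. \<xi> k x) $ i $ j)"
    by (cases "i \<in> J") (auto simp: frame_mat_def assms intro: poly_fun.const)
qed

lemma covector_fields_poly_fun: "covector_fields \<G> \<Longrightarrow> \<xi> \<in> \<G> \<Longrightarrow> poly_fun (\<lambda>x. \<xi> x $ i)"
  unfolding covector_fields_def by blast

text \<open>The fields that form a frame at \<open>p\<close> remain independent wherever their minor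
  is nonzero, and there they bound the annihilator by the dimension at \<open>p\<close>.\<close>

lemma annihilator_semicontinuous:
  assumes "covector_fields \<G>"
  obtains h where "poly_fun h" "h p \<noteq> 0"
    "\<And>x. h x \<noteq> 0 \<Longrightarrow> vec.dim (annihilator \<G> x) \<le> vec.dim (annihilator \<G> p)"
proof -
  obtain J \<xi> where \<xi>: "\<And>k. k \<in> J \<Longrightarrow> \<xi> k \<in> \<G>" "det (frame_mat J (\<lambda>k. \<xi> k p)) \<noteq> 0"
    "annihilator \<G> p = {v. \<forall>k\<in>J. bform (\<xi> k p) v = 0}"
    using ex_frame[OF assms, where x = p] by blast
  have "poly_fun (\<lambda>x. det (frame_mat J (\<lambda>k. \<xi> k x)))"
    by (rule poly_fun_det_frame) (use covector_fields_poly_fun[OF assms \<xi>(1)] in blast)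
  moreover have "vec.dim (annihilator \<G> x) \<le> vec.dim (annihilator \<G> p)"
    if "det (frame_mat J (\<lambda>k. \<xi> k x)) \<noteq> 0" for x
    using annihilator_eq_frame_ker(1)[of J \<xi> \<G> x] \<xi>(1) that dim_frame_ker[OF \<xi>(2)]
    unfolding \<xi>(3) by simp
  ultimately show ?thesis using that[of "\<lambda>x. det (frame_mat J (\<lambda>k. \<xi> k x))"] \<xi>(2) by blast
qed

section \<open>Gradients of the vanishing ideal and normal vectors\<close>

definition gradients :: "(complex ^ 'n) set \<Rightarrow> (complex ^ 'n \<Rightarrow> complex ^ 'n) set" where
  "gradients X = grad ` vanishing_ideal X"

lemma grad_add: "poly_fun f \<Longrightarrow> poly_fun g \<Longrightarrow> grad (\<lambda>x. f x + g x) = (\<lambda>x. grad f x + grad g x)"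
  by (simp add: grad_def fun_eq_iff vec_eq_iff dd_add)

lemma grad_cmult: "poly_fun f \<Longrightarrow> grad (\<lambda>x. c * f x) = (\<lambda>x. c *s grad f x)"
  by (simp add: grad_def fun_eq_iff vec_eq_iff dd_cmult)

lemma covector_fields_gradients: "covector_fields (gradients X)"
proof -
  have "(\<lambda>x. 0) \<in> gradients X"
  proof -
    have "(\<lambda>x. 0) \<in> vanishing_ideal X" by (intro vanishing_idealI poly_fun.const refl)
    moreover have "grad (\<lambda>x :: complex ^ 'a. 0) = (\<lambda>x. 0)"
      by (simp add: grad_def fun_eq_iff vec_eq_iff)
    ultimately show ?thesis unfolding gradients_def by force
  qed
  moreover have "(\<lambda>x. grad f x + grad g x) \<in> gradients X"
    if fg: "f \<in> vanishing_ideal X" "g \<in> vanishing_ideal X" for f g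
    unfolding gradients_def grad_add[OF vanishing_idealD(2)[OF fg(1)] vanishing_idealD(2)[OF fg(2)], symmetric]
    by (intro imageI vanishing_ideal_add fg)
  moreover have "(\<lambda>x. c *s grad f x) \<in> gradients X" if f: "f \<in> vanishing_ideal X" for f c
    unfolding gradients_def grad_cmult[OF vanishing_idealD(2)[OF f], symmetric]
    by (intro imageI vanishing_ideal_mult f poly_fun.const)
  ultimately show ?thesis
    unfolding covector_fields_def by (auto simp: gradients_def poly_fun_grad vanishing_idealD(2))
qed

lemma annihilator_gradients: "annihilator (gradients X) x = tangent_space X x"
  by (auto simp: annihilator_def gradients_def tangent_space_eq dd_eq_bform_grad vanishing_idealD(2))

text \<open>Double annihilator: a normal vector is a constant combination of frame gradients at
  \<open>x\<close>, and the same combination of the underlying polynomials lies in the ideal. Hence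
  each normal vector extends to a polynomial normal field.\<close>

lemma normal_vectors_eq: "normal_vectors X x = (\<lambda>f. grad f x) ` vanishing_ideal X"
proof (intro set_eqI iffI)
  fix y assume y: "y \<in> normal_vectors X x"
  obtain J \<xi> where \<xi>: "\<And>k. k \<in> J \<Longrightarrow> \<xi> k \<in> gradients X" "det (frame_mat J (\<lambda>k. \<xi> k x)) \<noteq> 0"
    "annihilator (gradients X) x = {v. \<forall>k\<in>J. bform (\<xi> k x) v = 0}"
    using ex_frame[OF covector_fields_gradients, where x = x] by blast
  obtain c where c: "y = (\<Sum>k\<in>J. c k *s \<xi> k x)"
    by (rule frame_mat_annihilator[OF \<xi>(2)])
      (use y \<xi>(3) in \<open>auto simp: normal_vectors_def annihilator_gradients\<close>)
  have "\<forall>k\<in>J. \<exists>f\<in>vanishing_ideal X. \<xi> k = grad f" using \<xi>(1) unfolding gradients_def by blast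
  then obtain f where f: "\<And>k. k \<in> J \<Longrightarrow> f k \<in> vanishing_ideal X" "\<And>k. k \<in> J \<Longrightarrow> \<xi> k = grad (f k)"
    by metis
  define F where "F = (\<lambda>x. \<Sum>k\<in>J. c k * f k x)"
  have "F \<in> vanishing_ideal X" unfolding F_def
    by (intro vanishing_idealI poly_fun_sum poly_fun.mult poly_fun.const)
      (simp_all add: vanishing_idealD(1)[OF f(1)] vanishing_idealD(2)[OF f(1)])
  moreover have "grad F x = y"
  proof -
    have "grad F x $ i = y $ i" for i
    proof -
      have "grad F x $ i = (\<Sum>k\<in>J. dd (\<lambda>x. c k * f k x) x (axis i 1))"
        unfolding F_def grad_def using vanishing_idealD(2)[OF f(1)]
        by (subst dd_sum[symmetric]) (auto intro: poly_fun.intros)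
      also have "\<dots> = y $ i"
        unfolding c sum_component using f vanishing_idealD(2)[OF f(1)]
        by (intro sum.cong) (auto simp: dd_cmult grad_def)
      finally show ?thesis .
    qed
    then show ?thesis by (simp add: vec_eq_iff)
  qed
  ultimately show "y \<in> (\<lambda>f. grad f x) ` vanishing_ideal X" by blast
next
  fix y assume "y \<in> (\<lambda>f. grad f x) ` vanishing_ideal X"
  then show "y \<in> normal_vectors X x"
    by (auto simp: normal_vectors_def tangent_space_eq dd_eq_bform_grad vanishing_idealD(2))
qed

text \<open>The tangent dimension can only drop on an open set around \<open>x\<close>, and by
  irreducibility this set contains points where it has its generic value
  \<open>adim X\<close>.\<close>

lemma adim_le_dim_tangent_space:
  assumes X: "zprime X" and x: "x \<in> X"
  shows "adim X \<le> vec.dim (tangent_space X x)"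
proof -
  obtain h where h: "poly_fun h" "h x \<noteq> 0"
    "\<And>y. h y \<noteq> 0 \<Longrightarrow> vec.dim (annihilator (gradients X) y) \<le> vec.dim (annihilator (gradients X) x)"
    using annihilator_semicontinuous[OF covector_fields_gradients, where p = x] by blast
  obtain S g where g: "poly_fun g" "g \<notin> vanishing_ideal X"
    "\<And>y. y \<in> X \<Longrightarrow> g y \<noteq> 0 \<Longrightarrow> vec.dim (tangent_space X y) = adim X"
    using generic_tangent_space[OF X] by metis
  have "h \<notin> vanishing_ideal X" using h(2) x vanishing_idealD(1) by blast
  then obtain y where "y \<in> X" "h y \<noteq> 0" "g y \<noteq> 0" using zprimeE[OF X h(1) g(1) _ g(2)] by blast
  then show ?thesis using h(3)[of y] g(3)[of y] unfolding annihilator_gradients by simp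
qed


section \<open>Products and projections\<close>

lemma pr1_vpair [simp]: "pr1 (vpair x u) = x"
  and pr2_vpair [simp]: "pr2 (vpair x u) = u"
  and vpair_pr [simp]: "vpair (pr1 p) (pr2 p) = p"
  by (auto simp: pr1_def pr2_def vpair_def vec_eq_iff split: sum.split)

lemma vpair_nth [simp]: "vpair x u $ Inl i = x $ i" "vpair x u $ Inr i = u $ i"
  and pr_nth [simp]: "pr1 p $ i = p $ Inl i" "pr2 p $ i = p $ Inr i"
  by (simp_all add: vpair_def pr1_def pr2_def)

lemma vpair_eq_iff [simp]: "vpair x u = vpair y v \<longleftrightarrow> x = y \<and> u = v"
  by (metis pr1_vpair pr2_vpair)

lemma pr_add_scale:
  "pr1 (p + t *s w) = pr1 p + t *s pr1 w" "pr2 (p + t *s w) = pr2 p + t *s pr2 w"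
  by (simp_all add: vec_eq_iff)

lemma poly_fun_pr1: "poly_fun f \<Longrightarrow> poly_fun (\<lambda>p. f (pr1 p))"
  and poly_fun_pr2: "poly_fun f \<Longrightarrow> poly_fun (\<lambda>p. f (pr2 p))"
  by (rule poly_fun_compose, assumption, simp add: poly_fun.coord)+

lemma poly_fun_vpair:
  assumes "poly_fun f" "\<And>i. poly_fun (\<lambda>x. \<phi> x $ i)" "\<And>i. poly_fun (\<lambda>x. \<psi> x $ i)"
  shows "poly_fun (\<lambda>x. f (vpair (\<phi> x) (\<psi> x)))"
proof (rule poly_fun_compose[OF assms(1)])
  fix k
  show "poly_fun (\<lambda>x. vpair (\<phi> x) (\<psi> x) $ k)"
    by (cases k) (simp_all add: assms(2,3))
qed

lemma dd_pr1: "dd (\<lambda>p. f (pr1 p)) p w = dd f (pr1 p) (pr1 w)"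
  and dd_pr2: "dd (\<lambda>p. f (pr2 p)) p w = dd f (pr2 p) (pr2 w)"
  unfolding dd_def pr_add_scale by simp_all

lemma zprime_image:
  assumes E: "zprime E" and \<phi>: "\<And>i. poly_fun (\<lambda>x. \<phi> x $ i)"
  shows "zprime (\<phi> ` E)"
  unfolding zprime_def
proof (intro conjI allI impI)
  show "\<phi> ` E \<noteq> {}" using E unfolding zprime_def by simp
  fix f g assume fg: "poly_fun f" "poly_fun g" "f \<notin> vanishing_ideal (\<phi> ` E)"
    "g \<notin> vanishing_ideal (\<phi> ` E)"
  have "(\<lambda>x. f (\<phi> x)) \<notin> vanishing_ideal E" "(\<lambda>x. g (\<phi> x)) \<notin> vanishing_ideal E"
    using fg unfolding vanishing_ideal_def by auto
  from zprimeE[OF E poly_fun_compose[OF fg(1) \<phi>] poly_fun_compose[OF fg(2) \<phi>] this]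
  obtain x where "x \<in> E" "f (\<phi> x) \<noteq> 0" "g (\<phi> x) \<noteq> 0" .
  then show "\<exists>x\<in>\<phi> ` E. f x \<noteq> 0 \<and> g x \<noteq> 0" by blast
qed

lemma poly_fun_not_vanishing: "x \<in> W \<Longrightarrow> f x \<noteq> 0 \<Longrightarrow> f \<notin> vanishing_ideal W"
  using vanishing_idealD(1) by blast

text \<open>A frame at a smooth point has as many covectors as the codimension of \<open>X\<close>.
  Where its minor is nonzero it bounds the tangent space from above by \<open>adim X\<close>, which
  is also the lower bound, so on that open part of \<open>X\<close> it cuts out the tangent space
  exactly.\<close>

lemma smooth_frame:
  fixes X :: "(complex ^ 'n) set"
  assumes X: "irreducible_variety X" and z: "z \<in> smooth_locus X"
  obtains J \<xi> where "\<And>k. k \<in> J \<Longrightarrow> \<xi> k \<in> gradients X" "card (- J) = adim X"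
    "det (frame_mat J (\<lambda>k. \<xi> k z)) \<noteq> 0"
    "\<And>x. x \<in> X \<Longrightarrow> det (frame_mat J (\<lambda>k. \<xi> k x)) \<noteq> 0 \<Longrightarrow> x \<in> smooth_locus X"
    "\<And>x. x \<in> X \<Longrightarrow> det (frame_mat J (\<lambda>k. \<xi> k x)) \<noteq> 0 \<Longrightarrow>
      tangent_space X x = {v. \<forall>k\<in>J. bform (\<xi> k x) v = 0}"
proof -
  have smooth: "smooth_locus X = {x \<in> X. vec.dim (tangent_space X x) = adim X}"
    unfolding smooth_locus_def variety_dim_eq_adim[OF X] by simp
  obtain J \<xi> where \<xi>: "\<And>k. k \<in> J \<Longrightarrow> \<xi> k \<in> gradients X" "det (frame_mat J (\<lambda>k. \<xi> k z)) \<noteq> 0"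
    "annihilator (gradients X) z = {v. \<forall>k\<in>J. bform (\<xi> k z) v = 0}"
    using ex_frame[OF covector_fields_gradients, where x = z] by blast
  have card: "card (- J) = adim X"
    using z dim_frame_ker[OF \<xi>(2)] unfolding \<xi>(3)[symmetric] annihilator_gradients smooth by simp
  have "vec.dim (tangent_space X x) = adim X"
    "tangent_space X x = {v. \<forall>k\<in>J. bform (\<xi> k x) v = 0}"
    if x: "x \<in> X" "det (frame_mat J (\<lambda>k. \<xi> k x)) \<noteq> 0" for x
  proof -
    have ge: "card (- J) \<le> vec.dim (tangent_space X x)"
      unfolding card using X x(1) irreducible_variety_iff by (intro adim_le_dim_tangent_space) blast+
    note ann = annihilator_eq_frame_ker[of J \<xi> "gradients X" x, OF \<xi>(1) x(2),
        unfolded annihilator_gradients]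
    show "tangent_space X x = {v. \<forall>k\<in>J. bform (\<xi> k x) v = 0}"
      using ann(2) ge by blast
    show "vec.dim (tangent_space X x) = adim X"
      using ann(1) ge card by simp
  qed
  then show ?thesis using that[of J \<xi>, OF \<xi>(1) card \<xi>(2)] unfolding smooth by blast
qed

section \<open>The conditional incidence set\<close>

definition cond_incidence :: "(complex ^ 'n) set \<Rightarrow> (complex ^ 'n) set \<Rightarrow> (complex ^ ('n + 'n)) set" where
  "cond_incidence X Z = {vpair x u | x u. x \<in> smooth_locus X \<inter> Z \<and> u - x \<in> normal_vectors X x}"

lemma cond_ED_corr_eq: "cond_ED_corr X Z = zariski closure_of cond_incidence X Z"
  unfolding cond_ED_corr_def cond_incidence_def ..

lemma vpair_in_cond_incidence:
  "vpair x u \<in> cond_incidence X Z \<longleftrightarrow> x \<in> smooth_locus X \<and> x \<in> Z \<and> u - x \<in> normal_vectors X x"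
  unfolding cond_incidence_def by auto

lemma subspace_normal_vectors: "vec.subspace (normal_vectors X x)"
  by (auto simp: normal_vectors_def vec.subspace_def bform_add_left bform_scale_left)

text \<open>Every normal vector at \<open>x\<close> is the value at \<open>x\<close> of a gradient field, so every point of the
  incidence set lies on a polynomial section over \<open>Z\<close>.\<close>

lemma cond_incidence_section:
  assumes "vpair x u \<in> cond_incidence X Z"
  obtains \<phi> where "\<phi> \<in> vanishing_ideal X" "u = x + grad \<phi> x"
proof -
  obtain \<phi> where "\<phi> \<in> vanishing_ideal X" "u - x = grad \<phi> x"
    using assms unfolding vpair_in_cond_incidence normal_vectors_eq by blast
  then show ?thesis using that[of \<phi>] by (simp add: algebra_simps)
qed

text \<open>Primality is used twice. Polynomial sections through points with \<open>f\<close> and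
  \<open>g\<close> nonzero give, by primality of \<open>Z\<close>, one base point \<open>x\<close>
  where both sections are defined and nonvanishing; then the fibre over \<open>x\<close>, an affine
  space, provides a common point.\<close>

lemma zprime_cond_incidence:
  fixes X Z :: "(complex ^ 'n) set"
  assumes X: "irreducible_variety X" and Z: "irreducible_variety Z" "Z \<subseteq> X"
    and "\<not> Z \<subseteq> singular_locus X"
  shows "zprime (cond_incidence X Z)"
  unfolding zprime_def
proof (intro conjI allI impI)
  have Zp: "zprime Z" using Z irreducible_variety_iff by blast
  obtain z where "z \<in> Z" "z \<in> smooth_locus X" using assms(4) Z(2) unfolding singular_locus_def by blast
  then have "vpair z z \<in> cond_incidence X Z"
    by (simp add: vpair_in_cond_incidence vec.subspace_0[OF subspace_normal_vectors])
  then show "cond_incidence X Z \<noteq> {}" by blast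
  fix f g :: "complex ^ ('n + 'n) \<Rightarrow> complex"
  assume fg: "poly_fun f" "poly_fun g" "f \<notin> vanishing_ideal (cond_incidence X Z)"
    "g \<notin> vanishing_ideal (cond_incidence X Z)"
  have section_ex: "\<exists>x\<in>smooth_locus X \<inter> Z. \<exists>\<phi>\<in>vanishing_ideal X. f (vpair x (x + grad \<phi> x)) \<noteq> 0"
    if f: "poly_fun f" "f \<notin> vanishing_ideal (cond_incidence X Z)" for f
  proof -
    obtain p where p: "p \<in> cond_incidence X Z" "f p \<noteq> 0" using f unfolding vanishing_ideal_def by blast
    then obtain x u where xu: "p = vpair x u" unfolding cond_incidence_def by blast
    obtain \<phi> where "\<phi> \<in> vanishing_ideal X" "u = x + grad \<phi> x"
      using cond_incidence_section p(1) unfolding xu by blast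
    then show ?thesis using p xu vpair_in_cond_incidence by blast
  qed
  obtain x1 \<phi> where x1: "x1 \<in> smooth_locus X" "x1 \<in> Z" "\<phi> \<in> vanishing_ideal X"
    "f (vpair x1 (x1 + grad \<phi> x1)) \<noteq> 0" using section_ex[OF fg(1,3)] by blast
  obtain x2 \<psi> where x2: "x2 \<in> Z" "\<psi> \<in> vanishing_ideal X"
    "g (vpair x2 (x2 + grad \<psi> x2)) \<noteq> 0" using section_ex[OF fg(2,4)] by blast
  obtain J \<xi> where \<xi>: "\<And>k. k \<in> J \<Longrightarrow> \<xi> k \<in> gradients X" "det (frame_mat J (\<lambda>k. \<xi> k x1)) \<noteq> 0"
    "\<And>x. x \<in> X \<Longrightarrow> det (frame_mat J (\<lambda>k. \<xi> k x)) \<noteq> 0 \<Longrightarrow> x \<in> smooth_locus X"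
    by (rule smooth_frame[OF X x1(1)], rule that)
  define h where "h = (\<lambda>x. det (frame_mat J (\<lambda>k. \<xi> k x)))"
  have h: "poly_fun h" unfolding h_def
    by (rule poly_fun_det_frame) (use covector_fields_poly_fun[OF covector_fields_gradients \<xi>(1)] in blast)
  \<comment> \<open>The factor \<open>h\<close> ensures that the base point found is smooth on
    \<open>X\<close>, so that its fibre belongs to the incidence set.\<close>
  define f' where "f' = (\<lambda>x. h x * f (vpair x (x + grad \<phi> x)))"
  define g' where "g' = (\<lambda>x. g (vpair x (x + grad \<psi> x)))"
  have sec: "poly_fun (\<lambda>x. (x + grad \<eta> x) $ i)" if "\<eta> \<in> vanishing_ideal X" for \<eta> i
    using poly_fun_grad[OF vanishing_idealD(2)[OF that]] by (simp add: poly_fun.intros)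
  have poly: "poly_fun f'" "poly_fun g'"
    unfolding f'_def g'_def
    by (intro poly_fun.mult h poly_fun_vpair fg poly_fun.coord sec x1 x2)+
  have "f' \<notin> vanishing_ideal Z"
    by (rule poly_fun_not_vanishing[OF x1(2)]) (use x1(4) \<xi>(2) in \<open>simp add: f'_def h_def\<close>)
  moreover have "g' \<notin> vanishing_ideal Z"
    by (rule poly_fun_not_vanishing[OF x2(1)]) (use x2(3) in \<open>simp add: g'_def\<close>)
  ultimately obtain x where x: "x \<in> Z" "f' x \<noteq> 0" "g' x \<noteq> 0"
    using zprimeE[OF Zp poly] by blast
  have xs: "x \<in> smooth_locus X" using \<xi>(3)[of x] x Z(2) unfolding f'_def h_def by auto
  define A where "A = {vpair x u | u. u - x \<in> normal_vectors X x}"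
  have A: "vpair x u \<in> A \<longleftrightarrow> u - x \<in> normal_vectors X x" for u
    unfolding A_def by auto
  have sub: "A \<subseteq> cond_incidence X Z" unfolding A_def using vpair_in_cond_incidence xs x(1) by blast
  have inA: "vpair x (x + grad \<eta> x) \<in> A" if "\<eta> \<in> vanishing_ideal X" for \<eta>
    unfolding A normal_vectors_eq using that by simp
  note N = subspace_normal_vectors[of X x]
  have "zprime A"
  proof (rule zprime_affine)
    show "A \<noteq> {}" using inA x1(3) by blast
    fix p q t assume "p \<in> A" "q \<in> A"
    then obtain u v where uv: "p = vpair x u" "q = vpair x v"
      "u - x \<in> normal_vectors X x" "v - x \<in> normal_vectors X x" unfolding A_def by blast
    have "p + t *s (q - p) = vpair x (u + t *s (v - u))"
      unfolding uv by (auto simp: vec_eq_iff vpair_def split: sum.split)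
    moreover have "u + t *s (v - u) - x = (u - x) + t *s ((v - x) - (u - x))"
      by (simp add: algebra_simps)
    moreover have "(u - x) + t *s ((v - x) - (u - x)) \<in> normal_vectors X x"
      by (rule vec.subspace_add[OF N uv(3) vec.subspace_scale[OF N vec.subspace_diff[OF N uv(4,3)]]])
    ultimately show "p + t *s (q - p) \<in> A" by (simp only: A)
  qed
  moreover have "f \<notin> vanishing_ideal A"
    by (rule poly_fun_not_vanishing[OF inA[OF x1(3)]]) (use x(2) in \<open>auto simp: f'_def\<close>)
  moreover have "g \<notin> vanishing_ideal A"
    by (rule poly_fun_not_vanishing[OF inA[OF x2(2)]]) (use x(3) in \<open>auto simp: g'_def\<close>)
  ultimately obtain p where "p \<in> A" "f p \<noteq> 0" "g p \<noteq> 0"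
    using zprimeE[OF _ fg(1,2), of A] by blast
  then show "\<exists>x\<in>cond_incidence X Z. f x \<noteq> 0 \<and> g x \<noteq> 0" using sub by blast
qed

section \<open>Determinantal equations for normal vectors\<close>

definition row_replace :: "complex ^ 'n ^ 'n \<Rightarrow> 'n \<Rightarrow> complex ^ 'n \<Rightarrow> complex ^ 'n ^ 'n" where
  "row_replace M k y = (\<chi> i. if i = k then y else M $ i)"

text \<open>Linearity in the replaced row makes the normality equations affine along lines with
  fixed \<open>x\<close>, so their directional derivatives can be read off as determinants.\<close>

lemma det_row_replace_affine:
  "det (row_replace M k (y + t *s w)) = det (row_replace M k y) + t * det (row_replace M k w)"
  unfolding row_replace_def
  using det_row_add[of k "\<lambda>i. y" "\<lambda>i. t *s w" "\<lambda>i. M $ i"] det_row_mul[of k t "\<lambda>i. w" "\<lambda>i. M $ i"]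
  by simp

lemma row_replace_frame_mult:
  "(row_replace (frame_mat J b) k y *v v) $ i =
    (if i = k then bform y v else if i \<in> J then bform (b i) v else v $ i)"
proof -
  have "(row_replace (frame_mat J b) k y *v v) $ i = bform (row_replace (frame_mat J b) k y $ i) v"
    by (simp add: matrix_vector_mult_def bform_def)
  then show ?thesis by (simp add: row_replace_def frame_mat_def)
qed

lemma det_eq_0_iff_ker: "det (M :: complex ^ 'n ^ 'n) = 0 \<longleftrightarrow> (\<exists>v. v \<noteq> 0 \<and> M *v v = 0)"
proof -
  have "det M \<noteq> 0 \<longleftrightarrow> (\<forall>v. M *v v = 0 \<longrightarrow> v = 0)"
    unfolding invertible_det_nz[symmetric] invertible_left_inverse matrix_left_invertible_ker ..
  then show ?thesis by blast
qed

text \<open>For \<open>k\<close> outside \<open>J\<close>, the determinant below tests whether the \<open>k\<close>-th frame coefficient of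
  \<open>y\<close> vanishes, so that these equations together say that \<open>y\<close> is normal.\<close>

lemma det_row_replace_span:
  assumes det: "det (frame_mat J b) \<noteq> 0" and "k \<notin> J" and y: "y = (\<Sum>j\<in>J. c j *s b j)"
  shows "det (row_replace (frame_mat J b) k y) = 0"
proof -
  obtain v where v: "\<And>k. k \<in> J \<Longrightarrow> bform (b k) v = 0" "\<And>l. l \<notin> J \<Longrightarrow> v $ l = axis k 1 $ l"
    using frame_mat_solve[OF det, of "axis k 1"] by blast
  have "bform y v = 0" unfolding y bform_sum_left bform_scale_left using v(1) by simp
  then have "row_replace (frame_mat J b) k y *v v = 0"
    using v by (auto simp: vec_eq_iff row_replace_frame_mult axis_def)
  moreover have "v $ k = 1" using v(2) \<open>k \<notin> J\<close> by simp
  then have "v \<noteq> 0" by auto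
  ultimately show ?thesis unfolding det_eq_0_iff_ker by blast
qed

text \<open>The determinants force \<open>w\<close> into the span of the frame, and an element of
  this span is determined by its coordinates in \<open>J\<close>.\<close>

lemma row_replace_dets_zero:
  assumes det: "det (frame_mat J b) \<noteq> 0"
    and zero: "\<And>k. k \<notin> J \<Longrightarrow> det (row_replace (frame_mat J b) k w) = 0"
    and wJ: "\<And>j. j \<in> J \<Longrightarrow> w $ j = 0"
  shows "w = 0"
proof -
  obtain c where c: "\<And>j. w $ j = (\<Sum>k\<in>J. c k *s b k) $ j + (if j \<in> J then 0 else c j)"
    using frame_mat_rows[OF det] by blast
  have w: "w = (\<Sum>k\<in>J. c k *s b k) + (\<chi> j. if j \<in> J then 0 else c j)"
    using c by (simp add: vec_eq_iff)
  have "c k = 0" if k: "k \<notin> J" for k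
  proof (rule ccontr)
    assume ck: "c k \<noteq> 0"
    obtain v where v: "v \<noteq> 0" "row_replace (frame_mat J b) k w *v v = 0"
      using zero[OF k] unfolding det_eq_0_iff_ker by blast
    have v': "(if i = k then bform w v else if i \<in> J then bform (b i) v else v $ i) = 0" for i
      using arg_cong[OF v(2), of "\<lambda>u. u $ i"] unfolding row_replace_frame_mult by simp
    have vJ: "bform (b i) v = 0" if "i \<in> J" for i using v'[of i] that k by (auto split: if_splits)
    have voff: "v $ i = 0" if "i \<notin> J" "i \<noteq> k" for i using v'[of i] that by simp
    have "bform w v = bform (\<chi> j. if j \<in> J then 0 else c j) v"
      unfolding w bform_add_left bform_sum_left bform_scale_left using vJ by simp
    also have "\<dots> = (\<Sum>l\<in>UNIV. if l = k then c k * v $ k else 0)"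
      unfolding bform_def using voff k by (intro sum.cong) auto
    finally have "c k * v $ k = 0" using v'[of k] by simp
    then have "v $ k = 0" using ck by simp
    then have "v = 0" using frame_mat_ker[OF det vJ] voff by metis
    then show False using v(1) by blast
  qed
  then have "(\<chi> j. if j \<in> J then 0 else c j) = 0" by (simp add: vec_eq_iff)
  then have w': "w = (\<Sum>k\<in>J. c k *s b k)" using w by simp
  show ?thesis
    unfolding w' by (rule frame_mat_span_zero[OF det]) (use wJ w' in simp)
qed

section \<open>Dimension of the conditional ED correspondence\<close>

text \<open>The coordinates \<open>T\<close>, a basis of \<open>Z\<close> for \<open>x\<close>
  together with \<open>J\<close> for \<open>u\<close>, are independent on the correspondence, which
  gives the lower bound. At a generic point a tangent vector is determined by its \<open>T\<close>
  coordinates, which gives the upper bound. The number of elements of \<open>J\<close> is the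
  codimension of \<open>X\<close>.\<close>

lemma adim_cond_ED_corr:
  fixes X Z :: "(complex ^ 'n) set"
  assumes X: "irreducible_variety X" and Z: "irreducible_variety Z" "Z \<subseteq> X"
    and sing: "\<not> Z \<subseteq> singular_locus X"
  shows "adim (cond_ED_corr X Z) + adim X = adim Z + CARD('n)"
proof -
  define B where "B = cond_incidence X Z"
  define E where "E = cond_ED_corr X Z"
  have IE: "vanishing_ideal E = vanishing_ideal B"
    unfolding E_def B_def cond_ED_corr_eq by (rule vanishing_ideal_closure_of)
  have BE: "B \<subseteq> E" unfolding E_def B_def cond_ED_corr_eq by (rule subset_zariski_closure_of)
  have Bp: "zprime B" unfolding B_def by (rule zprime_cond_incidence[OF assms])
  have Ep: "zprime E" using zprime_cong[OF Bp IE[symmetric]] .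
  have Zp: "zprime Z" using Z irreducible_variety_iff by blast
  have Z0: "zero_locus (vanishing_ideal Z) = Z"
    using Z closedin_zariski_iff[of Z] unfolding irreducible_variety_def by simp
  obtain z where z: "z \<in> Z" "z \<in> smooth_locus X" using sing Z(2) unfolding singular_locus_def by blast
  obtain J \<xi> where \<xi>: "\<And>k. k \<in> J \<Longrightarrow> \<xi> k \<in> gradients X" "card (- J) = adim X"
    "det (frame_mat J (\<lambda>k. \<xi> k z)) \<noteq> 0"
    "\<And>x. x \<in> X \<Longrightarrow> det (frame_mat J (\<lambda>k. \<xi> k x)) \<noteq> 0 \<Longrightarrow> x \<in> smooth_locus X"
    "\<And>x. x \<in> X \<Longrightarrow> det (frame_mat J (\<lambda>k. \<xi> k x)) \<noteq> 0 \<Longrightarrow>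
      tangent_space X x = {v. \<forall>k\<in>J. bform (\<xi> k x) v = 0}"
    by (rule smooth_frame[OF X z(2)], rule that)
  define h where "h = (\<lambda>x. det (frame_mat J (\<lambda>k. \<xi> k x)))"
  note \<xi>_poly = covector_fields_poly_fun[OF covector_fields_gradients \<xi>(1)]
  have h: "poly_fun h" unfolding h_def by (rule poly_fun_det_frame) (rule \<xi>_poly)
  have hZ: "h \<notin> vanishing_ideal Z"
    by (rule poly_fun_not_vanishing[OF z(1)]) (use \<xi>(3) in \<open>simp add: h_def\<close>)
  obtain S g where S: "alg_indep Z S" "card S = adim Z" and g: "poly_fun g" "g \<notin> vanishing_ideal Z"
    and g_inj: "\<And>x v. x \<in> Z \<Longrightarrow> g x \<noteq> 0 \<Longrightarrow> v \<in> tangent_space Z x \<Longrightarrow>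
      (\<And>i. i \<in> S \<Longrightarrow> v $ i = 0) \<Longrightarrow> v = 0"
    using generic_tangent_space[OF Zp] by metis
  define T where "T = Inl ` S \<union> Inr ` J"
  have cardT: "card T = adim Z + card J"
    unfolding T_def S(2)[symmetric]
    by (subst card_Un_disjoint) (auto simp: card_image)
  have "alg_indep B T"
    unfolding alg_indep_def
  proof (intro allI impI)
    fix f assume f: "poly_in T f" "\<forall>p\<in>B. f p = 0"
    have "f p = 0" for p
    proof -
      define u where "u = pr2 p"
      define fu where "fu = (\<lambda>x. f (vpair x u))"
      have fuS: "poly_in S fu"
      proof (rule poly_inI)
        show "poly_fun fu" unfolding fu_def
          by (rule poly_fun_vpair[OF poly_in_imp_poly_fun[OF f(1)]]) (intro poly_fun.intros)+
        show "fu x = fu y" if "\<And>i. i \<in> S \<Longrightarrow> x $ i = y $ i" for x y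
          unfolding fu_def by (rule poly_in_cong[OF f(1)]) (use that in \<open>auto simp: T_def\<close>)
      qed
      have "h x * fu x = 0" if x: "x \<in> Z" for x
      proof (cases "h x = 0")
        case False
        then have det: "det (frame_mat J (\<lambda>k. \<xi> k x)) \<noteq> 0" unfolding h_def .
        have xX: "x \<in> X" using x Z(2) by blast
        \<comment> \<open>Dropping the part of \<open>u - x\<close> that lives outside
          \<open>J\<close> leaves a normal vector with the same \<open>J\<close> coordinates. Since
          \<open>f\<close> sees only these coordinates of \<open>u\<close>, it cannot notice the
          change.\<close>
        obtain c where c: "\<And>j. (u - x) $ j = (\<Sum>k\<in>J. c k *s \<xi> k x) $ j + (if j \<in> J then 0 else c j)"
          using frame_mat_rows[OF det] by blast
        define y where "y = (\<Sum>k\<in>J. c k *s \<xi> k x)"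
        have "y \<in> normal_vectors X x"
          unfolding normal_vectors_def \<xi>(5)[OF xX det] y_def
          by (simp add: bform_sum_left bform_scale_left)
        then have "vpair x (x + y) \<in> B"
          unfolding B_def vpair_in_cond_incidence using x \<xi>(4)[OF xX det] by simp
        then have "f (vpair x (x + y)) = 0" using f(2) by blast
        moreover have "f (vpair x u) = f (vpair x (x + y))"
        proof (rule poly_in_cong[OF f(1)])
          fix i assume "i \<in> T"
          then consider j where "j \<in> S" "i = Inl j" | j where "j \<in> J" "i = Inr j"
            unfolding T_def by blast
          then show "vpair x u $ i = vpair x (x + y) $ i"
          proof cases
            case 2
            then have "(u - x) $ j = y $ j" using c[of j] unfolding y_def by simp
            then show ?thesis using 2 by (simp add: algebra_simps)
          qed simp
        qed
        ultimately show ?thesis unfolding fu_def by simp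
      qed simp
      then have "(\<lambda>x. h x * fu x) \<in> vanishing_ideal Z"
        by (intro vanishing_idealI poly_fun.mult h poly_in_imp_poly_fun[OF fuS])
      then have "fu \<in> vanishing_ideal Z"
        using zprime_mult[OF Zp h poly_in_imp_poly_fun[OF fuS] _ hZ] by blast
      then have "fu = (\<lambda>x. 0)" by (rule alg_indepD[OF S(1) fuS])
      then have "fu (pr1 p) = 0" by simp
      then show "f p = 0" unfolding fu_def u_def by simp
    qed
    then show "f = (\<lambda>x. 0)" by blast
  qed
  then have "alg_indep E T" using BE by (rule alg_indep_mono)
  then have lower: "adim Z + card J \<le> adim E" using card_le_adim cardT by metis
  obtain S' e where e: "poly_fun e" "e \<notin> vanishing_ideal E"
    and e_dim: "\<And>p. p \<in> E \<Longrightarrow> e p \<noteq> 0 \<Longrightarrow> vec.dim (tangent_space E p) = adim E"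
    using generic_tangent_space[OF Ep] by metis
  define m where "m = (\<lambda>x. g x * h x)"
  have m: "poly_fun m" unfolding m_def by (intro poly_fun.mult g h)
  have "(\<lambda>p. m (pr1 p)) \<notin> vanishing_ideal E"
  proof -
    obtain x where x: "x \<in> Z" "g x \<noteq> 0" "h x \<noteq> 0" using zprimeE[OF Zp g(1) h g(2) hZ] .
    then have "vpair x x \<in> B"
      using \<xi>(4)[of x] Z(2) unfolding B_def vpair_in_cond_incidence h_def
      by (auto simp: vec.subspace_0[OF subspace_normal_vectors])
    then have "vpair x x \<in> E" using BE by blast
    then show ?thesis by (rule poly_fun_not_vanishing) (use x in \<open>simp add: m_def\<close>)
  qed
  then obtain p where p: "p \<in> E" "e p \<noteq> 0" "m (pr1 p) \<noteq> 0"
    using zprimeE[OF Ep e(1) poly_fun_pr1[OF m] e(2)] by blast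
  define x where "x = pr1 p"
  have gx: "g x \<noteq> 0" and hx: "h x \<noteq> 0" using p(3) unfolding m_def x_def by simp_all
  then have det: "det (frame_mat J (\<lambda>k. \<xi> k x)) \<noteq> 0" unfolding h_def by blast
  \<comment> \<open>The point \<open>p\<close> lies only in the closure, but the equations of
    \<open>Z\<close> pull back to it, so \<open>pr1 p\<close> is in \<open>Z\<close>.\<close>
  have IZ: "(\<lambda>p. \<phi> (pr1 p)) \<in> vanishing_ideal E" if "\<phi> \<in> vanishing_ideal Z" for \<phi>
    unfolding IE
  proof (rule vanishing_idealI)
    show "poly_fun (\<lambda>p. \<phi> (pr1 p))" by (rule poly_fun_pr1[OF vanishing_idealD(2)[OF that]])
    show "\<phi> (pr1 p) = 0" if "p \<in> B" for p
      using that vanishing_idealD(1)[OF \<open>\<phi> \<in> vanishing_ideal Z\<close>]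
      unfolding B_def cond_incidence_def by auto
  qed
  have "x \<in> zero_locus (vanishing_ideal Z)"
    using vanishing_idealD(1)[OF IZ p(1)] unfolding zero_locus_def x_def by blast
  then have xZ: "x \<in> Z" unfolding Z0 .
  \<comment> \<open>For \<open>k\<close> outside \<open>J\<close> these express that
    \<open>u - x\<close> lies in the span of the frame at \<open>x\<close>.\<close>
  define \<rho> where "\<rho> = (\<lambda>k q. det (row_replace (frame_mat J (\<lambda>j. \<xi> j (pr1 q))) k (pr2 q - pr1 q)))"
  have \<rho>E: "\<rho> k \<in> vanishing_ideal E" if k: "k \<notin> J" for k
  proof -
    have \<rho>: "poly_fun (\<rho> k)"
      unfolding \<rho>_def
    proof (rule poly_fun_det)
      fix i j
      show "poly_fun (\<lambda>q. row_replace (frame_mat J (\<lambda>j. \<xi> j (pr1 q))) k (pr2 q - pr1 q) $ i $ j)"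
      proof (cases "i = k")
        case True
        then show ?thesis by (simp add: row_replace_def poly_fun_intros)
      next
        case False
        then show ?thesis
          by (cases "i \<in> J")
            (simp_all add: row_replace_def frame_mat_def poly_fun.const poly_fun_pr1[OF \<xi>_poly])
      qed
    qed
    \<comment> \<open>The frame spans the normal space only where \<open>h\<close> is nonzero;
      multiplication by \<open>h\<close> covers the other points, and primality removes the factor
      afterwards.\<close>
    have "h (pr1 q) * \<rho> k q = 0" if q: "q \<in> B" for q
    proof (cases "h (pr1 q) = 0")
      case False
      obtain x u where xu: "q = vpair x u" using q unfolding B_def cond_incidence_def by blast
      have x: "x \<in> X" "u - x \<in> normal_vectors X x"
        using q Z(2) unfolding B_def xu vpair_in_cond_incidence by auto
      have det: "det (frame_mat J (\<lambda>k. \<xi> k x)) \<noteq> 0" using False unfolding xu h_def by simp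
      obtain c where "u - x = (\<Sum>k\<in>J. c k *s \<xi> k x)"
        by (rule frame_mat_annihilator[OF det])
          (use x(2) in \<open>auto simp: normal_vectors_def \<xi>(5)[OF x(1) det]\<close>)
      then show ?thesis
        unfolding \<rho>_def xu using det_row_replace_span[OF det k] by simp
    qed simp
    then have "(\<lambda>q. h (pr1 q) * \<rho> k q) \<in> vanishing_ideal E"
      unfolding IE by (intro vanishing_idealI poly_fun.mult \<rho> poly_fun_pr1[OF h])
    moreover have "(\<lambda>q. h (pr1 q)) \<notin> vanishing_ideal E"
      by (rule poly_fun_not_vanishing[OF p(1)]) (use hx x_def in simp)
    ultimately show ?thesis using zprime_mult[OF Ep poly_fun_pr1[OF h] \<rho>] by blast
  qed
  have "w = 0" if w: "w \<in> tangent_space E p" "\<And>i. i \<in> T \<Longrightarrow> w $ i = 0" for w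
  proof -
    have wE: "dd f p w = 0" if "f \<in> vanishing_ideal E" for f
      using w(1) that unfolding tangent_space_eq by blast
    have "pr1 w \<in> tangent_space Z x"
      unfolding tangent_space_eq x_def using wE[OF IZ] by (simp add: dd_pr1)
    then have w1: "pr1 w = 0"
      by (rule g_inj[OF xZ gx]) (simp add: w(2) T_def)
    have "det (row_replace (frame_mat J (\<lambda>k. \<xi> k x)) k (pr2 w)) = 0" if k: "k \<notin> J" for k
    proof -
      let ?M = "frame_mat J (\<lambda>k. \<xi> k x)"
      have "\<rho> k (p + t *s w) = det (row_replace ?M k (pr2 p - pr1 p)) +
          t * det (row_replace ?M k (pr2 w))" for t
      proof -
        \<comment> \<open>As \<open>pr1 w = 0\<close>, the frame stays constant along the line and
          only the replaced row moves.\<close>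
        have 1: "pr1 (p + t *s w) = x"
          unfolding pr_add_scale w1 x_def by simp
        have 2: "pr2 (p + t *s w) - x = (pr2 p - pr1 p) + t *s pr2 w"
          unfolding pr_add_scale x_def by simp
        show ?thesis
          unfolding \<rho>_def 1 2 det_row_replace_affine ..
      qed
      then have "dd (\<rho> k) p w = det (row_replace ?M k (pr2 w))"
        by (intro dd_unique) (auto intro!: derivative_eq_intros)
      then show ?thesis using wE[OF \<rho>E[OF k]] by simp
    qed
    then have "pr2 w = 0"
      by (rule row_replace_dets_zero[OF det]) (simp_all add: w(2) T_def)
    then have "vpair (pr1 w) (pr2 w) = vpair 0 0" using w1 by simp
    then show "w = 0" unfolding vpair_pr by (simp add: vec_eq_iff vpair_def split: sum.split)
  qed
  from dim_le_card_coords[OF subspace_tangent_space this]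
  have "vec.dim (tangent_space E p) \<le> card T" .
  then have "adim E \<le> adim Z + card J" using e_dim[OF p(1,2)] cardT by simp
  moreover have "card J + card (- J) = CARD('n)"
    by (subst card_Un_disjoint[symmetric]) auto
  ultimately show ?thesis using lower \<xi>(2) unfolding E_def by simp
qed

section \<open>The data locus\<close>

text \<open>Independent coordinates on the image pull back to \<open>E\<close>, giving one
  inequality. For the other, the trivial kernel at \<open>p0\<close> spreads to a generic point,
  where the tangent space of \<open>E\<close> embeds into that of the image.\<close>

lemma adim_closure_of_image_pr2:
  fixes E :: "(complex ^ ('n::finite + 'n)) set"
  assumes E: "zprime E" and p0: "p0 \<in> E" "{w \<in> tangent_space E p0. pr2 w = 0} \<subseteq> {0}"
  shows "adim (zariski closure_of (pr2 ` E)) = adim E"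
proof -
  define D where "D = zariski closure_of (pr2 ` E)"
  have ID: "vanishing_ideal D = vanishing_ideal (pr2 ` E)"
    unfolding D_def by (rule vanishing_ideal_closure_of)
  have IDE: "(\<lambda>p. f (pr2 p)) \<in> vanishing_ideal E \<longleftrightarrow> f \<in> vanishing_ideal D" if "poly_fun f" for f
    unfolding ID using that poly_fun_pr2[OF that] by (auto simp: vanishing_ideal_def)
  have DE: "pr2 p \<in> D" if "p \<in> E" for p
    using subset_zariski_closure_of[of "pr2 ` E"] that unfolding D_def by blast
  have Dp: "zprime D"
    using zprime_cong[OF zprime_image[OF E] ID[symmetric]] by (simp add: poly_fun.coord)
  have "adim D \<le> adim E"
  proof -
    obtain S where S: "alg_indep D S" "card S = adim D"
      using adim_basis[of D] Dp unfolding zprime_def by metis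
    have "alg_indep E (Inr ` S)"
      unfolding alg_indep_def
    proof (intro allI impI)
      fix f assume f: "poly_in (Inr ` S) f" "\<forall>p\<in>E. f p = 0"
      \<comment> \<open>Since \<open>f\<close> depends on second components only, the value 0
        inserted for the first component is immaterial.\<close>
      define f' where "f' = (\<lambda>u. f (vpair 0 u))"
      have f': "poly_in S f'"
      proof (rule poly_inI)
        show "poly_fun f'" unfolding f'_def
          by (rule poly_fun_vpair[OF poly_in_imp_poly_fun[OF f(1)]]) (intro poly_fun.intros)+
        show "f' x = f' y" if "\<And>i. i \<in> S \<Longrightarrow> x $ i = y $ i" for x y
          unfolding f'_def by (rule poly_in_cong[OF f(1)]) (use that in auto)
      qed
      have ff': "f p = f' (pr2 p)" for p
        unfolding f'_def by (rule poly_in_cong[OF f(1)]) auto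
      have "(\<lambda>p. f' (pr2 p)) \<in> vanishing_ideal E"
        using f(2) ff' by (intro vanishing_idealI poly_fun_pr2 poly_in_imp_poly_fun[OF f']) auto
      then have "f' \<in> vanishing_ideal D" using IDE[OF poly_in_imp_poly_fun[OF f']] by blast
      then have "f' = (\<lambda>x. 0)" by (rule alg_indepD[OF S(1) f'])
      then show "f = (\<lambda>x. 0)" using ff' by auto
    qed
    then have "card (Inr ` S :: ('n + 'n) set) \<le> adim E" by (rule card_le_adim)
    then show ?thesis using S(2) by (simp add: card_image)
  qed
  moreover have "adim E \<le> adim D"
  proof -
    \<comment> \<open>Constant covectors supported on the second components are added to the
      gradients, so that the annihilator becomes the kernel of \<open>pr2\<close> on the tangent
      space and semicontinuity applies to it.\<close>
    define \<G> where "\<G> = {\<lambda>p. \<xi> p + c | \<xi> c. \<xi> \<in> gradients E \<and> pr1 c = 0}"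
    have \<G>I: "(\<lambda>p. \<xi> p + c) \<in> \<G>" if "\<xi> \<in> gradients E" "pr1 c = 0" for \<xi> c
      unfolding \<G>_def using that by blast
    have \<G>: "covector_fields \<G>"
    proof -
      note cf = covector_fields_gradients[of E, unfolded covector_fields_def]
      have "(\<lambda>p. 0) \<in> \<G>" unfolding \<G>_def using cf by (auto intro!: exI[of _ "\<lambda>p. 0"] exI[of _ 0] simp: vec_eq_iff)
      moreover have "poly_fun (\<lambda>p. \<xi> p $ i)" if "\<xi> \<in> \<G>" for \<xi> i
        using that cf unfolding \<G>_def by (auto intro!: poly_fun.intros)
      moreover have "(\<lambda>p. \<xi> p + \<eta> p) \<in> \<G>" if xe: "\<xi> \<in> \<G>" "\<eta> \<in> \<G>" for \<xi> \<eta>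
      proof -
        obtain \<xi>1 c \<eta>1 d where *: "\<xi> = (\<lambda>p. \<xi>1 p + c)" "\<xi>1 \<in> gradients E" "pr1 c = 0"
          "\<eta> = (\<lambda>p. \<eta>1 p + d)" "\<eta>1 \<in> gradients E" "pr1 d = 0"
          using xe unfolding \<G>_def by blast
        have "(\<lambda>p. \<xi>1 p + \<eta>1 p) \<in> gradients E" using cf *(2,5) by blast
        moreover have "pr1 (c + d) = 0" using *(3,6) by (simp add: vec_eq_iff)
        moreover have "(\<lambda>p. \<xi> p + \<eta> p) = (\<lambda>p. (\<xi>1 p + \<eta>1 p) + (c + d))"
          unfolding * by (simp add: algebra_simps)
        ultimately show ?thesis using \<G>I by simp
      qed
      moreover have "(\<lambda>p. a *s \<xi> p) \<in> \<G>" if xe: "\<xi> \<in> \<G>" for a \<xi>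
      proof -
        obtain \<xi>1 c where *: "\<xi> = (\<lambda>p. \<xi>1 p + c)" "\<xi>1 \<in> gradients E" "pr1 c = 0"
          using xe unfolding \<G>_def by blast
        have "(\<lambda>p. a *s \<xi>1 p) \<in> gradients E" using cf *(2) by blast
        moreover have "pr1 (a *s c) = 0" using *(3) by (simp add: vec_eq_iff)
        moreover have "(\<lambda>p. a *s \<xi> p) = (\<lambda>p. a *s \<xi>1 p + a *s c)"
          unfolding * by (simp add: vec.scale_right_distrib)
        ultimately show ?thesis using \<G>I by simp
      qed
      ultimately show ?thesis unfolding covector_fields_def by blast
    qed
    have ann: "annihilator \<G> p = {w \<in> tangent_space E p. pr2 w = 0}" for p
    proof (intro set_eqI iffI)
      fix w assume w: "w \<in> annihilator \<G> p"
      have wD: "bform (\<eta> p) w = 0" if "\<eta> \<in> \<G>" for \<eta>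
        using w that unfolding annihilator_def by blast
      have "bform (\<xi> p) w = 0" if "\<xi> \<in> gradients E" for \<xi>
      proof -
        have "pr1 0 = 0" by (simp add: vec_eq_iff)
        from \<G>I[OF that this] show ?thesis using w unfolding annihilator_def by auto
      qed
      then have "w \<in> tangent_space E p"
        unfolding annihilator_gradients[symmetric] annihilator_def by blast
      moreover have "w $ Inr i = 0" for i
      proof -
        have "(\<lambda>p. 0) \<in> gradients E" using covector_fields_gradients[of E] unfolding covector_fields_def by blast
        moreover have "pr1 (axis (Inr i) 1) = 0" by (simp add: vec_eq_iff axis_def)
        ultimately have "(\<lambda>p. 0 + axis (Inr i) 1) \<in> \<G>" by (rule \<G>I)
        from wD[OF this] show ?thesis by simp
      qed
      ultimately show "w \<in> {w \<in> tangent_space E p. pr2 w = 0}" by (simp add: vec_eq_iff)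
    next
      fix w assume w: "w \<in> {w \<in> tangent_space E p. pr2 w = 0}"
      have "bform (\<xi> p + c) w = 0" if "\<xi> \<in> gradients E" "pr1 c = 0" for \<xi> c
      proof -
        have "c $ k * w $ k = 0" for k
        proof (cases k)
          case (Inl i)
          then show ?thesis using arg_cong[OF that(2), of "\<lambda>v. v $ i"] by simp
        next
          case (Inr i)
          have "pr2 w $ i = 0" using w by simp
          then show ?thesis using Inr by simp
        qed
        then have "bform c w = 0" unfolding bform_def by (intro sum.neutral) blast
        moreover have "bform (\<xi> p) w = 0"
          using w that(1) unfolding annihilator_gradients[symmetric] annihilator_def by blast
        ultimately show ?thesis by (simp add: bform_add_left)
      qed
      then show "w \<in> annihilator \<G> p" unfolding annihilator_def \<G>_def by blast
    qed
    obtain h where h: "poly_fun h" "h p0 \<noteq> 0"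
      "\<And>p. h p \<noteq> 0 \<Longrightarrow> vec.dim (annihilator \<G> p) \<le> vec.dim (annihilator \<G> p0)"
      using annihilator_semicontinuous[OF \<G>, where p = p0] by blast
    have dim0: "vec.dim (annihilator \<G> p0) = 0" using p0(2) unfolding ann vec.dim_eq_0 .
    obtain S e where e: "poly_fun e" "e \<notin> vanishing_ideal E"
      and e_dim: "\<And>p. p \<in> E \<Longrightarrow> e p \<noteq> 0 \<Longrightarrow> vec.dim (tangent_space E p) = adim E"
      using generic_tangent_space[OF E] by metis
    obtain S' d where d: "poly_fun d" "d \<notin> vanishing_ideal D"
      and d_dim: "\<And>u. u \<in> D \<Longrightarrow> d u \<noteq> 0 \<Longrightarrow> vec.dim (tangent_space D u) = adim D"
      using generic_tangent_space[OF Dp] by metis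
    have "(\<lambda>p. d (pr2 p)) \<notin> vanishing_ideal E" using IDE[OF d(1)] d(2) by blast
    then obtain q where q: "q \<in> E" "e q \<noteq> 0" "d (pr2 q) \<noteq> 0"
      using zprimeE[OF E e(1) poly_fun_pr2[OF d(1)] e(2)] by blast
    have "(\<lambda>p. e p * d (pr2 p)) \<notin> vanishing_ideal E"
      by (rule poly_fun_not_vanishing[OF q(1)]) (use q in simp)
    moreover have "h \<notin> vanishing_ideal E" using h(2) by (rule poly_fun_not_vanishing[OF p0(1)])
    \<comment> \<open>At one point three conditions hold: trivial kernel, generic tangent dimension
      for \<open>E\<close>, and generic tangent dimension for the closure \<open>D\<close> at the
      image.\<close>
    ultimately obtain p where p: "p \<in> E" "h p \<noteq> 0" "e p * d (pr2 p) \<noteq> 0"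
      using zprimeE[OF E h(1) poly_fun.mult[OF e(1) poly_fun_pr2[OF d(1)]]] by blast
    have "vec.dim (annihilator \<G> p) = 0" using h(3)[OF p(2)] dim0 by simp
    then have ker: "{w \<in> tangent_space E p. pr2 w = 0} \<subseteq> {0}" unfolding ann vec.dim_eq_0 .
    have lin: "Vector_Spaces.linear (*s) (*s) (pr2 :: complex ^ ('n + 'n) \<Rightarrow> complex ^ 'n)"
      by (simp add: Vector_Spaces.linear_iff vec.vector_space_axioms vec_eq_iff)
    have span: "vec.span (tangent_space E p) = tangent_space E p"
      using subspace_tangent_space by (simp only: vec.span_eq_iff)
    have "inj_on pr2 (vec.span (tangent_space E p))"
      unfolding span
    proof (rule inj_onI)
      fix v w assume vw: "v \<in> tangent_space E p" "w \<in> tangent_space E p" "pr2 v = pr2 w"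
      have "pr2 (v - w) = 0" using arg_cong[OF vw(3), of "\<lambda>u. u $ i" for i] by (simp add: vec_eq_iff)
      moreover have "v - w \<in> tangent_space E p"
        by (rule vec.subspace_diff[OF subspace_tangent_space vw(1,2)])
      ultimately have "v - w = 0" using ker by blast
      then show "v = w" by simp
    qed
    then have "adim E = vec.dim (pr2 ` tangent_space E p)"
      using vec.dim_image_eq[OF lin] e_dim[OF p(1)] p(3) by simp
    also have "\<dots> \<le> vec.dim (tangent_space D (pr2 p))"
    proof (rule vec.dim_subset, clarify)
      fix w assume w: "w \<in> tangent_space E p"
      have "dd f (pr2 p) (pr2 w) = 0" if "f \<in> vanishing_ideal D" for f
      proof -
        have "(\<lambda>p. f (pr2 p)) \<in> vanishing_ideal E" using that IDE[OF vanishing_idealD(2)[OF that]] by blast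
        then show ?thesis using w unfolding tangent_space_eq dd_pr2[symmetric] by blast
      qed
      then show "pr2 w \<in> tangent_space D (pr2 p)" unfolding tangent_space_eq by blast
    qed
    also have "\<dots> = adim D" using d_dim[OF DE[OF p(1)]] p(3) by simp
    finally show ?thesis .
  qed
  ultimately show ?thesis unfolding D_def by simp
qed

lemma adim_UNIV: "adim (UNIV :: (complex ^ 'n) set) = CARD('n)"
proof (rule antisym)
  obtain S :: "'n set" where "card S = adim (UNIV :: (complex ^ 'n) set)"
    using adim_basis[of "UNIV :: (complex ^ 'n) set"] by blast
  then show "adim (UNIV :: (complex ^ 'n) set) \<le> CARD('n)" by (metis card_mono finite subset_UNIV)
  have "alg_indep (UNIV :: (complex ^ 'n) set) UNIV" by (auto simp: alg_indep_def)
  then show "CARD('n) \<le> adim (UNIV :: (complex ^ 'n) set)" by (rule card_le_adim)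
qed

theorem proposition5p9:
  fixes X Z U :: "(complex ^ 'n) set" and \<delta> :: nat
  assumes "irreducible_variety X"
    and "\<exists>x\<in>smooth_locus X. tangent_space X x \<inter> normal_vectors X x = {0}"
    and "ED_generic_data X U"
    and "irreducible_variety Z" and "Z \<subseteq> X" and "has_codim Z X \<delta>"
    and "ED_regular U X Z"
  shows "irreducible_variety (data_locus X Z) \<and> has_codim (data_locus X Z) UNIV \<delta>"
proof -
  note X = assms(1) and Z = assms(4,5)
  define E where "E = cond_ED_corr X Z"
  have sing: "\<not> Z \<subseteq> singular_locus X" and dl: "\<not> data_locus X Z \<subseteq> UNIV - U"
    using assms(7) unfolding ED_regular_def by blast+
  have "irreducible_variety E"
    unfolding E_def cond_ED_corr_eq
    by (intro irreducible_closure_of zprime_cond_incidence X Z sing)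
  then have Ep: "zprime E" using irreducible_variety_iff by blast
  have D: "data_locus X Z = zariski closure_of (pr2 ` E)"
    unfolding data_locus_def E_def ..
  have irr: "irreducible_variety (data_locus X Z)"
    unfolding D by (intro irreducible_closure_of zprime_image Ep) (simp add: poly_fun.coord)
  have "closedin zariski (UNIV - U)"
    using assms(3) topspace_zariski unfolding ED_generic_data_def by (metis closedin_diff closedin_topspace)
  \<comment> \<open>A closed set containing the projection of \<open>E\<close> would contain its
    closure, so a point of \<open>E\<close> itself, not just of the closure of its image, lies over
    \<open>U\<close>.\<close>
  then have "\<not> pr2 ` E \<subseteq> UNIV - U" using dl closure_of_minimal unfolding D by blast
  then obtain p where p: "p \<in> E" "pr2 p \<in> U" by blast
  have "E \<subseteq> ED_corr X"
    unfolding E_def cond_ED_corr_def ED_corr_def by (rule closure_of_mono) blast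
  then have "pr1 p \<in> critical_locus X (pr2 p)"
    unfolding critical_locus_def using p(1) by blast
  then have "simple_critical_point X (pr2 p) (pr1 p)"
    using assms(3) p(2) unfolding ED_generic_data_def by blast
  then have "{w \<in> tangent_space (ED_corr X) p. pr2 w = 0} = {0}"
    unfolding simple_critical_point_def by simp
  \<comment> \<open>A subvariety has smaller tangent spaces, so simplicity on the full
    correspondence is inherited by the conditional one.\<close>
  then have ker: "{w \<in> tangent_space E p. pr2 w = 0} \<subseteq> {0}"
    using tangent_space_mono[OF \<open>E \<subseteq> ED_corr X\<close>, of p] by blast
  have "adim (data_locus X Z) + adim X = adim Z + CARD('n)"
    using adim_closure_of_image_pr2[OF Ep p(1) ker] adim_cond_ED_corr[OF X Z sing]
    unfolding D E_def by simp
  moreover have "adim X = adim Z + \<delta>"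
    using assms(6) unfolding has_codim_def variety_dim_eq_adim[OF X] variety_dim_eq_adim[OF Z(1)]
    by simp
  ultimately have "CARD('n) = adim (data_locus X Z) + \<delta>" by simp
  moreover have "irreducible_variety (UNIV :: (complex ^ 'n) set)"
    unfolding irreducible_variety_iff using zprime_UNIV closedin_topspace topspace_zariski by metis
  ultimately have "has_codim (data_locus X Z) UNIV \<delta>"
    unfolding has_codim_def variety_dim_eq_adim[OF irr]
    using variety_dim_eq_adim adim_UNIV by (metis plus_enat_simps(1))
  with irr show ?thesis by blast
qed

end
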